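(* Let $\mu\ge 0$, let $n\ge 0$ be an integer, and let $\xi_\nu=\frac{\nu\pi}{n+1}$, $\zeta_\nu=(\cos\xi_\nu,\sin\xi_\nu,0)$ for $0\le\nu\le 2n+1$. Let $f\in L^2(H_\mu;S^2)$ be even in $x_3$, i.e. $f(x_1,x_2,x_3)=f(x_1,x_2,-x_3)$. Then for $\mathbf x=(x_1,x_2,x_3)\in S^2$ the partial sum $Y_n^\mu(f;\mathbf x)=\sum_{k=0}^n\operatorname{proj}_{\mathcal H_k^\mu}f(\mathbf x)$ satisfies $$Y_n^\mu(f;\mathbf x)=\frac{1}{n+1}\sum_{\nu=0}^{n}a_\mu\int_{-1}^1Q^\mu f(\zeta_\nu;t)\,\Phi_n^\mu(\xi_\nu,t;x_1,x_2)\,dt=\frac{1}{2n+2}\sum_{\nu=0}^{2n+1}a_\mu\int_{-1}^1Q^\mu f(\zeta_\nu;t)\,\Phi_n^\mu(\xi_\nu,t;x_1,x_2)\,dt .$$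
   Context: Sphere: $S^2=\{\mathbf x\in\mathbb R^3:\|\mathbf x\|=1\}$ with surface measure $d\omega$ and weight $H_\mu(\mathbf x)=|x_3|^{2\mu}$. $\mathcal H_k^\mu$ is the space of (restrictions to $S^2$ of) homogeneous polynomials of degree $k$ in three variables that are orthogonal, with respect to $H_\mu\,d\omega$ on $S^2$, to all polynomials of degree $<k$; $L^2(H_\mu;S^2)=\bigoplus_{k\ge0}\mathcal H_k^\mu$, and $\operatorname{proj}_{\mathcal H_k^\mu}$ is the orthogonal projection onto $\mathcal H_k^\mu$. Attenuated spherical transform: for $\zeta=(\cos\theta,\sin\theta,0)$ and $-1<t<1$, $Q^\mu f(\zeta;t)$ is the integral of $f(\mathbf x)|x_3|^{2\mu}$ over the circle $\{\mathbf x\in S^2:\langle\mathbf x,\zeta\rangle=t\}$, normalized as $$Q^\mu f(\zeta;t)=\frac12\int_0^{2\pi}f(\mathbf x(\alpha))\,|x_3(\alpha)|^{2\mu}\,d\alpha,$$ $$\mathbf x(\alpha)=\bigl(t\cos\theta-\sqrt{1-t^2}\cos\alpha\sin\theta,\ t\sin\theta+\sqrt{1-t^2}\cos\alpha\cos\theta,\ \sqrt{1-t^2}\sin\alpha\bigr)$$ (defined for a.e. $t$ for $f\in L^2(H_\mu;S^2)$). Disk: $B^2$ is the closed unit disk in $\mathbb R^2$; $W_\mu(x,y)=(1-x^2-y^2)^{\mu-1/2}$; $a_\mu=(\mu+1/2)/\pi=1/\int_{B^2}W_\mu$. $\mathcal V_k^2(W_\mu)$ is the space of polynomials in two variables of degree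 $k$ (together with $0$) orthogonal to all polynomials of degree $<k$ under $\langle P,Q\rangle_\mu=a_\mu\int_{B^2}PQW_\mu\,dx\,dy$. $(a)_k=a(a+1)\cdots(a+k-1)$. $C_k^\lambda$ is the Gegenbauer polynomial of degree $k$, orthogonal for $(1-s^2)^{\lambda-1/2}$ on $[-1,1]$, with $C_k^\lambda(1)=(2\lambda)_k/k!$. $p_l^{(\alpha,\beta)}$ is the Jacobi polynomial of degree $l$ with positive leading coefficient, orthonormal for the weight $(1-t)^\alpha(1+t)^\beta$ normalized to have integral $1$ on $[-1,1]$. Orthonormal basis of $\mathcal V_k^2(W_\mu)$: in polar coordinates $x=r\cos\phi$, $y=r\sin\phi$, $$P_{l,\varepsilon}^k(x,y)=h_{l,k}\,p_l^{(\mu-1/2,\,k-2l)}(2r^2-1)\,r^{k-2l}S_{k-2l,\varepsilon}(\phi),$$ where $S_{j,0}(\phi)=\cos j\phi$, $S_{j,1}(\phi)=\sin j\phi$, $0\le 2l\le k$ if $\varepsilon=0$, $0\le 2l\le k-1$ if $\varepsilon=1$, and $$h_{l,k}^2=\frac1{d_{l,k}}\,\frac{\Gamma(k-2l+\mu+3/2)}{\Gamma(\mu+3/2)\Gamma(k-2l+1)},\quad h_{l,k}>0,\qquad d_{l,k}=\tfrac12\ (2l<k),\quad d_{l,k}=1\ (2l=k).$$ $$\lambda_{l,k}^\mu=\frac{l!\,(k-l)!\,(k-l+\mu+\frac12)}{(\mu+\frac12)_l\,(\mu+\frac32)_{k-l}\,(k+\mu+\frac12)},\qquad D_k^{\mu+1/2}(\xi;x,y)=\sum_{l,\varepsilon}\lambda_{l,k}^\mu\,P_{l,\varepsilon}^k(\cos\xi,\sin\xi)\,P_{l,\varepsilon}^k(x,y)$$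 (sum over all admissible pairs $(l,\varepsilon)$), and $$\Phi_n^\mu(\xi,t;x,y)=\sum_{k=0}^n\frac{k+\mu+1/2}{\mu+1/2}\,C_k^{\mu+1/2}(t)\,D_k^{\mu+1/2}(\xi;x,y).$$ *)

theory Defs
  imports "HOL-Analysis.Analysis" "HOL-Computational_Algebra.Polynomial"
begin

definition sphere_param :: "real \<times> real \<Rightarrow> real ^ 3" where
  "sphere_param = (\<lambda>(\<theta>, \<phi>). vector [sin \<theta> * cos \<phi>, sin \<theta> * sin \<phi>, cos \<theta>])"

text \<open>Surface measure: the image of \<open>sin \<theta> d\<theta> d\<phi>\<close> under spherical coordinates. It is completed, so
  that every Lebesgue measurable function on the sphere is covered; the integrals in the spherical
  transform are accordingly taken against \<open>lebesgue\<close>.\<close>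

definition surface_measure :: "(real ^ 3) measure" where
  "surface_measure = completion
     (distr (density lborel (\<lambda>(\<theta>, \<phi>). ennreal (sin \<theta>) * indicator ({0..pi} \<times> {0..2 * pi}) (\<theta>, \<phi>)))
       (restrict_space borel (sphere 0 1)) sphere_param)"

text \<open>The case distinction is needed since \<open>0 powr 0 = 0\<close>.\<close>

definition sphere_weight :: "real \<Rightarrow> real ^ 3 \<Rightarrow> real" where
  "sphere_weight \<mu> x = (if \<mu> = 0 then 1 else \<bar>x $ 3\<bar> powr (2 * \<mu>))"

definition sphere_inner :: "real \<Rightarrow> (real ^ 3 \<Rightarrow> real) \<Rightarrow> (real ^ 3 \<Rightarrow> real) \<Rightarrow> real" where
  "sphere_inner \<mu> f g = (LINT x|surface_measure. f x * g x * sphere_weight \<mu> x)"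

text \<open>Square integrable functions themselves, not classes modulo null sets.\<close>

definition sphere_L2 :: "real \<Rightarrow> (real ^ 3 \<Rightarrow> real) set" where
  "sphere_L2 \<mu> = {f \<in> borel_measurable surface_measure.
     integrable surface_measure (\<lambda>x. (f x)\<^sup>2 * sphere_weight \<mu> x)}"

text \<open>Polynomial functions in three variables whose exponents all lie in the finite set \<open>A\<close>.\<close>

definition poly3 :: "(nat \<times> nat \<times> nat) set \<Rightarrow> (real ^ 3 \<Rightarrow> real) set" where
  "poly3 A = {p. \<exists>c. p = (\<lambda>x. \<Sum>(i, j, m)\<in>A. c i j m * x $ 1 ^ i * x $ 2 ^ j * x $ 3 ^ m)}"

definition homogeneous_poly3 :: "nat \<Rightarrow> (real ^ 3 \<Rightarrow> real) set" where
  "homogeneous_poly3 k = poly3 {(i, j, m). i + j + m = k}"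

definition poly3_degree_less :: "nat \<Rightarrow> (real ^ 3 \<Rightarrow> real) set" where
  "poly3_degree_less k = poly3 {(i, j, m). i + j + m < k}"

text \<open>Restricting to the sphere makes the elements, and hence the projection below, unique as
  functions.\<close>

definition sphere_harmonics :: "real \<Rightarrow> nat \<Rightarrow> (real ^ 3 \<Rightarrow> real) set" where
  "sphere_harmonics \<mu> k = {restrict p (sphere 0 1) | p.
     p \<in> homogeneous_poly3 k \<and> (\<forall>q \<in> poly3_degree_less k. sphere_inner \<mu> p q = 0)}"

definition proj_harmonics :: "real \<Rightarrow> nat \<Rightarrow> (real ^ 3 \<Rightarrow> real) \<Rightarrow> real ^ 3 \<Rightarrow> real" where
  "proj_harmonics \<mu> k f = (THE g. g \<in> sphere_harmonics \<mu> k \<and>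
     (\<forall>q \<in> sphere_harmonics \<mu> k. sphere_inner \<mu> (\<lambda>x. f x - g x) q = 0))"

definition partial_sum :: "real \<Rightarrow> nat \<Rightarrow> (real ^ 3 \<Rightarrow> real) \<Rightarrow> real ^ 3 \<Rightarrow> real" where
  "partial_sum \<mu> n f x = (\<Sum>k=0..n. proj_harmonics \<mu> k f x)"

definition equator_point :: "real \<Rightarrow> real ^ 3" where
  "equator_point \<theta> = vector [cos \<theta>, sin \<theta>, 0]"

text \<open>For \<open>\<zeta>\<close> on the equator this parametrizes the circle \<open>{x \<in> S\<^sup>2. \<langle>x, \<zeta>\<rangle> = t}\<close>.\<close>

definition circle_point :: "real ^ 3 \<Rightarrow> real \<Rightarrow> real \<Rightarrow> real ^ 3" where
  "circle_point \<zeta> t \<alpha> = vector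
     [t * \<zeta> $ 1 - sqrt (1 - t\<^sup>2) * cos \<alpha> * \<zeta> $ 2,
      t * \<zeta> $ 2 + sqrt (1 - t\<^sup>2) * cos \<alpha> * \<zeta> $ 1,
      sqrt (1 - t\<^sup>2) * sin \<alpha>]"

definition spherical_transform :: "real \<Rightarrow> (real ^ 3 \<Rightarrow> real) \<Rightarrow> real ^ 3 \<Rightarrow> real \<Rightarrow> real" where
  "spherical_transform \<mu> f \<zeta> t = 1 / 2 * (LINT \<alpha>:{0..2 * pi}|lebesgue.
     f (circle_point \<zeta> t \<alpha>) * sphere_weight \<mu> (circle_point \<zeta> t \<alpha>))"

definition gegenbauer :: "real \<Rightarrow> nat \<Rightarrow> real poly" where
  "gegenbauer a k = (THE p. degree p = k \<and>
     (\<forall>q. degree q < k \<longrightarrow>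
        (LINT s:{-1..1}|lborel. poly p s * poly q s * (1 - s\<^sup>2) powr (a - 1 / 2)) = 0) \<and>
     poly p 1 = pochhammer (2 * a) k / fact k)"

definition jacobi_weight :: "real \<Rightarrow> real \<Rightarrow> real \<Rightarrow> real" where
  "jacobi_weight \<alpha> \<beta> t = (1 - t) powr \<alpha> * (1 + t) powr \<beta>"

definition jacobi_inner :: "real \<Rightarrow> real \<Rightarrow> real poly \<Rightarrow> real poly \<Rightarrow> real" where
  "jacobi_inner \<alpha> \<beta> p q =
     (LINT t:{-1..1}|lborel. poly p t * poly q t * jacobi_weight \<alpha> \<beta> t) /
     (LINT t:{-1..1}|lborel. jacobi_weight \<alpha> \<beta> t)"

definition jacobi_orthonormal :: "real \<Rightarrow> real \<Rightarrow> nat \<Rightarrow> real poly" where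
  "jacobi_orthonormal \<alpha> \<beta> l = (THE p. degree p = l \<and> lead_coeff p > 0 \<and>
     (\<forall>q. degree q < l \<longrightarrow> jacobi_inner \<alpha> \<beta> p q = 0) \<and> jacobi_inner \<alpha> \<beta> p p = 1)"

text \<open>The reciprocal of the integral of \<open>(1 - x\<^sup>2 - y\<^sup>2) powr (\<mu> - 1/2)\<close> over the unit disk; for the weight so
  normalized, the functions \<open>disk_basis \<mu> k l \<epsilon>\<close> below are orthonormal.\<close>

definition disk_const :: "real \<Rightarrow> real" where
  "disk_const \<mu> = (\<mu> + 1 / 2) / pi"

definition trig_factor :: "nat \<Rightarrow> nat \<Rightarrow> real \<Rightarrow> real" where
  "trig_factor j \<epsilon> \<phi> = (if \<epsilon> = 0 then cos (real j * \<phi>) else sin (real j * \<phi>))"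

definition basis_norm_const :: "real \<Rightarrow> nat \<Rightarrow> nat \<Rightarrow> real" where
  "basis_norm_const \<mu> l k = sqrt (1 / (if 2 * l < k then 1 / 2 else 1) *
     (Gamma (real (k - 2 * l) + \<mu> + 3 / 2) / (Gamma (\<mu> + 3 / 2) * Gamma (real (k - 2 * l) + 1))))"

definition disk_basis_polar :: "real \<Rightarrow> nat \<Rightarrow> nat \<Rightarrow> nat \<Rightarrow> real \<Rightarrow> real \<Rightarrow> real" where
  "disk_basis_polar \<mu> k l \<epsilon> r \<phi> = basis_norm_const \<mu> l k *
     poly (jacobi_orthonormal (\<mu> - 1 / 2) (real (k - 2 * l)) l) (2 * r\<^sup>2 - 1) *
     r ^ (k - 2 * l) * trig_factor (k - 2 * l) \<epsilon> \<phi>"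

text \<open>At the origin, where the polar angle is arbitrary, the factor \<open>r ^ j * trig_factor j \<epsilon> \<phi>\<close> does not
  depend on it for the index pairs in \<open>basis_indices\<close>.\<close>

definition disk_basis :: "real \<Rightarrow> nat \<Rightarrow> nat \<Rightarrow> nat \<Rightarrow> real \<Rightarrow> real \<Rightarrow> real" where
  "disk_basis \<mu> k l \<epsilon> x y =
     disk_basis_polar \<mu> k l \<epsilon> (cmod (Complex x y)) (Arg (Complex x y))"

definition disk_multiplier :: "real \<Rightarrow> nat \<Rightarrow> nat \<Rightarrow> real" where
  "disk_multiplier \<mu> l k =
     (fact l * fact (k - l) * (real (k - l) + \<mu> + 1 / 2)) /
     (pochhammer (\<mu> + 1 / 2) l * pochhammer (\<mu> + 3 / 2) (k - l) * (real k + \<mu> + 1 / 2))"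

definition basis_indices :: "nat \<Rightarrow> (nat \<times> nat) set" where
  "basis_indices k = {(l, \<epsilon>). (\<epsilon> = 0 \<and> 2 * l \<le> k) \<or> (\<epsilon> = 1 \<and> 2 * l + 1 \<le> k)}"

definition kernel_D :: "real \<Rightarrow> nat \<Rightarrow> real \<Rightarrow> real \<Rightarrow> real \<Rightarrow> real" where
  "kernel_D \<mu> k \<xi> x y = (\<Sum>(l, \<epsilon>)\<in>basis_indices k.
     disk_multiplier \<mu> l k * disk_basis \<mu> k l \<epsilon> (cos \<xi>) (sin \<xi>) * disk_basis \<mu> k l \<epsilon> x y)"

definition kernel_Phi :: "real \<Rightarrow> nat \<Rightarrow> real \<Rightarrow> real \<Rightarrow> real \<Rightarrow> real \<Rightarrow> real" where
  "kernel_Phi \<mu> n \<xi> t x y = (\<Sum>k=0..n. (real k + \<mu> + 1 / 2) / (\<mu> + 1 / 2) *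
     poly (gegenbauer (\<mu> + 1 / 2) k) t * kernel_D \<mu> k \<xi> x y)"

definition view_angle :: "nat \<Rightarrow> nat \<Rightarrow> real" where
  "view_angle n \<nu> = real \<nu> * pi / (real n + 1)"

end

theory Submission
  imports Defs
begin

text \<open>
  On functions that are even in the third coordinate, the weighted sphere is the weighted disk. Slicing
  the sphere by the circles orthogonal to an equatorial direction \<open>\<zeta>\<close> turns the integral of
  \<open>Q f (\<zeta>; t) g t\<close> over \<open>t\<close> into the mean of \<open>f u * g \<langle>u, \<zeta>\<rangle>\<close>. For a polynomial \<open>P\<close> of degree \<open>k\<close> orthogonal
  to lower degrees, the mean of \<open>P\<close> over these circles is, up to the factor \<open>P \<zeta>\<close>, a Gegenbauer polynomial
  in \<open>t\<close> (Funk--Hecke), so the ridge polynomial \<open>(k + \<mu> + 1/2) / (\<mu> + 1/2) * C\<^sub>k \<langle>u, \<zeta>\<rangle>\<close> equals the sum of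
  \<open>P u * P \<zeta>\<close> over the orthonormal basis of degree \<open>k\<close>. On the unit circle the basis functions are trigonometric
  of degree at most \<open>n\<close>, hence averaging over the directions \<open>\<zeta>\<^sub>\<nu>\<close> is an exact quadrature: it reproduces
  orthogonality up to the normalization \<open>1 / \<lambda>\<close>, which comes from the value at \<open>1\<close> of the Jacobi polynomials.
  Therefore the average of \<open>\<Phi>\<^sub>n\<close> is the reproducing kernel of the polynomials of degree at most \<open>n\<close>.
\<close>

section \<open>Jacobi and Gegenbauer polynomials\<close>

text \<open>On the sphere every polynomial is g + x3 h with g and h in the first two variables, and
  only g matters against an even \<open>f\<close>. The projection is defined by \<open>THE\<close>,
  so uniqueness must still exclude the part x3 h; this is why the weight with parameter \<mu> + 1
  appears near the end. Half of the directions suffice because the kernel pairs only basis functions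
  of one degree \<open>k\<close>: their angular frequencies have the parity of \<open>k\<close>, so
  sums and differences of frequencies are even. No dimension is counted: completeness of the basis
  is an induction over the generators (x^2 + y^2)^s times the real or imaginary part of (x + i y)^m,
  while the slices by circles use the monomials. \<open>f\<close> is measurable only for a completed
  measure and even only almost everywhere, so it is exchanged for a Borel function. Coordinate
  changes are proved for nonnegative integrands, where Fubini needs no integrability, and then
  restated as equalities of measures. Finitely many points are excluded repeatedly, because of
  \<open>0 powr 0 = 0\<close> or because a circle shrinks to a point.\<close>

lemma has_bochner_integral_jacobi_weight:
  fixes \<alpha> \<beta> :: real
  assumes "\<alpha> > -1" "\<beta> > -1"
  shows "has_bochner_integral lborel (\<lambda>t. indicator {-1..1} t * jacobi_weight \<alpha> \<beta> t)
           (2 powr (\<alpha> + \<beta> + 1) * Beta (\<alpha> + 1) (\<beta> + 1))"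
proof -
  define f :: "real \<Rightarrow> real" where "f = (\<lambda>x. x powr \<alpha> * (1 - x) powr \<beta>)"
  have f_int: "(f has_integral Beta (\<alpha> + 1) (\<beta> + 1)) {0..1}"
    using has_integral_Beta_real[of "\<alpha> + 1" "\<beta> + 1"] assms by (simp add: f_def)
  have f_meas [measurable]: "f \<in> borel_measurable borel" unfolding f_def by measurable
  have f_nonneg: "f x \<ge> 0" for x by (simp add: f_def)
  have "(\<lambda>x. if x \<in> {0..1} then f x else 0) = (\<lambda>x. indicator {0..1} x * f x)" by auto
  hence "((\<lambda>x. indicator {0..1} x * f x) has_integral Beta (\<alpha> + 1) (\<beta> + 1)) UNIV"
    using f_int has_integral_restrict_UNIV[of "{0..1}" f] by simp
  hence "integral\<^sup>N lborel (\<lambda>x. ennreal (indicator {0..1} x * f x)) = Beta (\<alpha> + 1) (\<beta> + 1)"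
    using f_nonneg by (intro nn_integral_has_integral_lborel) auto
  moreover have "Beta (\<alpha> + 1) (\<beta> + 1) \<ge> 0"
    using has_integral_nonneg[OF f_int] f_nonneg by simp
  ultimately have "has_bochner_integral lborel (\<lambda>x. indicator {0..1} x * f x) (Beta (\<alpha> + 1) (\<beta> + 1))"
    using f_nonneg by (intro has_bochner_integral_nn_integral) auto
  \<comment> \<open>The map x = (1 - s)/2 carries the Beta integrand to the Jacobi weight. Its
    Jacobian 1/2 raises the exponent of 2 from \<alpha> + \<beta> to \<alpha> + \<beta> + 1.\<close>
  hence "has_bochner_integral lborel (\<lambda>s. indicator {0..1} (1/2 + (-1/2) * s) * f (1/2 + (-1/2) * s))
           (Beta (\<alpha> + 1) (\<beta> + 1) /\<^sub>R \<bar>-1/2\<bar>)"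
    by (subst (asm) lborel_has_bochner_integral_real_affine_iff[of "-1/2" _ _ "1/2"]) auto
  from has_bochner_integral_mult_right[OF this, of "2 powr (\<alpha> + \<beta>)"]
  have "has_bochner_integral lborel
      (\<lambda>s. 2 powr (\<alpha> + \<beta>) * (indicator {0..1} (1/2 + (-1/2) * s) * f (1/2 + (-1/2) * s)))
      (2 powr (\<alpha> + \<beta> + 1) * Beta (\<alpha> + 1) (\<beta> + 1))"
    by (simp add: powr_add mult.assoc)
  moreover have "2 powr (\<alpha> + \<beta>) * (indicator {0..1} (1/2 + (-1/2) * s) * f (1/2 + (-1/2) * s)) =
      indicator {-1..1} s * jacobi_weight \<alpha> \<beta> s" for s
  proof (cases "s \<in> {-1..1}")
    case True
    have "1/2 + (-1/2) * s = (1 - s) / 2" "1 - (1/2 + (-1/2) * s) = (1 + s) / 2"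
      by (simp_all add: field_simps)
    thus ?thesis using True
      by (simp add: f_def jacobi_weight_def powr_divide powr_add field_simps)
  qed (auto simp: indicator_def)
  ultimately show ?thesis by simp
qed

text \<open>\<open>jacobi_inner\<close> depends only on the product of its arguments. As a linear
  functional of one polynomial it lets identities in the ring of polynomials carry the
  computations.\<close>

definition jacobi_functional :: "real \<Rightarrow> real \<Rightarrow> real poly \<Rightarrow> real" where
  "jacobi_functional \<alpha> \<beta> p = (LINT t:{-1..1}|lborel. poly p t * jacobi_weight \<alpha> \<beta> t) /
     (LINT t:{-1..1}|lborel. jacobi_weight \<alpha> \<beta> t)"

text \<open>The hypergeometric polynomial 2F1(-l, l + \<alpha> + \<beta> + 1; \<alpha> + 1; (1 -
  t)/2), that is, the Jacobi polynomial scaled to the value 1 at t = 1. The list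
  \<open>[:1/2, -1/2:]\<close> is (1 - t)/2, and \<open>[:1/2, 1/2:]\<close> is (1 + t)/2.\<close>

definition jacobi_poly :: "real \<Rightarrow> real \<Rightarrow> nat \<Rightarrow> real poly" where
  "jacobi_poly \<alpha> \<beta> l = (\<Sum>k\<le>l. smult (pochhammer (- real l) k * pochhammer (l + \<alpha> + \<beta> + 1) k /
     (pochhammer (\<alpha> + 1) k * fact k)) ([:1/2, -1/2:] ^ k))"

lemma pochhammer_neg_of_nat_self: "pochhammer (- real l) l = (-1) ^ l * fact l"
  using pochhammer_minus[of "real l" l] by (simp add: pochhammer_fact)

text \<open>The factor with index l - m - 1 is zero. This vanishing is the source of the
  orthogonality of \<open>jacobi_poly\<close>.\<close>

lemma pochhammer_of_int_neg_eq_0: "m < l \<Longrightarrow> pochhammer (real m + 1 - real l) l = 0"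
  by (rule pochhammer_eq_0_iff[THEN iffD2], rule exI[of _ "l - m - 1"]) auto

text \<open>Substitute t = 2 s - 1 and expand in powers of s = (1 + t)/2. These powers are
  convenient test polynomials, since multiplying by them only raises the exponent \<beta> of the
  weight.\<close>

lemma poly_expand_half:
  fixes q :: "real poly"
  shows "q = (\<Sum>m\<le>degree q. smult (coeff (pcompose q [:-1, 2:]) m) ([:1/2, 1/2:] ^ m))"
proof -
  have "q = pcompose (pcompose q [:-1, 2:]) [:1/2, 1/2:]"
    unfolding pcompose_assoc[symmetric] by (simp add: pcompose_pCons)
  also have "\<dots> = (\<Sum>m\<le>degree (pcompose q [:-1, 2:]). smult (coeff (pcompose q [:-1, 2:]) m) ([:1/2, 1/2:] ^ m))"
    by (subst pcompose_altdef) (simp add: poly_altdef coeff_map_poly degree_map_poly)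
  also have "degree (pcompose q [:-1, 2:]) = degree q" by (simp add: degree_pcompose)
  finally show ?thesis .
qed

context
  fixes \<alpha> \<beta> :: real
  assumes \<alpha>: "\<alpha> > -1" and \<beta>: "\<beta> > -1"
begin

lemma set_integrable_jacobi_weight: "set_integrable lborel {-1..1} (jacobi_weight \<alpha> \<beta>)"
  using has_bochner_integral_jacobi_weight[OF \<alpha> \<beta>]
  by (simp add: set_integrable_def has_bochner_integral_iff)

lemma integral_jacobi_weight:
  "(LINT t:{-1..1}|lborel. jacobi_weight \<alpha> \<beta> t) = 2 powr (\<alpha> + \<beta> + 1) * Beta (\<alpha> + 1) (\<beta> + 1)"
  using has_bochner_integral_jacobi_weight[OF \<alpha> \<beta>]
  by (simp add: set_lebesgue_integral_def has_bochner_integral_iff)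

lemma integral_jacobi_weight_pos: "(LINT t:{-1..1}|lborel. jacobi_weight \<alpha> \<beta> t) > 0"
  unfolding integral_jacobi_weight Beta_def using \<alpha> \<beta> by (auto intro!: mult_pos_pos divide_pos_pos Gamma_real_pos)

lemma set_integrable_poly_jacobi_weight:
  "set_integrable lborel {-1..1} (\<lambda>t. poly p t * jacobi_weight \<alpha> \<beta> t)"
proof -
  have "compact (poly p ` {-1..1})" by (intro compact_continuous_image continuous_intros) auto
  hence "bounded (poly p ` {-1..1})" by (rule compact_imp_bounded)
  then obtain B where B: "\<And>t. t \<in> {-1..1} \<Longrightarrow> \<bar>poly p t\<bar> \<le> B"
    unfolding bounded_iff by (metis imageI real_norm_def)
  have [measurable]: "poly p \<in> borel_measurable borel" "jacobi_weight \<alpha> \<beta> \<in> borel_measurable borel"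
    unfolding jacobi_weight_def by (auto intro!: borel_measurable_continuous_onI continuous_intros)
  have "set_integrable lborel {-1..1} (\<lambda>t. B * jacobi_weight \<alpha> \<beta> t)"
    using set_integrable_jacobi_weight by simp
  thus ?thesis unfolding set_integrable_def
  proof (rule Bochner_Integration.integrable_bound)
    show "AE t in lborel. norm (indicator {-1..1} t *\<^sub>R (poly p t * jacobi_weight \<alpha> \<beta> t))
            \<le> norm (indicator {-1..1} t *\<^sub>R (B * jacobi_weight \<alpha> \<beta> t))"
    proof (intro AE_I2)
      fix t :: real
      show "norm (indicator {-1..1} t *\<^sub>R (poly p t * jacobi_weight \<alpha> \<beta> t))
            \<le> norm (indicator {-1..1} t *\<^sub>R (B * jacobi_weight \<alpha> \<beta> t))"
        using B[of t] by (auto simp: indicator_def abs_mult intro!: mult_right_mono split: if_splits)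
    qed
  qed measurable
qed

lemma jacobi_functional_add:
  "jacobi_functional \<alpha> \<beta> (p + q) = jacobi_functional \<alpha> \<beta> p + jacobi_functional \<alpha> \<beta> q"
  using set_integrable_poly_jacobi_weight[of p] set_integrable_poly_jacobi_weight[of q]
  by (simp add: jacobi_functional_def ring_distribs set_integral_add add_divide_distrib)

lemma jacobi_functional_smult:
  "jacobi_functional \<alpha> \<beta> (smult c p) = c * jacobi_functional \<alpha> \<beta> p"
  by (simp add: jacobi_functional_def mult.assoc)

lemma jacobi_functional_0: "jacobi_functional \<alpha> \<beta> 0 = 0"
  using jacobi_functional_smult[of 0 0] by simp

lemma jacobi_functional_diff:
  "jacobi_functional \<alpha> \<beta> (p - q) = jacobi_functional \<alpha> \<beta> p - jacobi_functional \<alpha> \<beta> q"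
  using jacobi_functional_add[of p "smult (-1) q"] jacobi_functional_smult[of "-1" q] by simp

lemma jacobi_functional_sum:
  "jacobi_functional \<alpha> \<beta> (\<Sum>i\<in>A. f i) = (\<Sum>i\<in>A. jacobi_functional \<alpha> \<beta> (f i))"
  by (induction A rule: infinite_finite_induct)
     (auto simp: jacobi_functional_0 jacobi_functional_add)

text \<open>The two powers shift the exponents of the weight, so the value is a quotient of Beta
  functions; the quotients of Gamma values in it are Pochhammer symbols.\<close>

lemma jacobi_functional_moment:
  "jacobi_functional \<alpha> \<beta> ([:1/2, -1/2:] ^ a * [:1/2, 1/2:] ^ b) =
     pochhammer (\<alpha> + 1) a * pochhammer (\<beta> + 1) b / pochhammer (\<alpha> + \<beta> + 2) (a + b)"
proof -
  have eq: "poly ([:1/2, -1/2:] ^ a * [:1/2, 1/2:] ^ b) t * jacobi_weight \<alpha> \<beta> t =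
      (1/2) ^ (a + b) * jacobi_weight (\<alpha> + a) (\<beta> + b) t" if "t \<in> {-1..1}" for t :: real
  proof -
    \<comment> \<open>At t = 1 both sides are 0, because \<open>0 powr\<close> is 0 for every
      exponent, also a negative one. The other endpoint is handled alike below.\<close>
    have "(1 - t) ^ a * (1 - t) powr \<alpha> = (1 - t) powr (\<alpha> + a)"
      using that by (cases "t = 1") (auto simp: powr_add powr_realpow)
    moreover have "(1 + t) ^ b * (1 + t) powr \<beta> = (1 + t) powr (\<beta> + b)"
      using that by (cases "t = -1") (auto simp: powr_add powr_realpow)
    ultimately show ?thesis
      by (simp add: jacobi_weight_def power_add mult_ac
        diff_divide_distrib[symmetric] add_divide_distrib[symmetric] power_divide)
  qed
  have "(LINT t:{-1..1}|lborel. poly ([:1/2, -1/2:] ^ a * [:1/2, 1/2:] ^ b) t * jacobi_weight \<alpha> \<beta> t)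
     = (LINT t:{-1..1}|lborel. (1/2) ^ (a + b) * jacobi_weight (\<alpha> + a) (\<beta> + b) t)"
    by (intro set_lebesgue_integral_cong) (use eq in auto)
  also have "\<dots> = (1/2) ^ (a + b) * (2 powr (\<alpha> + a + (\<beta> + b) + 1) * Beta (\<alpha> + a + 1) (\<beta> + b + 1))"
    using has_bochner_integral_jacobi_weight[of "\<alpha> + a" "\<beta> + b"] \<alpha> \<beta>
    by (simp add: set_lebesgue_integral_def has_bochner_integral_iff)
  also have "\<dots> = 2 powr (\<alpha> + \<beta> + 1) * Beta (\<alpha> + a + 1) (\<beta> + b + 1)"
  proof -
    have "2 powr (\<alpha> + a + (\<beta> + b) + 1) = 2 powr (\<alpha> + \<beta> + 1) * 2 ^ (a + b)"
      by (simp add: powr_add powr_realpow power_add)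
    thus ?thesis by (simp add: power_add field_simps)
  qed
  finally have "jacobi_functional \<alpha> \<beta> ([:1/2, -1/2:] ^ a * [:1/2, 1/2:] ^ b) =
      Beta (\<alpha> + a + 1) (\<beta> + b + 1) / Beta (\<alpha> + 1) (\<beta> + 1)"
    unfolding jacobi_functional_def integral_jacobi_weight by simp
  moreover have "pochhammer (\<alpha> + 1) a = Gamma (\<alpha> + a + 1) / Gamma (\<alpha> + 1)"
    using \<alpha> by (subst pochhammer_Gamma) (auto simp: add_ac nonpos_Ints_def)
  moreover have "pochhammer (\<beta> + 1) b = Gamma (\<beta> + b + 1) / Gamma (\<beta> + 1)"
    using \<beta> by (subst pochhammer_Gamma) (auto simp: add_ac nonpos_Ints_def)
  moreover have "pochhammer (\<alpha> + \<beta> + 2) (a + b) = Gamma (\<alpha> + a + 1 + (\<beta> + b + 1)) / Gamma (\<alpha> + 1 + (\<beta> + 1))"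
    using \<alpha> \<beta> by (subst pochhammer_Gamma) (auto simp: add_ac nonpos_Ints_def)
  ultimately show ?thesis
    by (simp add: Beta_def)
qed

lemma jacobi_functional_square_nonneg: "jacobi_functional \<alpha> \<beta> (p * p) \<ge> 0"
  unfolding jacobi_functional_def set_lebesgue_integral_def
  by (auto intro!: divide_nonneg_nonneg Bochner_Integration.integral_nonneg simp: jacobi_weight_def)

text \<open>The weight is positive on the open interval, so \<open>p\<close> would vanish almost
  everywhere there; a nonzero polynomial has only finitely many roots.\<close>

lemma jacobi_functional_square_eq_0:
  assumes "jacobi_functional \<alpha> \<beta> (p * p) = 0"
  shows "p = 0"
proof (rule ccontr)
  assume "p \<noteq> 0"
  let ?g = "\<lambda>t. indicator {-1..1} t *\<^sub>R (poly (p * p) t * jacobi_weight \<alpha> \<beta> t)"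
  have "integral\<^sup>L lborel ?g = 0"
    using assms integral_jacobi_weight_pos
    by (auto simp: jacobi_functional_def set_lebesgue_integral_def)
  hence "AE t in lborel. ?g t = 0"
    using set_integrable_poly_jacobi_weight[of "p * p"]
    by (subst (asm) integral_nonneg_eq_0_iff_AE) (auto simp: jacobi_weight_def set_integrable_def)
  moreover have "AE t in lborel. t \<notin> {t. poly p t = 0}"
    using poly_roots_finite[OF \<open>p \<noteq> 0\<close>] by (intro AE_not_in finite_imp_null_set_lborel)
  ultimately have "AE t in lborel. t \<notin> {-1<..<1::real}"
    by eventually_elim (auto simp: jacobi_weight_def)
  hence "emeasure lborel {-1<..<1::real} = 0"
    by (subst (asm) AE_iff_measurable[OF _ refl]) (auto simp: Collect_conj_eq greaterThanLessThan_eq greaterThan_def lessThan_def)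
  thus False by simp
qed

lemma jacobi_poly_1: "poly (jacobi_poly \<alpha> \<beta> l) 1 = 1"
proof -
  have "poly (jacobi_poly \<alpha> \<beta> l) 1 = (\<Sum>k\<le>l. if k = 0 then 1 else 0)"
    unfolding jacobi_poly_def poly_sum by (intro sum.cong) (auto simp: power_0_left)
  thus ?thesis by simp
qed

lemma pochhammer_jacobi_pos: "pochhammer (l + \<alpha> + \<beta> + 1) l > 0"
  using \<alpha> \<beta> by (cases l) (auto intro!: pochhammer_pos)

lemma coeff_jacobi_poly:
  "coeff (jacobi_poly \<alpha> \<beta> l) l = pochhammer (l + \<alpha> + \<beta> + 1) l / (2 ^ l * pochhammer (\<alpha> + 1) l)"
proof -
  have deg: "degree ([:1/2, -(1/2)::real:] ^ k) = k" for k
    by (simp add: degree_power_eq)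
  have "coeff (jacobi_poly \<alpha> \<beta> l) l = (\<Sum>k\<le>l. if k = l then
     pochhammer (- real l) l * pochhammer (l + \<alpha> + \<beta> + 1) l / (pochhammer (\<alpha> + 1) l * fact l) * coeff ([:1/2, -1/2:] ^ l) l else 0)"
    unfolding jacobi_poly_def coeff_sum by (intro sum.cong) (auto simp: coeff_eq_0 deg)
  also have "coeff ([:1/2, -1/2::real:] ^ l) l = (-1/2) ^ l"
    using lead_coeff_power[of "[:1/2, -1/2::real:]" l] deg[of l] by simp
  also have "(-1/2) ^ l = (-1) ^ l * (1/2 :: real) ^ l" by (simp flip: power_mult_distrib)
  finally show ?thesis
    by (cases "even l") (auto simp: pochhammer_neg_of_nat_self power_divide)
qed

lemma lead_coeff_jacobi_poly_pos: "coeff (jacobi_poly \<alpha> \<beta> l) l > 0"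
  unfolding coeff_jacobi_poly using \<alpha> \<beta> pochhammer_jacobi_pos[of l] by (auto intro!: divide_pos_pos mult_pos_pos pochhammer_pos)

lemma degree_jacobi_poly: "degree (jacobi_poly \<alpha> \<beta> l) = l"
proof (rule antisym)
  show "degree (jacobi_poly \<alpha> \<beta> l) \<le> l" unfolding jacobi_poly_def
    by (intro degree_sum_le order.trans[OF degree_smult_le] order.trans[OF degree_power_le]) auto
  show "l \<le> degree (jacobi_poly \<alpha> \<beta> l)"
    using lead_coeff_jacobi_poly_pos[of l] by (intro le_degree) auto
qed

text \<open>Integrating term by term against a power of \<open>(1 + t) / 2\<close> leaves a terminating hypergeometric
  sum, which the Chu--Vandermonde identity evaluates.\<close>

lemma jacobi_functional_jacobi_poly_power:
  "jacobi_functional \<alpha> \<beta> (jacobi_poly \<alpha> \<beta> l * [:1/2, 1/2:] ^ m) =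
     pochhammer (\<beta> + 1) m * pochhammer (real m + 1 - real l) l / pochhammer (\<alpha> + \<beta> + 2) (m + l)"
proof -
  let ?c = "\<alpha> + \<beta> + 2 + m"
  have nz: "pochhammer (\<alpha> + 1) k > 0" "pochhammer (\<alpha> + \<beta> + 2) k > 0" "pochhammer ?c k > 0" for k
    using \<alpha> \<beta> by (auto intro!: pochhammer_pos)
  have split: "pochhammer (\<alpha> + \<beta> + 2) (k + m) = pochhammer (\<alpha> + \<beta> + 2) m * pochhammer ?c k" for k
    using pochhammer_product'[of "\<alpha> + \<beta> + 2" m k] by (simp add: add_ac)
  have "jacobi_functional \<alpha> \<beta> (jacobi_poly \<alpha> \<beta> l * [:1/2, 1/2:] ^ m) =
     (\<Sum>k\<le>l. pochhammer (- real l) k * pochhammer (l + \<alpha> + \<beta> + 1) k / (pochhammer (\<alpha> + 1) k * fact k) *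
       (pochhammer (\<alpha> + 1) k * pochhammer (\<beta> + 1) m / pochhammer (\<alpha> + \<beta> + 2) (k + m)))"
    unfolding jacobi_poly_def
    by (simp only: sum_distrib_right mult_smult_left jacobi_functional_sum jacobi_functional_smult
        jacobi_functional_moment)
  also have "\<dots> = pochhammer (\<beta> + 1) m / pochhammer (\<alpha> + \<beta> + 2) m *
      (\<Sum>k=0..l. pochhammer (l + \<alpha> + \<beta> + 1) k * pochhammer (- real l) k / (of_nat (fact k) * pochhammer ?c k))"
    unfolding sum_distrib_left atMost_atLeast0
  proof (intro sum.cong refl)
    fix k assume "k \<in> {0..l}"
    show "pochhammer (- real l) k * pochhammer (l + \<alpha> + \<beta> + 1) k / (pochhammer (\<alpha> + 1) k * fact k) *
       (pochhammer (\<alpha> + 1) k * pochhammer (\<beta> + 1) m / pochhammer (\<alpha> + \<beta> + 2) (k + m)) =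
       pochhammer (\<beta> + 1) m / pochhammer (\<alpha> + \<beta> + 2) m *
       (pochhammer (l + \<alpha> + \<beta> + 1) k * pochhammer (- real l) k / (of_nat (fact k) * pochhammer ?c k))"
      unfolding split using nz(1)[of k] nz(2)[of m] nz(3)[of k] by (simp add: field_simps)
  qed
  also have "(\<Sum>k=0..l. pochhammer (l + \<alpha> + \<beta> + 1) k * pochhammer (- real l) k / (of_nat (fact k) * pochhammer ?c k)) =
      pochhammer (?c - (l + \<alpha> + \<beta> + 1)) l / pochhammer ?c l"
    by (rule Vandermonde_pochhammer) (use \<alpha> \<beta> in auto)
  also have "?c - (l + \<alpha> + \<beta> + 1) = real m + 1 - real l" by simp
  finally show ?thesis using split[of l] by (simp add: add_ac)
qed

text \<open>For each power m < l the pairing contains the factor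
  \<open>pochhammer (real m + 1 - real l) l\<close>, which is 0.\<close>

lemma jacobi_poly_orthogonal:
  assumes "degree q < l"
  shows "jacobi_functional \<alpha> \<beta> (jacobi_poly \<alpha> \<beta> l * q) = 0"
proof -
  have "jacobi_functional \<alpha> \<beta> (jacobi_poly \<alpha> \<beta> l * q) =
     (\<Sum>m\<le>degree q. coeff (pcompose q [:-1, 2:]) m *
        jacobi_functional \<alpha> \<beta> (jacobi_poly \<alpha> \<beta> l * [:1/2, 1/2:] ^ m))"
    by (subst poly_expand_half[of q])
       (simp only: sum_distrib_left mult_smult_right jacobi_functional_sum jacobi_functional_smult)
  also have "\<dots> = 0"
    using assms by (intro sum.neutral) (auto simp: jacobi_functional_jacobi_poly_power pochhammer_of_int_neg_eq_0)
  finally show ?thesis .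
qed

lemma jacobi_functional_jacobi_poly_square:
  assumes "\<alpha> + \<beta> + 1 > 0"
  shows "jacobi_functional \<alpha> \<beta> (jacobi_poly \<alpha> \<beta> l * jacobi_poly \<alpha> \<beta> l) =
     fact l * pochhammer (\<beta> + 1) l * (\<alpha> + \<beta> + l + 1) /
     (pochhammer (\<alpha> + 1) l * pochhammer (\<alpha> + \<beta> + 2) l * (\<alpha> + \<beta> + 2 * l + 1))"
proof -
  \<comment> \<open>\<open>e\<close> is the leading coefficient relative to ((1 + t)/2)^l. The
    remainder \<open>r\<close> has degree less than \<open>l\<close> and drops out by orthogonality,
    which leaves one pairing that is already known.\<close>
  define e where "e = 2 ^ l * coeff (jacobi_poly \<alpha> \<beta> l) l"
  define r where "r = jacobi_poly \<alpha> \<beta> l - smult e ([:1/2, 1/2:] ^ l)"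
  have deg: "degree ([:1/2, 1/2::real:] ^ l) = l" by (simp add: degree_power_eq)
  have "coeff ([:1/2, 1/2::real:] ^ l) l = (1/2) ^ l"
    using lead_coeff_power[of "[:1/2, 1/2::real:]" l] deg by simp
  hence "coeff r l = 0" by (simp add: r_def e_def field_simps power_mult_distrib[symmetric])
  moreover have "degree r \<le> l"
    unfolding r_def by (intro degree_diff_le) (auto simp: degree_jacobi_poly deg)
  ultimately have "r = 0 \<or> degree r < l"
    by (metis le_neq_implies_less leading_coeff_0_iff)
  hence "jacobi_functional \<alpha> \<beta> (jacobi_poly \<alpha> \<beta> l * r) = 0"
    using jacobi_poly_orthogonal by (auto simp: jacobi_functional_0)
  hence "jacobi_functional \<alpha> \<beta> (jacobi_poly \<alpha> \<beta> l * jacobi_poly \<alpha> \<beta> l) =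
     e * jacobi_functional \<alpha> \<beta> (jacobi_poly \<alpha> \<beta> l * [:1/2, 1/2:] ^ l)"
    by (simp add: r_def ring_distribs jacobi_functional_diff jacobi_functional_smult)
  also have "\<dots> = pochhammer (l + \<alpha> + \<beta> + 1) l / pochhammer (\<alpha> + 1) l *
      (pochhammer (\<beta> + 1) l * fact l / pochhammer (\<alpha> + \<beta> + 2) (l + l))"
    by (simp add: e_def coeff_jacobi_poly jacobi_functional_jacobi_poly_power pochhammer_fact)
  also have "pochhammer (\<alpha> + \<beta> + 2) (l + l) =
      pochhammer (\<alpha> + \<beta> + 2) l * pochhammer (\<alpha> + \<beta> + 2 + l) l"
    by (rule pochhammer_product')
  \<comment> \<open>The product of l + 1 consecutive factors from l + \<alpha> + \<beta> + 1 is
    split at its first and at its last factor. The assumption keeps the divisor \<alpha> + \<beta> +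
    l + 1 positive for l = 0 as well.\<close>
  also have "pochhammer (\<alpha> + \<beta> + 2 + l) l * (\<alpha> + \<beta> + l + 1) =
      pochhammer (l + \<alpha> + \<beta> + 1) l * (\<alpha> + \<beta> + 2 * l + 1)"
    using pochhammer_rec[of "l + \<alpha> + \<beta> + 1" l] pochhammer_rec'[of "l + \<alpha> + \<beta> + 1" l]
    by (simp add: algebra_simps)
  hence "pochhammer (\<alpha> + \<beta> + 2 + l) l =
      pochhammer (l + \<alpha> + \<beta> + 1) l * (\<alpha> + \<beta> + 2 * l + 1) / (\<alpha> + \<beta> + l + 1)"
    using assms by (simp add: field_simps)
  finally show ?thesis
    using pochhammer_jacobi_pos[of l] assms by (simp add: mult_ac)
qed

text \<open>Cancelling the leading coefficient leaves a polynomial of lower degree that is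
  orthogonal to itself. Fixing the multiple by the value at 1 serves all later uses: the two
  \<open>THE\<close> definitions and the slice polynomials of the basis functions.\<close>

lemma orthogonal_poly_unique:
  assumes deg: "degree p = l" and orth: "\<And>q. degree q < l \<Longrightarrow> jacobi_functional \<alpha> \<beta> (p * q) = 0"
  shows "p = smult (poly p 1) (jacobi_poly \<alpha> \<beta> l)"
proof -
  define c where "c = coeff p l / coeff (jacobi_poly \<alpha> \<beta> l) l"
  define r where "r = p - smult c (jacobi_poly \<alpha> \<beta> l)"
  have "coeff r l = 0" using lead_coeff_jacobi_poly_pos[of l] by (simp add: r_def c_def)
  moreover have "degree r \<le> l"
    unfolding r_def by (intro degree_diff_le) (auto simp: degree_jacobi_poly deg)
  ultimately have "r = 0 \<or> degree r < l"
    by (metis le_neq_implies_less leading_coeff_0_iff)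
  hence "jacobi_functional \<alpha> \<beta> (r * r) = 0"
  proof
    assume "degree r < l"
    have "r * r = (p - smult c (jacobi_poly \<alpha> \<beta> l)) * r" by (simp add: r_def)
    also have "\<dots> = p * r - smult c (jacobi_poly \<alpha> \<beta> l * r)"
      by (simp only: left_diff_distrib mult_smult_left)
    finally show ?thesis
      using orth[OF \<open>degree r < l\<close>] jacobi_poly_orthogonal[OF \<open>degree r < l\<close>]
      by (simp add: jacobi_functional_diff jacobi_functional_smult)
  qed (auto simp: jacobi_functional_0)
  hence "p = smult c (jacobi_poly \<alpha> \<beta> l)"
    using jacobi_functional_square_eq_0[of r] by (simp add: r_def)
  thus ?thesis using jacobi_poly_1 by (metis mult.right_neutral poly_smult)
qed

lemma jacobi_poly_square_pos:
  "jacobi_functional \<alpha> \<beta> (jacobi_poly \<alpha> \<beta> l * jacobi_poly \<alpha> \<beta> l) > 0"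
  using jacobi_functional_square_nonneg[of "jacobi_poly \<alpha> \<beta> l"]
    jacobi_functional_square_eq_0[of "jacobi_poly \<alpha> \<beta> l"] lead_coeff_jacobi_poly_pos[of l]
  by (metis coeff_0 less_eq_real_def less_irrefl)

lemma jacobi_inner_eq: "jacobi_inner \<alpha> \<beta> p q = jacobi_functional \<alpha> \<beta> (p * q)"
  by (simp add: jacobi_inner_def jacobi_functional_def)

text \<open>The norm determines the multiple up to sign; the sign is fixed because
  \<open>jacobi_poly\<close> itself has positive leading coefficient.\<close>

lemma jacobi_orthonormal_eq:
  "jacobi_orthonormal \<alpha> \<beta> l =
     smult (1 / sqrt (jacobi_functional \<alpha> \<beta> (jacobi_poly \<alpha> \<beta> l * jacobi_poly \<alpha> \<beta> l))) (jacobi_poly \<alpha> \<beta> l)"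
    (is "_ = smult (1 / sqrt ?N) ?P")
  unfolding jacobi_orthonormal_def jacobi_inner_eq
proof (rule the_equality)
  show "degree (smult (1 / sqrt ?N) ?P) = l \<and> lead_coeff (smult (1 / sqrt ?N) ?P) > 0 \<and>
     (\<forall>q. degree q < l \<longrightarrow> jacobi_functional \<alpha> \<beta> (smult (1 / sqrt ?N) ?P * q) = 0) \<and>
     jacobi_functional \<alpha> \<beta> (smult (1 / sqrt ?N) ?P * smult (1 / sqrt ?N) ?P) = 1"
    using jacobi_poly_square_pos[of l] lead_coeff_jacobi_poly_pos[of l]
    by (auto simp: degree_jacobi_poly jacobi_functional_smult jacobi_poly_orthogonal)
next
  fix p assume p: "degree p = l \<and> lead_coeff p > 0 \<and>
     (\<forall>q. degree q < l \<longrightarrow> jacobi_functional \<alpha> \<beta> (p * q) = 0) \<and> jacobi_functional \<alpha> \<beta> (p * p) = 1"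
  define c where "c = poly p 1"
  have pc: "p = smult c ?P" unfolding c_def using p by (intro orthogonal_poly_unique) auto
  have "lead_coeff p = c * coeff ?P l" by (simp add: pc lead_coeff_smult degree_jacobi_poly)
  hence "c * coeff ?P l > 0" using p by metis
  hence "c > 0" using lead_coeff_jacobi_poly_pos[of l]
    by (simp add: zero_less_mult_iff)
  moreover have "c\<^sup>2 * ?N = 1" using p by (simp add: pc jacobi_functional_smult power2_eq_square)
  ultimately have "c = 1 / sqrt ?N"
    using jacobi_poly_square_pos[of l]
    by (metis abs_of_pos divide_inverse inverse_unique mult_1 mult.commute real_sqrt_abs real_sqrt_inverse)
  thus "p = smult (1 / sqrt ?N) ?P" using pc by simp
qed

lemma degree_jacobi_orthonormal: "degree (jacobi_orthonormal \<alpha> \<beta> l) = l"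
  using jacobi_poly_square_pos[of l] by (simp add: jacobi_orthonormal_eq degree_jacobi_poly)

lemma jacobi_orthonormal_orthogonal:
  "degree q < l \<Longrightarrow> jacobi_functional \<alpha> \<beta> (jacobi_orthonormal \<alpha> \<beta> l * q) = 0"
  by (simp add: jacobi_orthonormal_eq jacobi_functional_smult jacobi_poly_orthogonal)

lemma jacobi_orthonormal_norm:
  "jacobi_functional \<alpha> \<beta> (jacobi_orthonormal \<alpha> \<beta> l * jacobi_orthonormal \<alpha> \<beta> l) = 1"
  using jacobi_poly_square_pos[of l]
  by (simp add: jacobi_orthonormal_eq jacobi_functional_smult)

text \<open>On the unit circle the radial variable 2 r^2 - 1 equals 1, so this value governs the
  size of a basis function there. Most factors of \<open>disk_multiplier\<close> come from
  it.\<close>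

lemma jacobi_orthonormal_1_square:
  assumes "\<alpha> + \<beta> + 1 > 0"
  shows "(poly (jacobi_orthonormal \<alpha> \<beta> l) 1)\<^sup>2 =
     (pochhammer (\<alpha> + 1) l * pochhammer (\<alpha> + \<beta> + 2) l * (\<alpha> + \<beta> + 2 * l + 1)) /
     (fact l * pochhammer (\<beta> + 1) l * (\<alpha> + \<beta> + l + 1))"
  using jacobi_poly_square_pos[of l]
  by (simp add: jacobi_orthonormal_eq jacobi_poly_1 power_divide)
     (simp add: jacobi_functional_jacobi_poly_square[OF assms])

end

section \<open>Gegenbauer polynomials as the case \<alpha> = \<beta> = \<mu>\<close>

context
  fixes \<mu> :: real
  assumes \<mu>: "\<mu> > -1/2"
begin

text \<open>For the parameter \<lambda> = \<mu> + 1/2 the weight exponent \<lambda> - 1/2 is \<mu>,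
  and (1 - s^2)^\<mu> is the Jacobi weight with both exponents \<mu>.\<close>

lemma gegenbauer_eq:
  "gegenbauer (\<mu> + 1/2) k = smult (pochhammer (2 * \<mu> + 1) k / fact k) (jacobi_poly \<mu> \<mu> k)"
proof -
  have \<mu>': "\<mu> > -1" using \<mu> by simp
  note int_pos = integral_jacobi_weight_pos[OF \<mu>' \<mu>']
  have "(LINT s:{-1..1}|lborel. poly p s * poly q s * (1 - s\<^sup>2) powr \<mu>) = 0 \<longleftrightarrow>
      jacobi_functional \<mu> \<mu> (p * q) = 0" for p q
  proof -
    have "(LINT s:{-1..1}|lborel. poly p s * poly q s * (1 - s\<^sup>2) powr \<mu>) =
        (LINT s:{-1..1}|lborel. poly (p * q) s * jacobi_weight \<mu> \<mu> s)"
    proof (rule set_lebesgue_integral_cong)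
      show "\<forall>s. s \<in> {-1..1} \<longrightarrow> poly p s * poly q s * (1 - s\<^sup>2) powr \<mu> = poly (p * q) s * jacobi_weight \<mu> \<mu> s"
        by (auto simp: jacobi_weight_def powr_mult[symmetric] power2_eq_square algebra_simps)
    qed auto
    thus ?thesis using int_pos by (simp add: jacobi_functional_def)
  qed
  hence "gegenbauer (\<mu> + 1/2) k = (THE p. degree p = k \<and>
     (\<forall>q. degree q < k \<longrightarrow> jacobi_functional \<mu> \<mu> (p * q) = 0) \<and> poly p 1 = pochhammer (2 * \<mu> + 1) k / fact k)"
    by (simp add: gegenbauer_def ring_distribs)
  also have "\<dots> = smult (pochhammer (2 * \<mu> + 1) k / fact k) (jacobi_poly \<mu> \<mu> k)"
  proof (rule the_equality)
    have "pochhammer (2 * \<mu> + 1) k > 0" using \<mu> by (intro pochhammer_pos) auto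
    thus "degree (smult (pochhammer (2 * \<mu> + 1) k / fact k) (jacobi_poly \<mu> \<mu> k)) = k \<and>
     (\<forall>q. degree q < k \<longrightarrow> jacobi_functional \<mu> \<mu> (smult (pochhammer (2 * \<mu> + 1) k / fact k) (jacobi_poly \<mu> \<mu> k) * q) = 0) \<and>
     poly (smult (pochhammer (2 * \<mu> + 1) k / fact k) (jacobi_poly \<mu> \<mu> k)) 1 = pochhammer (2 * \<mu> + 1) k / fact k"
      by (auto simp: degree_jacobi_poly[OF \<mu>' \<mu>'] jacobi_functional_smult[OF \<mu>' \<mu>']
          jacobi_poly_orthogonal[OF \<mu>' \<mu>'] jacobi_poly_1[OF \<mu>' \<mu>'])
  qed (metis orthogonal_poly_unique[OF \<mu>' \<mu>'])
  finally show ?thesis .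
qed

lemma degree_gegenbauer: "degree (gegenbauer (\<mu> + 1/2) k) = k"
proof -
  have "pochhammer (2 * \<mu> + 1) k > 0" using \<mu> by (intro pochhammer_pos) auto
  thus ?thesis using \<mu> by (simp add: gegenbauer_eq degree_jacobi_poly)
qed

lemma gegenbauer_orthogonal:
  "degree q < k \<Longrightarrow> jacobi_functional \<mu> \<mu> (gegenbauer (\<mu> + 1/2) k * q) = 0"
  using \<mu> by (simp add: gegenbauer_eq jacobi_functional_smult jacobi_poly_orthogonal)

lemma gegenbauer_1_pos: "poly (gegenbauer (\<mu> + 1/2) k) 1 > 0"
proof -
  have "pochhammer (2 * \<mu> + 1) k > 0" using \<mu> by (intro pochhammer_pos) auto
  thus ?thesis using \<mu> by (simp add: gegenbauer_eq jacobi_poly_1)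
qed

text \<open>The ratio of the squared norm to the value at 1 is the reciprocal of the factor in front
  of the Gegenbauer polynomial in \<open>kernel_Phi\<close>; this is where that factor comes
  from.\<close>

lemma gegenbauer_square:
  "jacobi_functional \<mu> \<mu> (gegenbauer (\<mu> + 1/2) k * gegenbauer (\<mu> + 1/2) k) =
     poly (gegenbauer (\<mu> + 1/2) k) 1 * ((\<mu> + 1/2) / (k + \<mu> + 1/2))"
proof -
  have \<mu>': "\<mu> > -1" using \<mu> by simp
  have pos: "pochhammer (2 * \<mu> + 1) k > 0" "pochhammer (\<mu> + 1) k > 0" "pochhammer (2 * \<mu> + 2) k > 0"
    using \<mu> by (auto intro!: pochhammer_pos)
  have "pochhammer (2 * \<mu> + 1) k * (2 * \<mu> + 1 + k) = (2 * \<mu> + 1) * pochhammer (2 * \<mu> + 2) k"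
    using pochhammer_rec[of "2 * \<mu> + 1" k] pochhammer_rec'[of "2 * \<mu> + 1" k] by (simp add: add_ac mult_ac)
  hence eq: "pochhammer (2 * \<mu> + 1) k = (2 * \<mu> + 1) * pochhammer (2 * \<mu> + 2) k / (2 * \<mu> + 1 + k)"
    using \<mu> by (simp add: field_simps)
  have "pochhammer (2 * \<mu> + 1) k / fact k * jacobi_functional \<mu> \<mu> (jacobi_poly \<mu> \<mu> k * jacobi_poly \<mu> \<mu> k)
      = (\<mu> + 1/2) / (k + \<mu> + 1/2)"
  proof -
    have "jacobi_functional \<mu> \<mu> (jacobi_poly \<mu> \<mu> k * jacobi_poly \<mu> \<mu> k) =
        fact k * (2 * \<mu> + 1 + k) / (pochhammer (2 * \<mu> + 2) k * (2 * \<mu> + 1 + 2 * k))"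
      using pos \<mu> by (subst jacobi_functional_jacobi_poly_square) (auto simp: mult_2[symmetric] add_ac mult_ac)
    also have "pochhammer (2 * \<mu> + 1) k / fact k * \<dots> = (2 * \<mu> + 1) / (2 * \<mu> + 1 + 2 * k)"
      unfolding eq using pos \<mu> by simp
    also have "\<dots> = (\<mu> + 1/2) / (k + \<mu> + 1/2)" using \<mu> by (simp add: divide_simps) (simp add: algebra_simps)
    finally show ?thesis .
  qed
  moreover have "jacobi_functional \<mu> \<mu> (gegenbauer (\<mu> + 1/2) k * gegenbauer (\<mu> + 1/2) k) =
      poly (gegenbauer (\<mu> + 1/2) k) 1 * (pochhammer (2 * \<mu> + 1) k / fact k *
        jacobi_functional \<mu> \<mu> (jacobi_poly \<mu> \<mu> k * jacobi_poly \<mu> \<mu> k))"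
    using \<mu> by (simp add: gegenbauer_eq jacobi_poly_1 jacobi_functional_smult)
  ultimately show ?thesis by simp
qed

end

section \<open>Surface measure of the sphere\<close>

lemma vector_3_axis: "vector [a, b, c] = a *\<^sub>R axis 1 1 + b *\<^sub>R axis 2 1 + c *\<^sub>R (axis 3 1 :: real ^ 3)"
  by (simp add: vec_eq_iff forall_3 axis_def)

lemma borel_measurable_vector_3 [measurable]:
  assumes [measurable]: "f \<in> borel_measurable M" "g \<in> borel_measurable M" "h \<in> borel_measurable M"
  shows "(\<lambda>x. vector [f x, g x, h x] :: real ^ 3) \<in> borel_measurable M"
  unfolding vector_3_axis by measurable

section \<open>Integrals over circles and the exchange of axes\<close>

lemma nn_integral_lborel_cong_finite:
  fixes f g :: "real \<Rightarrow> ennreal"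
  assumes "finite S" "\<And>x. x \<notin> S \<Longrightarrow> f x = g x"
  shows "(\<integral>\<^sup>+x. f x \<partial>lborel) = (\<integral>\<^sup>+x. g x \<partial>lborel)"
proof (rule nn_integral_cong_AE)
  have "AE x in lborel. x \<notin> S" using assms(1) by (intro AE_not_in finite_imp_null_set_lborel)
  thus "AE x in lborel. f x = g x" by eventually_elim (use assms(2) in auto)
qed

lemma nn_integral_reflect:
  fixes g :: "real \<Rightarrow> ennreal"
  assumes [measurable]: "g \<in> borel_measurable borel"
  shows "(\<integral>\<^sup>+x\<in>{c - b..c - a}. g (c - x) \<partial>lborel) = (\<integral>\<^sup>+x\<in>{a..b}. g x \<partial>lborel)"
  by (subst (2) nn_integral_real_affine[of _ "-1" c])
     (auto intro!: nn_integral_cong simp: indicator_def)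

text \<open>The part of the shifted interval beyond \<open>p\<close> is moved back by one period.
  Half-open pieces make the indicators add up exactly.\<close>

lemma nn_integral_periodic_shift:
  fixes g :: "real \<Rightarrow> ennreal"
  assumes [measurable]: "g \<in> borel_measurable borel" and per: "\<And>x. g (x + p) = g x" and c: "0 \<le> c" "c \<le> p"
  shows "(\<integral>\<^sup>+x\<in>{0..p}. g (x + c) \<partial>lborel) = (\<integral>\<^sup>+x\<in>{0..p}. g x \<partial>lborel)"
proof -
  have "(\<integral>\<^sup>+x\<in>{0..p}. g (x + c) \<partial>lborel) = (\<integral>\<^sup>+x\<in>{c..p + c}. g x \<partial>lborel)"
    by (subst (2) nn_integral_real_affine[of _ "1" c]) (auto intro!: nn_integral_cong simp: indicator_def add_ac)
  also have "\<dots> = (\<integral>\<^sup>+x. g x * indicator {c..p} x + g x * indicator {p<..p + c} x \<partial>lborel)"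
    using c by (intro nn_integral_cong) (auto simp: indicator_def)
  also have "\<dots> = (\<integral>\<^sup>+x\<in>{c..p}. g x \<partial>lborel) + (\<integral>\<^sup>+x\<in>{p<..p + c}. g x \<partial>lborel)"
    by (intro nn_integral_add) auto
  also have "(\<integral>\<^sup>+x\<in>{p<..p + c}. g x \<partial>lborel) = (\<integral>\<^sup>+x\<in>{0<..c}. g x \<partial>lborel)"
    by (subst nn_integral_real_affine[of _ "1" p]) (auto intro!: nn_integral_cong simp: indicator_def per add.commute[of p])
  also have "\<dots> = (\<integral>\<^sup>+x\<in>{0..<c}. g x \<partial>lborel)"
    by (rule nn_integral_lborel_cong_finite[of "{0, c}"]) (auto simp: indicator_def)
  also have "(\<integral>\<^sup>+x\<in>{c..p}. g x \<partial>lborel) + \<dots> =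
      (\<integral>\<^sup>+x. g x * indicator {c..p} x + g x * indicator {0..<c} x \<partial>lborel)"
    by (intro nn_integral_add[symmetric]) auto
  also have "\<dots> = (\<integral>\<^sup>+x\<in>{0..p}. g x \<partial>lborel)"
    using c by (intro nn_integral_cong) (auto simp: indicator_def)
  finally show ?thesis .
qed

lemma borel_measurable_compose2:
  fixes h :: "real \<Rightarrow> real \<Rightarrow> real"
  assumes "(\<lambda>(a, b). h a b) \<in> borel_measurable borel" "u \<in> borel_measurable M" "v \<in> borel_measurable M"
  shows "(\<lambda>x. h (u x) (v x)) \<in> borel_measurable M"
  using measurable_compose[OF borel_measurable_Pair[OF assms(2,3)] assms(1)] by simp

text \<open>Integration is over the angle, not over arc length, so no factor \<open>s\<close>
  appears.\<close>

abbreviation arc :: "(real \<Rightarrow> real \<Rightarrow> real) \<Rightarrow> real \<Rightarrow> real set \<Rightarrow> ennreal" where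
  "arc h s A \<equiv> (\<integral>\<^sup>+\<phi>\<in>A. ennreal (h (s * cos \<phi>) (s * sin \<phi>)) \<partial>lborel)"

text \<open>Substitute x = s cos \<phi> on the upper half circle: dx has modulus s sin \<phi>
  d\<phi>, which is the second coordinate times d\<phi>. Hence the reciprocal of that coordinate as
  density.\<close>

lemma arc_half:
  assumes h: "(\<lambda>(a, b). h a b) \<in> borel_measurable borel" and s: "s > 0"
  shows "arc h s {0..pi} = (\<integral>\<^sup>+x\<in>{-s..s}. ennreal (h x (sqrt (s\<^sup>2 - x\<^sup>2)) / sqrt (s\<^sup>2 - x\<^sup>2)) \<partial>lborel)"
proof -
  \<comment> \<open>The substitution rule wants an increasing map, so -s cos \<phi> is used, and the
    sign is undone by a reflection at the end.\<close>
  define f where "f = (\<lambda>x. h (-x) (sqrt (s\<^sup>2 - x\<^sup>2)) / sqrt (s\<^sup>2 - x\<^sup>2))"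
  have f_meas [measurable]: "f \<in> borel_measurable borel"
    unfolding f_def by (intro borel_measurable_divide borel_measurable_compose2[OF h]) measurable
  have fm: "set_borel_measurable borel {- s * cos 0..- s * cos pi} f"
    unfolding set_borel_measurable_def by measurable
  have "(\<integral>\<^sup>+x. f x * indicator {- s * cos 0..- s * cos pi} x \<partial>lborel) =
        (\<integral>\<^sup>+x. f (- s * cos x) * (s * sin x) * indicator {0..pi} x \<partial>lborel)"
    by (rule nn_integral_substitution[where g = "\<lambda>x. - s * cos x" and g' = "\<lambda>x. s * sin x", OF fm])
       (auto intro!: derivative_eq_intros continuous_intros mult_nonneg_nonneg sin_ge_zero simp: s less_imp_le)
  also have "\<dots> = arc h s {0..pi}"
  \<comment> \<open>At the ends of the half circle the second coordinate is 0 and cannot be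
    cancelled.\<close>
  proof (rule nn_integral_lborel_cong_finite[of "{0, pi}"])
    fix x :: real assume "x \<notin> {0, pi}"
    hence x: "x \<noteq> 0" "x \<noteq> pi" by auto
    have "f (- s * cos x) * (s * sin x) = h (s * cos x) (s * sin x)" if "x \<in> {0..pi}"
    proof -
      have "sin x > 0" using x that by (intro sin_gt_zero) auto
      hence "s * sin x > 0" using s by simp
      have "s\<^sup>2 - (- s * cos x)\<^sup>2 = (s * sin x)\<^sup>2"
        by (simp add: sin_squared_eq power_mult_distrib algebra_simps)
      hence "sqrt (s\<^sup>2 - (- s * cos x)\<^sup>2) = s * sin x"
        using \<open>s * sin x > 0\<close> by simp
      moreover have "s \<noteq> 0" "sin x \<noteq> 0" using s \<open>sin x > 0\<close> by auto
      ultimately show ?thesis unfolding f_def by simp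
    qed
    thus "ennreal (f (- s * cos x) * (s * sin x) * indicator {0..pi} x) =
      ennreal (h (s * cos x) (s * sin x)) * indicator {0..pi} x"
      by (auto simp: indicator_def)
  qed simp
  also have "(\<integral>\<^sup>+x. f x * indicator {- s * cos 0..- s * cos pi} x \<partial>lborel) =
      (\<integral>\<^sup>+x\<in>{0 - s.. 0 - (- s)}. ennreal (f (0 - x)) \<partial>lborel)"
    by (subst nn_integral_reflect) (auto intro!: nn_integral_cong simp: indicator_def)
  finally show ?thesis by (simp add: f_def)
qed

text \<open>The angle 2 pi - \<phi> folds the lower half circle onto the upper one. Nonnegativity is
  needed to add inside \<open>ennreal\<close>.\<close>

lemma arc_full:
  assumes h [measurable]: "(\<lambda>(a, b). h a b) \<in> borel_measurable borel" and nonneg: "\<And>a b. h a b \<ge> 0"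
  shows "arc h s {0..2 * pi} = arc (\<lambda>a b. h a b + h a (- b)) s {0..pi}"
proof -
  let ?g = "\<lambda>\<phi>. ennreal (h (s * cos \<phi>) (s * sin \<phi>))"
  have hm [measurable]: "?g \<in> borel_measurable borel" "(\<lambda>\<phi>. ennreal (h (s * cos \<phi>) (- (s * sin \<phi>)))) \<in> borel_measurable borel"
    by (intro measurable_compose[OF borel_measurable_compose2[OF h] measurable_ennreal]; measurable)+
  have "arc h s {0..2 * pi} = (\<integral>\<^sup>+\<phi>. ?g \<phi> * indicator {0..pi} \<phi> + ?g \<phi> * indicator {pi..2 * pi} \<phi> \<partial>lborel)"
    by (rule nn_integral_lborel_cong_finite[of "{pi}"]) (auto simp: indicator_def)
  also have "\<dots> = arc h s {0..pi} + arc h s {pi..2 * pi}"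
    by (intro nn_integral_add) measurable
  also have "arc h s {pi..2 * pi} = (\<integral>\<^sup>+\<phi>\<in>{2 * pi - 2 * pi..2 * pi - pi}. ?g (2 * pi - \<phi>) \<partial>lborel)"
    by (rule nn_integral_reflect[symmetric]) measurable
  also have "arc h s {0..pi} + \<dots> = (\<integral>\<^sup>+\<phi>. ?g \<phi> * indicator {0..pi} \<phi> +
      ennreal (h (s * cos \<phi>) (- (s * sin \<phi>))) * indicator {0..pi} \<phi> \<partial>lborel)"
    by (subst nn_integral_add) (simp_all add: cos_diff sin_diff)
  also have "\<dots> = arc (\<lambda>a b. h a b + h a (- b)) s {0..pi}"
    by (intro nn_integral_cong) (auto simp: indicator_def nonneg)
  finally show ?thesis .
qed

text \<open>The symmetry \<phi> to pi/2 - \<phi> exchanges cosine and sine. It is composed of a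
  periodic shift by pi/2 and the reflection 2 pi - \<phi>, so that the interval of integration stays
  a full period.\<close>

lemma arc_swap:
  assumes h: "(\<lambda>(a, b). h a b) \<in> borel_measurable borel"
  shows "arc h s {0..2 * pi} = arc (\<lambda>a b. h b a) s {0..2 * pi}"
proof -
  let ?g = "\<lambda>\<phi>. ennreal (h (s * cos \<phi>) (s * sin \<phi>))"
  have [measurable]: "?g \<in> borel_measurable borel"
    by (intro measurable_compose[OF borel_measurable_compose2[OF h] measurable_ennreal]; measurable)
  have shift: "cos ((2 * pi - \<phi>) + pi/2) = sin \<phi>" "sin ((2 * pi - \<phi>) + pi/2) = cos \<phi>" for \<phi>
    by (simp_all only: cos_add sin_add cos_diff sin_diff) simp_all
  have "arc h s {0..2 * pi} = (\<integral>\<^sup>+\<phi>\<in>{0..2 * pi}. ?g (\<phi> + pi/2) \<partial>lborel)"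
    by (rule nn_integral_periodic_shift[symmetric]) auto
  also have "\<dots> = (\<integral>\<^sup>+\<phi>\<in>{2 * pi - 2 * pi..2 * pi - 0}. ?g ((2 * pi - \<phi>) + pi/2) \<partial>lborel)"
    by (rule nn_integral_reflect[symmetric]) measurable
  finally show ?thesis unfolding shift by simp
qed

text \<open>Both sides are brought to the Cartesian coordinates of the first and third variable, where
  the density is the reciprocal of the second.\<close>

lemma nn_integral_sphere_axis_swap:
  fixes F :: "real \<Rightarrow> real \<Rightarrow> real \<Rightarrow> real"
  assumes meas [measurable]: "(\<lambda>(a, b, c). F a b c) \<in> borel_measurable borel" and nonneg: "\<And>a b c. F a b c \<ge> 0"
  shows "(\<integral>\<^sup>+z\<in>{-1..1}. arc (\<lambda>a b. F a b z) (sqrt (1 - z\<^sup>2)) {0..2 * pi} \<partial>lborel) =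
    (\<integral>\<^sup>+t\<in>{-1..1}. arc (F t) (sqrt (1 - t\<^sup>2)) {0..2 * pi} \<partial>lborel)"
proof -
  have Fm [measurable]: "(\<lambda>x. F (u x) (v x) (w x)) \<in> borel_measurable M"
    if [measurable]: "u \<in> borel_measurable M" "v \<in> borel_measurable M" "w \<in> borel_measurable M"
    for u v w :: "'z \<Rightarrow> real" and M
    using measurable_compose[of "\<lambda>x. (u x, v x, w x)" M borel "\<lambda>(a, b, c). F a b c"] by simp
  have Fz: "(\<lambda>(a, b). F a b z) \<in> borel_measurable borel"
    "(\<lambda>(b, a). F z a b) \<in> borel_measurable borel"
    "(\<lambda>(a, b). F z a b) \<in> borel_measurable borel" for z
    unfolding split_beta by (intro Fm borel_measurable_continuous_onI continuous_intros)+
  let ?I = "\<lambda>x z. indicator {p. (fst p)\<^sup>2 + (snd p)\<^sup>2 \<le> 1} (x, z) :: ennreal"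
  let ?y = "\<lambda>x z. sqrt (1 - x\<^sup>2 - z\<^sup>2)"
  define J where "J = (\<lambda>(x, z). ennreal ((F x (?y x z) z + F x (- ?y x z) z) / ?y x z) * ?I x z)"
  have dom: "indicator {- sqrt (1 - z\<^sup>2)..sqrt (1 - z\<^sup>2)} x * indicator {-1..1} z = ?I x z" for x z :: real
  proof -
    have "x\<^sup>2 + z\<^sup>2 \<le> 1 \<longleftrightarrow> \<bar>x\<bar> \<le> sqrt (1 - z\<^sup>2) \<and> \<bar>z\<bar> \<le> 1"
    proof
      assume *: "x\<^sup>2 + z\<^sup>2 \<le> 1"
      hence "z\<^sup>2 \<le> 1" using zero_le_power2[of x] by linarith
      moreover have "\<bar>x\<bar> \<le> sqrt (1 - z\<^sup>2)" using * by (intro real_le_rsqrt) auto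
      ultimately show "\<bar>x\<bar> \<le> sqrt (1 - z\<^sup>2) \<and> \<bar>z\<bar> \<le> 1" by (simp add: abs_square_le_1)
    next
      assume *: "\<bar>x\<bar> \<le> sqrt (1 - z\<^sup>2) \<and> \<bar>z\<bar> \<le> 1"
      hence "\<bar>x\<bar>\<^sup>2 \<le> (sqrt (1 - z\<^sup>2))\<^sup>2" by (intro power_mono) auto
      moreover have "z\<^sup>2 \<le> 1" using * by (simp add: abs_square_le_1)
      ultimately show "x\<^sup>2 + z\<^sup>2 \<le> 1" by simp
    qed
    thus ?thesis by (auto simp: indicator_def abs_le_iff)
  qed
  \<comment> \<open>At z = 1 and z = -1 the circle is a point, and its radius 0 is not covered by
    \<open>arc_half\<close>.\<close>
  have slice: "arc h (sqrt (1 - z\<^sup>2)) {0..2 * pi} * indicator {-1..1} z =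
      (\<integral>\<^sup>+x. ennreal ((h x (?y x z) + h x (- ?y x z)) / ?y x z) * ?I x z \<partial>lborel)"
    if hm: "(\<lambda>(a, b). h a b) \<in> borel_measurable borel" and hn: "\<And>a b. h a b \<ge> 0" and z: "z \<notin> {1, -1}" for h z
  proof (cases "z \<in> {-1..1}")
    case True
    with z have "z\<^sup>2 < 1" by (simp add: abs_square_less_1 abs_less_iff)
    hence s: "sqrt (1 - z\<^sup>2) > 0" "(sqrt (1 - z\<^sup>2))\<^sup>2 = 1 - z\<^sup>2" by auto
    have "(\<lambda>(a, b). h a b + h a (- b)) \<in> borel_measurable borel"
      unfolding split_beta by (intro borel_measurable_add borel_measurable_compose2[OF hm] borel_measurable_continuous_onI continuous_intros)
    from arc_half[OF this s(1)] show ?thesis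
      using True dom[of z] unfolding arc_full[OF hm hn] s(2) by (simp add: diff_diff_eq add.commute)
  qed (simp flip: dom)
  have "(\<integral>\<^sup>+z\<in>{-1..1}. arc (\<lambda>a b. F a b z) (sqrt (1 - z\<^sup>2)) {0..2 * pi} \<partial>lborel) =
      (\<integral>\<^sup>+z. (\<integral>\<^sup>+x. J (x, z) \<partial>lborel) \<partial>lborel)"
    by (rule nn_integral_lborel_cong_finite[of "{1, -1}"], simp)
       (unfold J_def prod.case, rule slice[OF Fz(1) nonneg])
  also have "\<dots> = (\<integral>\<^sup>+x. (\<integral>\<^sup>+z. J (x, z) \<partial>lborel) \<partial>lborel)"
    by (rule lborel_pair.Fubini'[where f = "\<lambda>x z. J (x, z)"]) (unfold J_def split_beta, measurable)
  also have "\<dots> = (\<integral>\<^sup>+t\<in>{-1..1}. arc (F t) (sqrt (1 - t\<^sup>2)) {0..2 * pi} \<partial>lborel)"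
  proof (rule nn_integral_lborel_cong_finite[of "{1, -1}"])
    fix t :: real assume t: "t \<notin> {1, -1}"
    \<comment> \<open>Slicing the disk at a fixed first coordinate puts the third coordinate in the
      place of the cosine; \<open>arc_swap\<close> then restores the order.\<close>
    have "(\<integral>\<^sup>+z. J (t, z) \<partial>lborel) = arc (\<lambda>b a. F t a b) (sqrt (1 - t\<^sup>2)) {0..2 * pi} * indicator {-1..1} t"
      unfolding slice[OF Fz(2) nonneg t] J_def prod.case
      by (intro nn_integral_cong) (simp add: diff_diff_eq add.commute indicator_def)
    also have "arc (\<lambda>b a. F t a b) (sqrt (1 - t\<^sup>2)) {0..2 * pi} = arc (F t) (sqrt (1 - t\<^sup>2)) {0..2 * pi}"
      by (rule arc_swap[OF Fz(3), symmetric])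
    finally show "(\<integral>\<^sup>+z. J (t, z) \<partial>lborel) = arc (F t) (sqrt (1 - t\<^sup>2)) {0..2 * pi} * indicator {-1..1} t" .
  qed simp
  finally show ?thesis .
qed

text \<open>The measure behind \<open>surface_measure\<close>, before completion and on the Borel sets of the whole space,
  so that functions defined everywhere can be integrated without restricting them.\<close>

definition sphere_measure :: "(real ^ 3) measure" where
  "sphere_measure = distr (density lborel (\<lambda>(\<theta>, \<phi>). ennreal (sin \<theta>) * indicator ({0..pi} \<times> {0..2 * pi}) (\<theta>, \<phi>)))
     borel sphere_param"

definition latitude_point :: "real \<Rightarrow> real \<Rightarrow> real ^ 3" where
  "latitude_point z \<phi> = vector [sqrt (1 - z\<^sup>2) * cos \<phi>, sqrt (1 - z\<^sup>2) * sin \<phi>, z]"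

lemma sets_sphere_measure [simp, measurable_cong]: "sets sphere_measure = sets borel"
  by (simp add: sphere_measure_def)

lemma borel_measurable_sphere_param [measurable]: "sphere_param \<in> borel_measurable borel"
  unfolding sphere_param_def split_beta
  by (intro borel_measurable_vector_3 borel_measurable_continuous_onI continuous_intros)

lemma borel_measurable_latitude_point [measurable]: "(\<lambda>(z, \<phi>). latitude_point z \<phi>) \<in> borel_measurable borel"
  unfolding latitude_point_def split_beta
  by (intro borel_measurable_vector_3 borel_measurable_continuous_onI continuous_intros)

lemma borel_measurable_circle_point [measurable]: "(\<lambda>(t, \<alpha>). circle_point \<zeta> t \<alpha>) \<in> borel_measurable borel"
  unfolding circle_point_def split_beta
  by (intro borel_measurable_vector_3 borel_measurable_continuous_onI continuous_intros)

text \<open>Archimedes' hat-box theorem: with z = cos \<theta> the density sin \<theta> d\<theta>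
  becomes dz, so height and longitude carry plain Lebesgue measure.\<close>

lemma nn_integral_latitude:
  fixes F :: "real ^ 3 \<Rightarrow> real"
  assumes [measurable]: "F \<in> borel_measurable borel" and nonneg: "\<And>u. F u \<ge> 0"
  shows "(\<integral>\<^sup>+u. ennreal (F u) \<partial>sphere_measure) =
    (\<integral>\<^sup>+z\<in>{-1..1}. (\<integral>\<^sup>+\<phi>\<in>{0..2 * pi}. ennreal (F (latitude_point z \<phi>)) \<partial>lborel) \<partial>lborel)"
proof -
  have Fm [measurable]: "(\<lambda>x. F (vector [u x, v x, w x])) \<in> borel_measurable M"
    if [measurable]: "u \<in> borel_measurable M" "v \<in> borel_measurable M" "w \<in> borel_measurable M"
    for u v w :: "'z \<Rightarrow> real" and M
    by measurable
  have [measurable]: "(\<lambda>p :: real \<times> real. ennreal (sin (fst p)) * indicator ({0..pi} \<times> {0..2 * pi}) p) \<in> borel_measurable borel"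
    by (intro borel_measurable_times_ennreal measurable_compose[OF _ measurable_ennreal]
        borel_measurable_continuous_onI continuous_intros borel_measurable_indicator borel_closed closed_Times closed_atLeastAtMost)
  let ?W = "\<lambda>p. ennreal (sin (fst p)) * indicator ({0..pi} \<times> {0..2 * pi}) p * ennreal (F (sphere_param p))"
  have "(\<integral>\<^sup>+u. ennreal (F u) \<partial>sphere_measure) = (\<integral>\<^sup>+p. ?W p \<partial>(lborel \<Otimes>\<^sub>M lborel))"
    unfolding sphere_measure_def lborel_prod
    by (simp add: nn_integral_distr nn_integral_density case_prod_unfold)
  also have "\<dots> = (\<integral>\<^sup>+\<phi>. (\<integral>\<^sup>+\<theta>. ?W (\<theta>, \<phi>) \<partial>lborel) \<partial>lborel)"
    by (subst lborel_pair.nn_integral_snd[symmetric]) (simp_all add: lborel_prod)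
  also have "\<dots> = (\<integral>\<^sup>+\<phi>. (\<integral>\<^sup>+z\<in>{-1..1}. ennreal (F (latitude_point z \<phi>)) * indicator {0..2 * pi} \<phi> \<partial>lborel) \<partial>lborel)"
  proof (rule nn_integral_cong)
    fix \<phi> :: real
    \<comment> \<open>As for half circles, the substitution uses the increasing map -cos \<theta>,
      and the height is reflected afterwards.\<close>
    define f where "f = (\<lambda>z. F (latitude_point (0 - z) \<phi>) * indicator {0..2 * pi} \<phi>)"
    have [measurable]: "f \<in> borel_measurable borel" unfolding f_def latitude_point_def by measurable
    have fm: "set_borel_measurable borel {- cos 0..- cos pi} f"
      unfolding set_borel_measurable_def by measurable
    have "(\<integral>\<^sup>+\<theta>. ?W (\<theta>, \<phi>) \<partial>lborel) = (\<integral>\<^sup>+\<theta>. f (- cos \<theta>) * sin \<theta> * indicator {0..pi} \<theta> \<partial>lborel)"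
    proof (intro nn_integral_cong)
      fix \<theta> :: real
      have "sqrt (1 - (cos \<theta>)\<^sup>2) = sin \<theta>" if "\<theta> \<in> {0..pi}"
        using that sin_ge_zero[of \<theta>] by (simp flip: sin_squared_eq)
      thus "?W (\<theta>, \<phi>) = ennreal (f (- cos \<theta>) * sin \<theta> * indicator {0..pi} \<theta>)"
        using sin_ge_zero[of \<theta>]
        by (auto simp: f_def sphere_param_def latitude_point_def indicator_def nonneg ennreal_mult mult_ac)
    qed
    also have "\<dots> = (\<integral>\<^sup>+z. f z * indicator {- cos 0..- cos pi} z \<partial>lborel)"
      by (rule nn_integral_substitution[where g = "\<lambda>x. - cos x" and g' = sin, OF fm, symmetric])
         (auto intro!: derivative_eq_intros continuous_intros sin_ge_zero)
    also have "\<dots> = (\<integral>\<^sup>+z\<in>{0 - 1..0 - (-1)}. ennreal (F (latitude_point (0 - z) \<phi>) * indicator {0..2 * pi} \<phi>) \<partial>lborel)"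
      by (intro nn_integral_cong) (auto simp: f_def indicator_def)
    also have "\<dots> = (\<integral>\<^sup>+z\<in>{-1..1}. ennreal (F (latitude_point z \<phi>) * indicator {0..2 * pi} \<phi>) \<partial>lborel)"
      by (rule nn_integral_reflect) (simp add: latitude_point_def)
    finally show "(\<integral>\<^sup>+\<theta>. ?W (\<theta>, \<phi>) \<partial>lborel) = (\<integral>\<^sup>+z\<in>{-1..1}. ennreal (F (latitude_point z \<phi>)) * indicator {0..2 * pi} \<phi> \<partial>lborel)"
      by (simp add: nonneg ennreal_mult ennreal_indicator)
  qed
  also have "\<dots> = (\<integral>\<^sup>+z. (\<integral>\<^sup>+\<phi>. ennreal (F (latitude_point z \<phi>)) * indicator {0..2 * pi} \<phi> * indicator {-1..1} z \<partial>lborel) \<partial>lborel)"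
    by (rule lborel_pair.Fubini') (unfold latitude_point_def split_beta, measurable)
  also have "\<dots> = (\<integral>\<^sup>+z\<in>{-1..1}. (\<integral>\<^sup>+\<phi>\<in>{0..2 * pi}. ennreal (F (latitude_point z \<phi>)) \<partial>lborel) \<partial>lborel)"
    by (intro nn_integral_cong nn_integral_multc) (simp add: latitude_point_def)
  finally show ?thesis .
qed

text \<open>The hat-box theorem with an equatorial axis. A shift of the longitude by \<theta> turns
  \<zeta> into the first axis, and the exchange of axes makes that axis the slicing
  direction.\<close>

lemma nn_integral_circle_point:
  fixes F :: "real ^ 3 \<Rightarrow> real"
  assumes [measurable]: "F \<in> borel_measurable borel" and nonneg: "\<And>u. F u \<ge> 0" and \<theta>: "0 \<le> \<theta>" "\<theta> \<le> 2 * pi"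
  shows "(\<integral>\<^sup>+u. ennreal (F u) \<partial>sphere_measure) =
    (\<integral>\<^sup>+t\<in>{-1..1}. (\<integral>\<^sup>+\<alpha>\<in>{0..2 * pi}. ennreal (F (circle_point (equator_point \<theta>) t \<alpha>)) \<partial>lborel) \<partial>lborel)"
proof -
  \<comment> \<open>\<open>F\<close> in rotated coordinates: \<open>a\<close> is measured along
    \<zeta> and \<open>b\<close> along the equatorial direction orthogonal to it.\<close>
  define G where "G = (\<lambda>a b c. F (vector [a * cos \<theta> - b * sin \<theta>, a * sin \<theta> + b * cos \<theta>, c]))"
  have G_meas: "(\<lambda>(a, b, c). G a b c) \<in> borel_measurable borel"
    unfolding G_def split_beta
    by (rule measurable_compose[OF borel_measurable_vector_3 assms(1)];
        intro borel_measurable_continuous_onI continuous_intros)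
  have "(\<integral>\<^sup>+u. ennreal (F u) \<partial>sphere_measure) =
    (\<integral>\<^sup>+z\<in>{-1..1}. (\<integral>\<^sup>+\<phi>\<in>{0..2 * pi}. ennreal (F (latitude_point z (\<phi> + \<theta>))) \<partial>lborel) \<partial>lborel)"
    unfolding nn_integral_latitude[OF assms(1) nonneg]
  proof (intro nn_integral_cong)
    fix z :: real
    show "(\<integral>\<^sup>+\<phi>\<in>{0..2 * pi}. ennreal (F (latitude_point z \<phi>)) \<partial>lborel) * indicator {-1..1} z =
          (\<integral>\<^sup>+\<phi>\<in>{0..2 * pi}. ennreal (F (latitude_point z (\<phi> + \<theta>))) \<partial>lborel) * indicator {-1..1} z"
      by (subst nn_integral_periodic_shift[where g = "\<lambda>\<phi>. ennreal (F (latitude_point z \<phi>))"])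
         (auto simp: latitude_point_def \<theta>)
  qed
  also have "\<dots> = (\<integral>\<^sup>+z\<in>{-1..1}. (\<integral>\<^sup>+\<phi>\<in>{0..2 * pi}. ennreal (G (sqrt (1 - z\<^sup>2) * cos \<phi>) (sqrt (1 - z\<^sup>2) * sin \<phi>) z) \<partial>lborel) \<partial>lborel)"
    by (simp add: G_def latitude_point_def cos_add sin_add algebra_simps)
  also have "\<dots> = (\<integral>\<^sup>+t\<in>{-1..1}. (\<integral>\<^sup>+\<alpha>\<in>{0..2 * pi}. ennreal (G t (sqrt (1 - t\<^sup>2) * cos \<alpha>) (sqrt (1 - t\<^sup>2) * sin \<alpha>)) \<partial>lborel) \<partial>lborel)"
    by (rule nn_integral_sphere_axis_swap[OF G_meas]) (simp add: G_def nonneg)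
  finally show ?thesis
    by (simp add: G_def circle_point_def equator_point_def)
qed

text \<open>Indicators suffice to turn a formula for nonnegative integrals into an equality of
  measures. The latter transports Bochner integrals and null sets as well.\<close>

lemma sphere_measure_eqI:
  fixes g :: "real \<Rightarrow> real \<Rightarrow> real ^ 3"
  assumes g: "(\<lambda>(a, b). g a b) \<in> borel_measurable borel"
    and eq: "\<And>F :: real ^ 3 \<Rightarrow> real. F \<in> borel_measurable borel \<Longrightarrow> (\<And>u. F u \<ge> 0) \<Longrightarrow>
      (\<integral>\<^sup>+u. ennreal (F u) \<partial>sphere_measure) =
      (\<integral>\<^sup>+a\<in>{-1..1}. (\<integral>\<^sup>+b\<in>{0..2 * pi}. ennreal (F (g a b)) \<partial>lborel) \<partial>lborel)"
  shows "sphere_measure = distr (restrict_space lborel ({-1..1} \<times> {0..2 * pi})) borel (\<lambda>(a, b). g a b)"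
proof (rule measure_eqI)
  fix A assume "A \<in> sets sphere_measure"
  hence [measurable]: "A \<in> sets borel" by simp
  note [measurable] = g
  let ?D = "{-1..1} \<times> {0..2 * pi} :: (real \<times> real) set"
  have [measurable]: "?D \<in> sets borel" by (intro borel_closed closed_Times closed_atLeastAtMost)
  have gA: "(\<lambda>p. indicator A (case p of (a, b) \<Rightarrow> g a b) :: real) \<in> borel_measurable borel"
    by measurable
  have gm: "(\<lambda>(a, b). g a b) \<in> measurable (restrict_space lborel ?D) borel"
    using g by (intro measurable_restrict_space1) simp
  have "emeasure sphere_measure A = (\<integral>\<^sup>+u. ennreal (indicator A u) \<partial>sphere_measure)"
    by (simp add: ennreal_indicator)
  also have "\<dots> = (\<integral>\<^sup>+a\<in>{-1..1}. (\<integral>\<^sup>+b\<in>{0..2 * pi}. ennreal (indicator A (g a b)) \<partial>lborel) \<partial>lborel)"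
    by (intro eq) auto
  also have "\<dots> = (\<integral>\<^sup>+a. (\<integral>\<^sup>+b. ennreal (indicator A (g a b)) * indicator ?D (a, b) \<partial>lborel) \<partial>lborel)"
    by (intro nn_integral_cong) (auto simp: indicator_def)
  also have "\<dots> = (\<integral>\<^sup>+p. ennreal (indicator A (case p of (a, b) \<Rightarrow> g a b)) * indicator ?D p \<partial>(lborel \<Otimes>\<^sub>M lborel))"
    using gA by (subst lborel.nn_integral_fst[symmetric]) (simp_all add: lborel_prod, measurable)
  also have "\<dots> = (\<integral>\<^sup>+p. ennreal (indicator A (case p of (a, b) \<Rightarrow> g a b)) \<partial>restrict_space lborel ?D)"
    by (subst nn_integral_restrict_space) (simp_all add: lborel_prod borel_closed closed_Times)
  also have "\<dots> = (\<integral>\<^sup>+u. ennreal (indicator A u) \<partial>distr (restrict_space lborel ?D) borel (\<lambda>(a, b). g a b))"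
    by (subst nn_integral_distr[OF gm]) auto
  also have "\<dots> = emeasure (distr (restrict_space lborel ?D) borel (\<lambda>(a, b). g a b)) A"
    by (simp add: ennreal_indicator)
  finally show "emeasure sphere_measure A = emeasure (distr (restrict_space lborel ?D) borel (\<lambda>(a, b). g a b)) A" .
qed simp

lemma sphere_measure_latitude:
  "sphere_measure = distr (restrict_space lborel ({-1..1} \<times> {0..2 * pi})) borel (\<lambda>(z, \<phi>). latitude_point z \<phi>)"
  by (rule sphere_measure_eqI[OF borel_measurable_latitude_point nn_integral_latitude])

lemma sphere_measure_circle:
  assumes "0 \<le> \<theta>" "\<theta> \<le> 2 * pi"
  shows "sphere_measure = distr (restrict_space lborel ({-1..1} \<times> {0..2 * pi})) borel
    (\<lambda>(t, \<alpha>). circle_point (equator_point \<theta>) t \<alpha>)"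
  by (rule sphere_measure_eqI[OF borel_measurable_circle_point nn_integral_circle_point[OF _ _ assms]])

section \<open>The weighted measure\<close>

lemma norm_vector_3: "norm (vector [a, b, c] :: real ^ 3) = sqrt (a\<^sup>2 + b\<^sup>2 + c\<^sup>2)"
  by (simp add: norm_vec_def L2_set_def sum_3)

lemma circle_point_height:
  "circle_point (equator_point \<theta>) t \<alpha> $ 1 * cos \<theta> + circle_point (equator_point \<theta>) t \<alpha> $ 2 * sin \<theta> = t"
proof -
  have "circle_point (equator_point \<theta>) t \<alpha> $ 1 * cos \<theta> + circle_point (equator_point \<theta>) t \<alpha> $ 2 * sin \<theta> =
      t * ((cos \<theta>)\<^sup>2 + (sin \<theta>)\<^sup>2)"
    unfolding circle_point_def equator_point_def vector_3 by (simp only: algebra_simps power2_eq_square)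
  thus ?thesis by simp
qed

lemma sphere_param_in_sphere: "sphere_param p \<in> sphere 0 1"
proof -
  obtain \<theta> \<phi> where p: "p = (\<theta>, \<phi>)" by fastforce
  have "(sin \<theta>)\<^sup>2 * (cos \<phi>)\<^sup>2 + (sin \<theta>)\<^sup>2 * (sin \<phi>)\<^sup>2 + (cos \<theta>)\<^sup>2 = 1"
    by (simp flip: distrib_left)
  thus ?thesis
    by (simp add: sphere_param_def p norm_vector_3 power_mult_distrib)
qed

section \<open>Passing from the completed surface measure to Borel functions on the whole
  space\<close>

lemma AE_in_sphere: "AE u in sphere_measure. u \<in> sphere 0 1"
  unfolding sphere_measure_def
  using sphere_param_in_sphere by (subst AE_distr_iff) (simp_all del: mem_sphere)

abbreviation base_surface :: "(real ^ 3) measure" where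
  "base_surface \<equiv> distr (density lborel (\<lambda>(\<theta>, \<phi>). ennreal (sin \<theta>) * indicator ({0..pi} \<times> {0..2 * pi}) (\<theta>, \<phi>)))
       (restrict_space borel (sphere 0 1)) sphere_param"

lemma sphere_param_restrict: "sphere_param \<in> measurable (density lborel f) (restrict_space borel (sphere 0 1))"
  using borel_measurable_sphere_param sphere_param_in_sphere
  by (intro measurable_restrict_space2) (auto simp del: mem_sphere)

lemma
  fixes F :: "real ^ 3 \<Rightarrow> real"
  assumes [measurable]: "F \<in> borel_measurable borel"
  shows integral_surface_measure: "(LINT u|surface_measure. F u) = (LINT u|sphere_measure. F u)"
    and integrable_surface_measure: "integrable surface_measure F \<longleftrightarrow> integrable sphere_measure F"
proof -
  have F: "F \<in> borel_measurable (restrict_space borel (sphere 0 1))"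
    by (intro measurable_restrict_space1) measurable
  have "F \<in> borel_measurable base_surface" using F by simp
  hence *: "(LINT u|surface_measure. F u) = (LINT u|base_surface. F u)"
    "integrable surface_measure F \<longleftrightarrow> integrable base_surface F"
    unfolding surface_measure_def by (auto simp: integral_completion integrable_completion)
  show "(LINT u|surface_measure. F u) = (LINT u|sphere_measure. F u)"
    unfolding * sphere_measure_def
    by (simp add: integral_distr[OF sphere_param_restrict F] integral_distr)
  show "integrable surface_measure F \<longleftrightarrow> integrable sphere_measure F"
    unfolding * sphere_measure_def
    by (simp add: integrable_distr_eq[OF sphere_param_restrict F] integrable_distr_eq)
qed

text \<open>Completion adds no new almost-everywhere statements, and a null set of the restricted
  Borel sets is also Borel in the whole space, with the same measure.\<close>

lemma AE_surface_measureD: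
  assumes "AE u in surface_measure. P u"
  shows "AE u in sphere_measure. P u"
proof -
  have "AE u in base_surface. P u"
    using assms unfolding surface_measure_def AE_completion_iff .
  then obtain N where N: "N \<in> null_sets base_surface" "{u \<in> space base_surface. \<not> P u} \<subseteq> N"
    by (auto simp: eventually_ae_filter)
  have Nb: "N \<in> sets borel" "N \<subseteq> sphere 0 1"
    using N(1) by (auto simp: null_sets_def sets_restrict_space_iff)
  have "emeasure sphere_measure N = emeasure base_surface N"
  proof -
    have "N \<in> sets (restrict_space borel (sphere 0 1))" using N(1) by (simp add: null_sets_def)
    thus ?thesis using Nb unfolding sphere_measure_def
      by (subst emeasure_distr[OF sphere_param_restrict]; (subst emeasure_distr)?; simp)
  qed
  hence "N \<in> null_sets sphere_measure" using N(1) Nb by (auto simp: null_sets_def)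
  hence "AE u in sphere_measure. u \<notin> N" by (rule AE_not_in)
  with AE_in_sphere show ?thesis
    by eventually_elim (use N(2) in \<open>auto simp: space_restrict_space\<close>)
qed

text \<open>\<open>f\<close> is measurable only for the completion and only on the sphere. The
  representative is extended by 0 off the sphere, so it is Borel everywhere and can be composed with
  parametrizations and reflections.\<close>

lemma surface_measurable_representative:
  fixes f :: "real ^ 3 \<Rightarrow> real"
  assumes "f \<in> borel_measurable surface_measure"
  obtains g where "g \<in> borel_measurable borel" "AE u in surface_measure. f u = g u"
proof -
  from completion_ex_borel_measurable_real[OF assms[unfolded surface_measure_def]]
  obtain g where g: "g \<in> borel_measurable base_surface" "AE u in base_surface. f u = g u"
    by auto
  have "g \<in> borel_measurable (restrict_space borel (sphere 0 1))" using g(1) by simp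
  hence "(\<lambda>u. indicator (sphere 0 1) u *\<^sub>R g u) \<in> borel_measurable borel"
    by (subst (asm) borel_measurable_restrict_space_iff) auto
  moreover have "AE u in base_surface. f u = indicator (sphere 0 1) u *\<^sub>R g u"
    using g(2) AE_space by eventually_elim (auto simp: space_restrict_space)
  hence "AE u in surface_measure. f u = indicator (sphere 0 1) u *\<^sub>R g u"
    unfolding surface_measure_def by (rule AE_completion)
  ultimately show ?thesis using that by blast
qed

definition reflect3 :: "real ^ 3 \<Rightarrow> real ^ 3" where
  "reflect3 u = vector [u $ 1, u $ 2, - u $ 3]"

lemma borel_measurable_vec_nth3 [measurable]: "(\<lambda>u :: real ^ 3. u $ i) \<in> borel_measurable borel"
  by (intro borel_measurable_continuous_onI continuous_intros)

lemma borel_measurable_reflect3 [measurable]: "reflect3 \<in> borel_measurable borel"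
  unfolding reflect3_def by measurable

text \<open>In height and longitude the reflection is z to -z, which preserves Lebesgue measure on
  [-1, 1].\<close>

lemma sphere_measure_reflect: "distr sphere_measure borel reflect3 = sphere_measure"
proof (rule measure_eqI)
  fix A assume "A \<in> sets (distr sphere_measure borel reflect3)"
  hence [measurable]: "A \<in> sets borel" by simp
  define h where "h = (\<lambda>z. \<integral>\<^sup>+\<phi>\<in>{0..2 * pi}. ennreal (indicator A (latitude_point z \<phi>)) \<partial>lborel)"
  have "(\<lambda>p. indicator A (case p of (a, b) \<Rightarrow> latitude_point a b) :: real) \<in> borel_measurable borel"
    by measurable
  hence [measurable]: "(\<lambda>(a, b). indicator A (latitude_point a b) :: real) \<in> borel_measurable (lborel \<Otimes>\<^sub>M lborel)"
    by (simp add: lborel_prod case_prod_unfold)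
  have [measurable]: "h \<in> borel_measurable borel"
    unfolding h_def by measurable
  have "emeasure (distr sphere_measure borel reflect3) A = (\<integral>\<^sup>+u. ennreal (indicator A (reflect3 u)) \<partial>sphere_measure)"
    by (subst emeasure_distr)
       (auto simp flip: nn_integral_indicator simp: ennreal_indicator intro!: nn_integral_cong simp: indicator_def)
  also have "\<dots> = (\<integral>\<^sup>+z\<in>{0 - 1..0 - (- 1)}. h (0 - z) \<partial>lborel)"
    by (subst nn_integral_latitude) (simp_all add: h_def reflect3_def latitude_point_def)
  also have "\<dots> = (\<integral>\<^sup>+z\<in>{-1..1}. h z \<partial>lborel)"
    by (rule nn_integral_reflect) measurable
  also have "\<dots> = (\<integral>\<^sup>+u. ennreal (indicator A u) \<partial>sphere_measure)"
    by (subst nn_integral_latitude) (simp_all add: h_def)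
  also have "\<dots> = emeasure sphere_measure A"
    by (simp add: ennreal_indicator)
  finally show "emeasure (distr sphere_measure borel reflect3) A = emeasure sphere_measure A" .
qed simp

text \<open>The one-variable form of \<open>sphere_weight\<close> is multiplicative, so on a circle
  it separates into a factor for the radius and one for the angle.\<close>

definition abs_weight :: "real \<Rightarrow> real \<Rightarrow> real" where
  "abs_weight \<mu> s = (if \<mu> = 0 then 1 else \<bar>s\<bar> powr (2 * \<mu>))"

lemma sphere_weight_eq: "sphere_weight \<mu> u = abs_weight \<mu> (u $ 3)"
  by (simp add: sphere_weight_def abs_weight_def)

lemma abs_weight_nonneg [simp]: "abs_weight \<mu> s \<ge> 0"
  by (simp add: abs_weight_def)

lemma abs_weight_mult: "abs_weight \<mu> (a * b) = abs_weight \<mu> a * abs_weight \<mu> b"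
  by (simp add: abs_weight_def abs_mult powr_mult)

lemma abs_weight_minus [simp]: "abs_weight \<mu> (- a) = abs_weight \<mu> a"
  by (simp add: abs_weight_def)

lemma abs_weight_le_1: "\<mu> \<ge> 0 \<Longrightarrow> \<bar>s\<bar> \<le> 1 \<Longrightarrow> abs_weight \<mu> s \<le> 1"
  by (auto simp: abs_weight_def intro: powr_le1)

lemma borel_measurable_abs_weight [measurable]: "abs_weight \<mu> \<in> borel_measurable borel"
  unfolding abs_weight_def by measurable

lemma borel_measurable_sphere_weight [measurable]: "sphere_weight \<mu> \<in> borel_measurable borel"
  unfolding sphere_weight_eq[abs_def] by measurable

text \<open>The strict inequality matters when \<mu> = 0: at t^2 = 1 the weight is 1 whereas
  \<open>0 powr 0\<close> is 0.\<close>

lemma abs_weight_sqrt: "t\<^sup>2 < 1 \<Longrightarrow> abs_weight \<mu> (sqrt (1 - t\<^sup>2)) = (1 - t\<^sup>2) powr \<mu>"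
  by (simp add: abs_weight_def powr_half_sqrt[symmetric] powr_powr)

text \<open>Surface measure projects to dx dy/|x3|, so the weight becomes (1 - x^2 - y^2)^(\<mu> -
  1/2) on the disk. The two hemispheres cover the disk twice, hence the factor 1/2 on the disk
  constant.\<close>

definition sphere_prob :: "real \<Rightarrow> (real ^ 3) measure" where
  "sphere_prob \<mu> = density sphere_measure (\<lambda>u. ennreal (disk_const \<mu> / 2 * sphere_weight \<mu> u))"

lemma sets_sphere_prob [simp, measurable_cong]: "sets (sphere_prob \<mu>) = sets borel"
  by (simp add: sphere_prob_def)

lemma space_sphere_prob [simp]: "space (sphere_prob \<mu>) = UNIV"
  by (simp add: sphere_prob_def sphere_measure_def)

lemma jacobi_functional_one: "\<alpha> > -1 \<Longrightarrow> \<beta> > -1 \<Longrightarrow> jacobi_functional \<alpha> \<beta> 1 = 1"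
  using integral_jacobi_weight_pos[of \<alpha> \<beta>] by (simp add: jacobi_functional_def)

lemma integral_sphere_measure_param:
  fixes G :: "real ^ 3 \<Rightarrow> real" and g :: "real \<Rightarrow> real \<Rightarrow> real ^ 3"
  assumes g: "(\<lambda>(a, b). g a b) \<in> borel_measurable borel"
    and eq: "sphere_measure = distr (restrict_space lborel ({-1..1} \<times> {0..2 * pi})) borel (\<lambda>(a, b). g a b)"
    and G [measurable]: "G \<in> borel_measurable borel" and int: "integrable sphere_measure G"
  shows "(LINT u|sphere_measure. G u) = (LINT a:{-1..1}|lborel. LINT b:{0..2 * pi}|lborel. G (g a b))"
proof -
  note [measurable] = g
  let ?D = "{-1..1} \<times> {0..2 * pi} :: (real \<times> real) set"
  have D: "?D \<inter> space lborel \<in> sets (lborel :: (real \<times> real) measure)"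
    by (auto intro!: borel_closed closed_Times)
  have gm: "(\<lambda>(a, b). g a b) \<in> measurable (restrict_space lborel ?D) borel"
    using g by (intro measurable_restrict_space1) simp
  have int': "integrable (lborel \<Otimes>\<^sub>M lborel) (\<lambda>p. indicator ?D p *\<^sub>R G (case p of (a, b) \<Rightarrow> g a b))"
    using int unfolding eq integrable_distr_eq[OF gm G] integrable_restrict_space[OF D] lborel_prod .
  have "(LINT u|sphere_measure. G u) = (LINT p|(lborel \<Otimes>\<^sub>M lborel). indicator ?D p *\<^sub>R G (case p of (a, b) \<Rightarrow> g a b))"
    unfolding eq integral_distr[OF gm G] integral_restrict_space[OF D] lborel_prod ..
  also have "\<dots> = (LINT a|lborel. LINT b|lborel. indicator ?D (a, b) *\<^sub>R G (g a b))"
    using lborel_pair.integral_fst'[OF int'] by simp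
  also have "\<dots> = (LINT a:{-1..1}|lborel. LINT b:{0..2 * pi}|lborel. G (g a b))"
    unfolding set_lebesgue_integral_def
    by (intro Bochner_Integration.integral_cong refl)
       (auto simp: indicator_times simp flip: integral_mult_right_zero intro!: Bochner_Integration.integral_cong)
  finally show ?thesis .
qed

text \<open>\<open>k\<close> need not be Borel, as with the transform of an arbitrary
  \<open>f\<close>. Agreement almost everywhere with a Borel function makes it Lebesgue
  measurable.\<close>

lemma integral_lebesgue_AE_cong:
  fixes h k :: "real \<Rightarrow> real"
  assumes [measurable]: "h \<in> borel_measurable borel" and eq: "AE x in lborel. k x = h x"
  shows "(LINT x|lebesgue. k x) = (LINT x|lborel. h x)"
proof -
  have h: "h \<in> borel_measurable lebesgue" by (simp add: measurable_completion)
  have eq': "AE x in lebesgue. k x = h x" using eq by (rule AE_completion)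
  have k: "k \<in> borel_measurable lebesgue"
    by (rule borel_measurable_AE[OF h]) (use eq' in \<open>eventually_elim, simp\<close>)
  have "(LINT x|lebesgue. k x) = (LINT x|lebesgue. h x)"
    by (rule integral_cong_AE[OF k h eq'])
  also have "\<dots> = (LINT x|lborel. h x)" by (rule integral_completion) simp
  finally show ?thesis .
qed

context
  fixes \<mu> :: real
  assumes \<mu>: "\<mu> \<ge> 0"
begin

lemma disk_const_pos: "disk_const \<mu> > 0"
  using \<mu> by (simp add: disk_const_def)

text \<open>With r^2 = 1 - z^2 the radial variable is t = 2 r^2 - 1 = 1 - 2 z^2. Then 1 - t = 2 z^2,
  1 + t = 2 (1 - z^2) and |dt| = 4 |z| dz turn the Jacobi weight with exponents \<mu> - 1/2 and m
  into |z|^(2 \<mu>) (1 - z^2)^m, up to a power of 2.\<close>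

lemma radial_integral:
  fixes q :: "real poly"
  shows "set_integrable lborel {-1..1} (\<lambda>z. poly q (1 - 2 * z\<^sup>2) * (1 - z\<^sup>2) ^ m * abs_weight \<mu> z)"
    and "(LINT z:{-1..1}|lborel. poly q (1 - 2 * z\<^sup>2) * (1 - z\<^sup>2) ^ m * abs_weight \<mu> z) =
      Beta (\<mu> + 1/2) (real m + 1) * jacobi_functional (\<mu> - 1/2) m q"
proof -
  define F where "F = (\<lambda>z. poly q (1 - 2 * z\<^sup>2) * (1 - z\<^sup>2) ^ m * abs_weight \<mu> z)"
  have [measurable]: "poly p \<in> borel_measurable borel" for p :: "real poly"
    by (intro borel_measurable_continuous_onI continuous_intros)
  have [measurable]: "F \<in> borel_measurable borel"
    unfolding F_def by measurable
  have \<alpha>: "\<mu> - 1/2 > -1" and \<beta>: "real m > -1" using \<mu> by auto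
  \<comment> \<open>The reflected integrand, so that the increasing map 2 z^2 - 1 can be substituted
    on [0, 1].\<close>
  define f where "f = (\<lambda>s. poly q (0 + -1 * s) * jacobi_weight (\<mu> - 1/2) m (0 + -1 * s))"
  have [measurable]: "f \<in> borel_measurable borel"
    unfolding f_def jacobi_weight_def by measurable
  have int: "set_integrable lborel {-1..1} (\<lambda>t. poly q t * jacobi_weight (\<mu> - 1/2) m t)"
    by (rule set_integrable_poly_jacobi_weight[OF \<alpha> \<beta>])
  have ind: "indicator {-1..1} (0 + -1 * s) = (indicator {-1..1} s :: real)" for s :: real
    by (auto simp: indicator_def)
  have f_int: "set_integrable lborel {2 * 0\<^sup>2 - 1..2 * 1\<^sup>2 - (1::real)} f"
    using lborel_integrable_real_affine[OF int[unfolded set_integrable_def], of "-1" 0]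
    unfolding ind by (simp add: f_def set_integrable_def)
  have f_eq: "(LINT s:{-1..1}|lborel. f s) = (LINT t:{-1..1}|lborel. poly q t * jacobi_weight (\<mu> - 1/2) m t)"
    unfolding set_lebesgue_integral_def
    by (subst (2) lborel_integral_real_affine[of "-1" _ 0]) (simp_all add: f_def ind[simplified])
  \<comment> \<open>The collected powers of 2: \<mu> - 1/2 and m from the two factors of the weight,
    and 2 from the derivative 4 z.\<close>
  define C where "C = 2 powr (\<mu> + m + 3/2)"
  have pull: "f (2 * z\<^sup>2 - 1) * (4 * z) = C * F z" if "z \<in> {0<..<1}" for z
  proof -
    have z: "z > 0" "z\<^sup>2 \<le> 1" using that by (auto simp: abs_square_le_1)
    have "(2 * z\<^sup>2) powr (\<mu> - 1/2) = 2 powr (\<mu> - 1/2) * z powr (2 * \<mu> - 1)"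
    proof -
      have "z\<^sup>2 = z powr 2" using z by simp
      hence "(z\<^sup>2) powr (\<mu> - 1/2) = z powr (2 * \<mu> - 1)"
        by (simp only: powr_powr) (simp add: algebra_simps)
      thus ?thesis using z by (simp add: powr_mult)
    qed
    hence 1: "(2 * z\<^sup>2) powr (\<mu> - 1/2) * (4 * z) = 2 powr (\<mu> + 3/2) * abs_weight \<mu> z"
    proof -
      have "2 powr (\<mu> + 3/2) = 2 powr (\<mu> - 1/2 + 2)" by (rule arg_cong[of _ _ "(powr) 2"]) simp
      also have "\<dots> = 2 powr (\<mu> - 1/2) * 4" by (subst powr_add) simp
      finally have "2 powr (\<mu> + 3/2) = 2 powr (\<mu> - 1/2) * 4" .
      moreover have "z powr (2 * \<mu> - 1) * z = abs_weight \<mu> z"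
        using z by (simp add: powr_diff abs_weight_def)
      ultimately show ?thesis unfolding \<open>(2 * z\<^sup>2) powr (\<mu> - 1/2) = _\<close> by (simp add: mult_ac)
    qed
    have 2: "(2 - 2 * z\<^sup>2) powr real m = 2 powr real m * (1 - z\<^sup>2) ^ m"
    proof -
      have "z\<^sup>2 < 1" using that by (simp add: abs_square_less_1)
      hence "(2 - 2 * z\<^sup>2) powr real m = (2 - 2 * z\<^sup>2) ^ m" by (intro powr_realpow) simp
      also have "\<dots> = (2 * (1 - z\<^sup>2)) ^ m" by simp
      finally show ?thesis by (simp only: power_mult_distrib powr_realpow[of 2 m] zero_less_numeral)
    qed
    have "f (2 * z\<^sup>2 - 1) * (4 * z) = poly q (1 - 2 * z\<^sup>2) *
        ((2 * z\<^sup>2) powr (\<mu> - 1/2) * (4 * z)) * (2 - 2 * z\<^sup>2) powr real m"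
      by (simp add: f_def jacobi_weight_def)
    also have "\<dots> = C * F z"
      unfolding 1 2 by (simp add: C_def F_def powr_add mult_ac)
    finally show ?thesis .
  qed
  define I where "I = (LINT t:{-1..1}|lborel. poly q t * jacobi_weight (\<mu> - 1/2) m t)"
  have deriv: "((\<lambda>z. 2 * z\<^sup>2 - 1) has_real_derivative 4 * z) (at z)" for z :: real
    by (auto intro!: derivative_eq_intros)
  have cont: "continuous_on {0..1} (\<lambda>z :: real. 4 * z)" by (intro continuous_intros)
  have "has_bochner_integral lborel (\<lambda>z. f (2 * z\<^sup>2 - 1) * (4 * z) * indicator {0..1} z) I"
    using integral_substitution[where g = "\<lambda>z. 2 * z\<^sup>2 - 1" and g' = "\<lambda>z. 4 * z" and a = 0 and b = 1, OF f_int deriv cont] f_eq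
    by (auto simp: has_bochner_integral_iff I_def set_integrable_def set_lebesgue_integral_def mult_ac intro!: continuous_intros)
  hence "has_bochner_integral lborel (\<lambda>z. f (2 * z\<^sup>2 - 1) * (4 * z) * indicator {0..1} z / C) (I / C)"
    by (rule has_bochner_integral_divide_zero)
  \<comment> \<open>The pointwise identity can fail at both ends because \<open>0 powr 0\<close> is
    0, for \<mu> = 0 at z = 0 and for m = 0 at z = 1.\<close>
  moreover have "AE z in lborel. z \<notin> {0, 1::real}"
    by (intro AE_not_in finite_imp_null_set_lborel) auto
  hence "AE z in lborel. f (2 * z\<^sup>2 - 1) * (4 * z) * indicator {0..1} z / C = indicator {0..1} z * F z"
    by eventually_elim (auto simp: indicator_def pull C_def)
  ultimately have h1: "has_bochner_integral lborel (\<lambda>z. indicator {0..1} z * F z) (I / C)"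
    by (subst (asm) has_bochner_integral_cong_AE) (auto simp: has_bochner_integral_iff)
  hence h2: "has_bochner_integral lborel (\<lambda>z. indicator {0..1} (0 + -1 * z) * F (0 + -1 * z)) (I / C)"
    by (subst (asm) lborel_has_bochner_integral_real_affine_iff[of "-1" _ _ 0]) auto
  have "AE z in lborel. z \<notin> {0::real}"
    by (intro AE_not_in finite_imp_null_set_lborel) auto
  hence "AE z in lborel. indicator {0..1} z * F z + indicator {0..1} (0 + -1 * z) * F (0 + -1 * z) = indicator {-1..1} z * F z"
    by eventually_elim (auto simp: indicator_def F_def)
  with has_bochner_integral_add[OF h1 h2]
  have h3: "has_bochner_integral lborel (\<lambda>z. indicator {-1..1} z * F z) (I / C + I / C)"
    by (subst (asm) has_bochner_integral_cong_AE) auto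
  show "set_integrable lborel {-1..1} (\<lambda>z. poly q (1 - 2 * z\<^sup>2) * (1 - z\<^sup>2) ^ m * abs_weight \<mu> z)"
    using h3 by (simp add: has_bochner_integral_iff set_integrable_def F_def)
  have "I = 2 powr (\<mu> + m + 1/2) * Beta (\<mu> + 1/2) (real m + 1) * jacobi_functional (\<mu> - 1/2) m q"
  proof -
    have "I = (LINT t:{-1..1}|lborel. jacobi_weight (\<mu> - 1/2) m t) * jacobi_functional (\<mu> - 1/2) m q"
      using integral_jacobi_weight_pos[OF \<alpha> \<beta>] by (simp add: jacobi_functional_def I_def)
    thus ?thesis
      unfolding integral_jacobi_weight[OF \<alpha> \<beta>] by (simp add: algebra_simps)
  qed
  \<comment> \<open>The extra factor 2 absorbs the two equal halves z > 0 and z < 0; the rest is the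
    power of 2 in the normalizing integral.\<close>
  moreover have "C = 2 * 2 powr (\<mu> + m + 1/2)"
  proof -
    have "C = 2 powr (\<mu> + m + 1/2 + 1)" unfolding C_def by (rule arg_cong[of _ _ "(powr) 2"]) simp
    thus ?thesis by (simp only: powr_add) simp
  qed
  ultimately have "I / C + I / C = Beta (\<mu> + 1/2) (real m + 1) * jacobi_functional (\<mu> - 1/2) m q"
    by simp
  thus "(LINT z:{-1..1}|lborel. poly q (1 - 2 * z\<^sup>2) * (1 - z\<^sup>2) ^ m * abs_weight \<mu> z) =
      Beta (\<mu> + 1/2) (real m + 1) * jacobi_functional (\<mu> - 1/2) m q"
    using h3 by (simp add: has_bochner_integral_iff set_lebesgue_integral_def F_def)
qed

text \<open>The height integral is 1/(\<mu> + 1/2), since Beta(a, 1) = 1/a; times the angle 2 pi it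
  is 2/\<open>disk_const \<mu>\<close>.\<close>

lemma total_mass: "emeasure (sphere_prob \<mu>) UNIV = 1"
proof -
  have int: "set_integrable lborel {-1..1} (abs_weight \<mu>)"
    using radial_integral(1)[of 1 0] by simp
  have val: "(LINT z:{-1..1}|lborel. abs_weight \<mu> z) = 1 / (\<mu> + 1/2)"
  proof -
    have "Gamma (\<mu> + 1/2 + 1) = (\<mu> + 1/2) * Gamma (\<mu> + 1/2)"
      using \<mu> by (intro Gamma_plus1) (auto simp: nonpos_Ints_def)
    moreover have "Gamma (\<mu> + 1/2) > 0" using \<mu> by (intro Gamma_real_pos) simp
    ultimately have "Beta (\<mu> + 1/2) 1 = 1 / (\<mu> + 1/2)"
      by (simp add: Beta_def)
    thus ?thesis
      using radial_integral(2)[of 1 0] jacobi_functional_one[of "\<mu> - 1/2" 0] \<mu> by simp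
  qed
  have "emeasure (sphere_prob \<mu>) UNIV = (\<integral>\<^sup>+u. ennreal (disk_const \<mu> / 2 * sphere_weight \<mu> u) \<partial>sphere_measure)"
    unfolding sphere_prob_def by (subst emeasure_density) auto
  also have "\<dots> = (\<integral>\<^sup>+z. ennreal (disk_const \<mu> * pi * (indicator {-1..1} z * abs_weight \<mu> z)) \<partial>lborel)"
  proof (subst nn_integral_latitude, goal_cases)
    case 3
    show ?case
    proof (rule nn_integral_cong)
      fix z :: real
      have "(\<integral>\<^sup>+\<phi>\<in>{0..2 * pi}. ennreal (disk_const \<mu> / 2 * sphere_weight \<mu> (latitude_point z \<phi>)) \<partial>lborel) =
          ennreal (disk_const \<mu> / 2 * abs_weight \<mu> z) * ennreal (2 * pi)"
        by (simp add: sphere_weight_eq latitude_point_def nn_integral_cmult_indicator)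
      also have "\<dots> = ennreal (disk_const \<mu> * pi * abs_weight \<mu> z)"
        using disk_const_pos by (simp add: mult_ac flip: ennreal_mult)
      finally show "(\<integral>\<^sup>+\<phi>\<in>{0..2 * pi}. ennreal (disk_const \<mu> / 2 * sphere_weight \<mu> (latitude_point z \<phi>)) \<partial>lborel) * indicator {-1..1} z =
         ennreal (disk_const \<mu> * pi * (indicator {-1..1} z * abs_weight \<mu> z))"
        by (auto simp: indicator_def)
    qed
  qed (use disk_const_pos in \<open>simp_all add: sphere_weight_eq\<close>)
  also have "\<dots> = ennreal (LINT z|lborel. disk_const \<mu> * pi * (indicator {-1..1} z * abs_weight \<mu> z))"
    using int disk_const_pos by (intro nn_integral_eq_integral) (auto simp: set_integrable_def)
  also have "\<dots> = ennreal (disk_const \<mu> * pi * (1 / (\<mu> + 1/2)))"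
    using val by (simp add: set_lebesgue_integral_def)
  also have "disk_const \<mu> * pi * (1 / (\<mu> + 1/2)) = 1"
    using \<mu> by (simp add: disk_const_def)
  finally show ?thesis by simp
qed

lemma finite_measure_sphere_prob: "finite_measure (sphere_prob \<mu>)"
  using total_mass by (intro finite_measureI) simp

lemma measure_sphere_prob_UNIV: "measure (sphere_prob \<mu>) UNIV = 1"
  using total_mass by (simp add: measure_def)

lemma
  fixes F :: "real ^ 3 \<Rightarrow> real"
  assumes [measurable]: "F \<in> borel_measurable borel"
  shows integral_sphere_prob: "(LINT u|sphere_prob \<mu>. F u) = disk_const \<mu> / 2 * (LINT u|sphere_measure. F u * sphere_weight \<mu> u)"
    and integrable_sphere_prob: "integrable (sphere_prob \<mu>) F \<longleftrightarrow> integrable sphere_measure (\<lambda>u. F u * sphere_weight \<mu> u)"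
proof -
  have nonneg: "disk_const \<mu> / 2 * sphere_weight \<mu> u \<ge> 0" for u
    using disk_const_pos by (simp add: sphere_weight_eq)
  show "(LINT u|sphere_prob \<mu>. F u) = disk_const \<mu> / 2 * (LINT u|sphere_measure. F u * sphere_weight \<mu> u)"
    unfolding sphere_prob_def using nonneg by (subst integral_density) (auto simp: mult_ac)
  show "integrable (sphere_prob \<mu>) F \<longleftrightarrow> integrable sphere_measure (\<lambda>u. F u * sphere_weight \<mu> u)"
  proof -
    have "integrable (sphere_prob \<mu>) F \<longleftrightarrow>
        integrable sphere_measure (\<lambda>u. (disk_const \<mu> / 2) * (F u * sphere_weight \<mu> u))"
      unfolding sphere_prob_def using nonneg by (subst integrable_density) (auto simp: mult_ac)
    also have "\<dots> \<longleftrightarrow> integrable sphere_measure (\<lambda>u. F u * sphere_weight \<mu> u)"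
      by (subst integrable_mult_left_iff) (use disk_const_pos in auto)
    finally show ?thesis .
  qed
qed

lemma AE_sphere_probI:
  assumes "AE u in sphere_measure. P u"
  shows "AE u in sphere_prob \<mu>. P u"
  unfolding sphere_prob_def using assms by (subst AE_density) auto

text \<open>The two arguments are treated differently on purpose: \<open>f\<close> is known only up
  to null sets, while a harmonic \<open>g\<close> is prescribed on the sphere but is
  \<open>undefined\<close> off it.\<close>

lemma sphere_inner_eq:
  assumes [measurable]: "F \<in> borel_measurable borel" "G \<in> borel_measurable borel"
    and f: "f \<in> borel_measurable surface_measure" "AE u in surface_measure. f u = F u"
    and g: "\<And>u. u \<in> sphere 0 1 \<Longrightarrow> g u = G u"
  shows "sphere_inner \<mu> f g = 2 / disk_const \<mu> * (LINT u|sphere_prob \<mu>. F u * G u)"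
proof -
  have m: "h \<in> borel_measurable surface_measure" if "h \<in> borel_measurable borel" for h :: "real ^ 3 \<Rightarrow> real"
    using that unfolding surface_measure_def by (intro measurable_completion) (simp add: measurable_restrict_space1)
  have sp: "space surface_measure = sphere 0 1"
    by (simp add: surface_measure_def space_restrict_space)
  have g': "AE u in surface_measure. g u = G u"
    using g by (intro AE_I2) (simp add: sp)
  have g'': "g \<in> borel_measurable surface_measure"
    using m[OF assms(2)] by (subst measurable_cong[of _ _ G]) (auto simp: g sp)
  have "sphere_inner \<mu> f g = (LINT u|surface_measure. F u * G u * sphere_weight \<mu> u)"
    unfolding sphere_inner_def
  proof (rule integral_cong_AE)
    show "AE u in surface_measure. f u * g u * sphere_weight \<mu> u = F u * G u * sphere_weight \<mu> u"
      using f(2) g' by eventually_elim simp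
    show "(\<lambda>u. f u * g u * sphere_weight \<mu> u) \<in> borel_measurable surface_measure"
      using f(1) g'' m[OF borel_measurable_sphere_weight] by (intro borel_measurable_times)
    show "(\<lambda>u. F u * G u * sphere_weight \<mu> u) \<in> borel_measurable surface_measure"
      by (intro m) measurable
  qed
  also have "\<dots> = (LINT u|sphere_measure. F u * G u * sphere_weight \<mu> u)"
    by (rule integral_surface_measure) measurable
  also have "\<dots> = 2 / disk_const \<mu> * (LINT u|sphere_prob \<mu>. F u * G u)"
    using disk_const_pos by (subst integral_sphere_prob) auto
  finally show ?thesis .
qed

text \<open>The measure lives on the compact sphere, where \<open>F\<close> is bounded.\<close>

lemma integrable_sphere_prob_mult_continuous:
  fixes f F :: "real ^ 3 \<Rightarrow> real"
  assumes f: "integrable (sphere_prob \<mu>) f" and F: "continuous_on UNIV F"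
  shows "integrable (sphere_prob \<mu>) (\<lambda>u. f u * F u)"
proof -
  have "compact (F ` sphere 0 1)"
    using F by (intro compact_continuous_image) (auto intro: continuous_on_subset)
  hence "bounded (F ` sphere 0 1)" by (rule compact_imp_bounded)
  then obtain C where C: "\<And>u. u \<in> sphere 0 1 \<Longrightarrow> \<bar>F u\<bar> \<le> C"
    unfolding bounded_iff by (metis imageI real_norm_def)
  have [measurable]: "F \<in> borel_measurable borel" "f \<in> borel_measurable borel"
    using F f by (auto intro: borel_measurable_continuous_onI dest: borel_measurable_integrable)
  have "AE u in sphere_prob \<mu>. norm (f u * F u) \<le> norm (C * f u)"
    using AE_sphere_probI[OF AE_in_sphere]
  proof eventually_elim
    case (elim u)
    hence "\<bar>F u\<bar> \<le> \<bar>C\<bar>" using C[of u] by simp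
    thus ?case by (simp add: abs_mult mult.commute[of "\<bar>C\<bar>"] mult_left_mono)
  qed
  moreover have "integrable (sphere_prob \<mu>) (\<lambda>u. C * f u)" using f by (rule integrable_mult_right)
  moreover have "(\<lambda>u. f u * F u) \<in> borel_measurable (sphere_prob \<mu>)" by measurable
  ultimately show ?thesis by (blast intro: Bochner_Integration.integrable_bound)
qed

lemma integrable_sphere_prob_continuous:
  fixes F :: "real ^ 3 \<Rightarrow> real"
  assumes "continuous_on UNIV F"
  shows "integrable (sphere_prob \<mu>) F"
  using integrable_sphere_prob_mult_continuous[OF finite_measure.integrable_const[OF finite_measure_sphere_prob] assms, of 1] by simp

lemma mean_product:
  fixes F :: "real ^ 3 \<Rightarrow> real"
  assumes [measurable]: "F \<in> borel_measurable borel" and int: "integrable (sphere_prob \<mu>) F"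
    and eq: "\<And>z \<phi>. z \<in> {-1..1} \<Longrightarrow> F (latitude_point z \<phi>) = A z * B \<phi>"
  shows "(LINT u|sphere_prob \<mu>. F u) =
    disk_const \<mu> / 2 * ((LINT z:{-1..1}|lborel. A z * abs_weight \<mu> z) * (LINT \<phi>:{0..2 * pi}|lborel. B \<phi>))"
proof -
  have "(LINT u|sphere_prob \<mu>. F u) = disk_const \<mu> / 2 * (LINT z:{-1..1}|lborel. LINT \<phi>:{0..2 * pi}|lborel.
      F (latitude_point z \<phi>) * sphere_weight \<mu> (latitude_point z \<phi>))"
    using int unfolding integral_sphere_prob[OF assms(1)] integrable_sphere_prob[OF assms(1)]
    by (subst integral_sphere_measure_param[OF borel_measurable_latitude_point sphere_measure_latitude]) auto
  also have "(LINT z:{-1..1}|lborel. LINT \<phi>:{0..2 * pi}|lborel.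
      F (latitude_point z \<phi>) * sphere_weight \<mu> (latitude_point z \<phi>)) =
      (LINT z:{-1..1}|lborel. (A z * abs_weight \<mu> z) * (LINT \<phi>:{0..2 * pi}|lborel. B \<phi>))"
  proof (rule set_lebesgue_integral_cong)
    show "\<forall>z. z \<in> {-1..1} \<longrightarrow> (LINT \<phi>:{0..2 * pi}|lborel. F (latitude_point z \<phi>) * sphere_weight \<mu> (latitude_point z \<phi>)) =
        (A z * abs_weight \<mu> z) * (LINT \<phi>:{0..2 * pi}|lborel. B \<phi>)"
    proof (intro allI impI)
      fix z :: real assume z: "z \<in> {-1..1}"
      have "F (latitude_point z \<phi>) * sphere_weight \<mu> (latitude_point z \<phi>) = (A z * abs_weight \<mu> z) * B \<phi>" for \<phi>
        using eq[OF z, of \<phi>] by (simp add: sphere_weight_eq latitude_point_def)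
      thus "(LINT \<phi>:{0..2 * pi}|lborel. F (latitude_point z \<phi>) * sphere_weight \<mu> (latitude_point z \<phi>)) =
        (A z * abs_weight \<mu> z) * (LINT \<phi>:{0..2 * pi}|lborel. B \<phi>)" by simp
    qed
  qed simp
  finally show ?thesis by simp
qed

lemma mean_circle:
  fixes F :: "real ^ 3 \<Rightarrow> real"
  assumes [measurable]: "F \<in> borel_measurable borel" and int: "integrable (sphere_prob \<mu>) F"
    and \<theta>: "0 \<le> \<theta>" "\<theta> \<le> 2 * pi"
  shows "(LINT u|sphere_prob \<mu>. F u) = disk_const \<mu> / 2 * (LINT t:{-1..1}|lborel. LINT \<alpha>:{0..2 * pi}|lborel.
     F (circle_point (equator_point \<theta>) t \<alpha>) * sphere_weight \<mu> (circle_point (equator_point \<theta>) t \<alpha>))"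
proof -
  have "(\<lambda>u. F u * sphere_weight \<mu> u) \<in> borel_measurable borel" by measurable
  moreover have "integrable sphere_measure (\<lambda>u. F u * sphere_weight \<mu> u)"
    using int unfolding integrable_sphere_prob[OF assms(1)] .
  ultimately show ?thesis unfolding integral_sphere_prob[OF assms(1)]
    by (simp only: integral_sphere_measure_param[OF borel_measurable_circle_point sphere_measure_circle[OF \<theta>]])
qed

text \<open>On each circle \<langle>u, \<zeta>\<rangle> is the constant \<open>t\<close>, so
  \<open>g t\<close> can be moved under the circle integral. The 1/2 in the transform is the 1/2 in
  \<open>sphere_prob\<close>.\<close>

lemma integral_spherical_transform:
  fixes f f' :: "real ^ 3 \<Rightarrow> real" and g :: "real \<Rightarrow> real"
  assumes [measurable]: "f' \<in> borel_measurable borel" and ff': "AE u in surface_measure. f u = f' u"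
    and int: "integrable (sphere_prob \<mu>) f'" and g: "continuous_on UNIV g"
    and \<theta>: "0 \<le> \<theta>" "\<theta> \<le> 2 * pi"
  shows "disk_const \<mu> * (LINT t:{-1..1}|lebesgue. spherical_transform \<mu> f (equator_point \<theta>) t * g t) =
    (LINT u|sphere_prob \<mu>. f' u * g (u $ 1 * cos \<theta> + u $ 2 * sin \<theta>))"
proof -
  let ?c = "circle_point (equator_point \<theta>)"
  let ?p = "\<lambda>p. case p of (t, \<alpha>) \<Rightarrow> ?c t \<alpha>"
  let ?f' = "\<lambda>t \<alpha>. f' (?c t \<alpha>) * sphere_weight \<mu> (?c t \<alpha>)"
  let ?K = "\<lambda>t. LINT \<alpha>:{0..2 * pi}|lborel. f' (?c t \<alpha>) * g t * sphere_weight \<mu> (?c t \<alpha>)"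
  let ?D = "{-1..1} \<times> {0..2 * pi} :: (real \<times> real) set"
  have [measurable]: "?D \<in> sets borel" by (intro borel_closed closed_Times closed_atLeastAtMost)
  have gm [measurable]: "g \<in> borel_measurable borel"
    using g by (rule borel_measurable_continuous_onI)
  have [measurable]: "(\<lambda>p. ?c (fst p) (snd p)) \<in> borel_measurable (lborel \<Otimes>\<^sub>M lborel)"
    using borel_measurable_circle_point unfolding lborel_prod case_prod_unfold by simp
  have fm [measurable]: "(\<lambda>(t, \<alpha>). indicator {0..2 * pi} \<alpha> *\<^sub>R (?f' t \<alpha>)) \<in> borel_measurable (lborel \<Otimes>\<^sub>M lborel)"
    unfolding case_prod_unfold by measurable
  \<comment> \<open>The transform of the Borel representative, taken against \<open>lborel\<close>;
    unlike that of \<open>f\<close> it is Borel in \<open>t\<close>.\<close>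
  define Q where "Q = (\<lambda>t. 1 / 2 * (LINT \<alpha>:{0..2 * pi}|lborel. ?f' t \<alpha>))"
  have [measurable]: "Q \<in> borel_measurable borel"
    unfolding Q_def set_lebesgue_integral_def by measurable
  have gm2: "(\<lambda>(t, \<alpha>). ?c t \<alpha>) \<in> measurable (restrict_space lborel ?D) borel"
    using borel_measurable_circle_point by (intro measurable_restrict_space1) simp
  have "AE u in sphere_measure. f u = f' u" using ff' by (rule AE_surface_measureD)
  hence "AE p in restrict_space lborel ?D. f (?p p) = f' (?p p)"
    unfolding sphere_measure_circle[OF \<theta>] by (rule AE_distrD[OF gm2])
  hence "AE p in (lborel \<Otimes>\<^sub>M lborel). p \<in> ?D \<longrightarrow> f (?p p) = f' (?p p)"
    unfolding lborel_prod by (subst (asm) AE_restrict_space_iff) auto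
  \<comment> \<open>By Fubini \<open>f\<close> and \<open>f'\<close> agree almost everywhere on
    almost every circle. On the remaining circles the transform of \<open>f\<close> may take any
    value.\<close>
  hence AE: "AE t in lborel. AE \<alpha> in lborel. (t, \<alpha>) \<in> ?D \<longrightarrow> f (?c t \<alpha>) = f' (?c t \<alpha>)"
    by (auto dest: lborel_pair.AE_pair)
  have "(LINT t:{-1..1}|lebesgue. spherical_transform \<mu> f (equator_point \<theta>) t * g t) =
      (LINT t|lborel. indicator {-1..1} t *\<^sub>R (Q t * g t))"
    unfolding set_lebesgue_integral_def
  proof (rule integral_lebesgue_AE_cong)
    show "AE t in lborel. indicator {-1..1} t *\<^sub>R (spherical_transform \<mu> f (equator_point \<theta>) t * g t) =
        indicator {-1..1} t *\<^sub>R (Q t * g t)"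
      using AE
    proof eventually_elim
      case (elim t)
      show ?case
      proof (cases "t \<in> {-1..1}")
        case True
        have "(LINT \<alpha>:{0..2 * pi}|lebesgue. f (?c t \<alpha>) * sphere_weight \<mu> (?c t \<alpha>)) =
            (LINT \<alpha>:{0..2 * pi}|lborel. ?f' t \<alpha>)"
          unfolding set_lebesgue_integral_def
        proof (rule integral_lebesgue_AE_cong)
          show "(\<lambda>\<alpha>. indicator {0..2 * pi} \<alpha> *\<^sub>R (?f' t \<alpha>)) \<in> borel_measurable borel"
            unfolding circle_point_def by measurable
          show "AE \<alpha> in lborel. indicator {0..2 * pi} \<alpha> *\<^sub>R (f (?c t \<alpha>) * sphere_weight \<mu> (?c t \<alpha>)) =
              indicator {0..2 * pi} \<alpha> *\<^sub>R (?f' t \<alpha>)"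
            using elim by eventually_elim (use True in \<open>auto simp: indicator_def\<close>)
        qed
        thus ?thesis by (simp add: spherical_transform_def Q_def)
      qed simp
    qed
  qed measurable
  also have "\<dots> = (LINT t:{-1..1}|lborel. Q t * g t)" by (simp add: set_lebesgue_integral_def)
  also have "\<dots> = (LINT t:{-1..1}|lborel. 1 / 2 * (?K t))"
    by (simp add: Q_def mult_ac flip: set_integral_mult_right)
  also have "\<dots> = 1 / 2 * (LINT t:{-1..1}|lborel. (?K t))"
    by (rule set_integral_mult_right)
  finally have *: "disk_const \<mu> * (LINT t:{-1..1}|lebesgue. spherical_transform \<mu> f (equator_point \<theta>) t * g t) =
      disk_const \<mu> / 2 * (LINT t:{-1..1}|lborel. (?K t))"
    by simp
  have gc: "continuous_on UNIV (\<lambda>u :: real ^ 3. g (u $ 1 * cos \<theta> + u $ 2 * sin \<theta>))"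
    by (rule continuous_on_compose2[OF g _ subset_UNIV]) (intro continuous_intros)
  have "(LINT u|sphere_prob \<mu>. f' u * g (u $ 1 * cos \<theta> + u $ 2 * sin \<theta>)) =
     disk_const \<mu> / 2 * (LINT t:{-1..1}|lborel. (?K t))"
  proof -
    have m: "(\<lambda>u. f' u * g (u $ 1 * cos \<theta> + u $ 2 * sin \<theta>)) \<in> borel_measurable borel"
      using borel_measurable_continuous_onI[OF gc] by measurable
    show ?thesis
      using mean_circle[OF m integrable_sphere_prob_mult_continuous[OF int gc] \<theta>] by (simp only: circle_point_height)
  qed
  from * this[symmetric] show ?thesis by (rule trans)
qed

end

section \<open>Polynomials in two variables and trigonometric sums\<close>

abbreviation planar :: "(real \<Rightarrow> real \<Rightarrow> real) \<Rightarrow> real ^ 3 \<Rightarrow> real" where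
  "planar g u \<equiv> g (u $ 1) (u $ 2)"

text \<open>Polynomial functions with \<open>d\<close> as an upper bound for the degree. Rule
  induction then replaces work with coefficients.\<close>

inductive bipoly :: "nat \<Rightarrow> (real \<Rightarrow> real \<Rightarrow> real) \<Rightarrow> bool" where
  bipoly_const: "bipoly d (\<lambda>x y. c)"
| bipoly_mult_x: "bipoly d g \<Longrightarrow> bipoly (Suc d) (\<lambda>x y. x * g x y)"
| bipoly_mult_y: "bipoly d g \<Longrightarrow> bipoly (Suc d) (\<lambda>x y. y * g x y)"
| bipoly_add: "bipoly d g \<Longrightarrow> bipoly d h \<Longrightarrow> bipoly d (\<lambda>x y. g x y + h x y)"

lemma bipoly_mono: "bipoly d g \<Longrightarrow> d \<le> e \<Longrightarrow> bipoly e g"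
proof (induction arbitrary: e rule: bipoly.induct)
  case (bipoly_mult_x d g)
  then obtain e' where "e = Suc e'" "d \<le> e'" by (cases e) auto
  thus ?case using bipoly_mult_x.IH by (auto intro: bipoly.bipoly_mult_x)
next
  case (bipoly_mult_y d g)
  then obtain e' where "e = Suc e'" "d \<le> e'" by (cases e) auto
  thus ?case using bipoly_mult_y.IH by (auto intro: bipoly.bipoly_mult_y)
qed (auto intro: bipoly.intros)

lemma bipoly_cmult: "bipoly d g \<Longrightarrow> bipoly d (\<lambda>x y. c * g x y)"
proof (induction rule: bipoly.induct)
  case (bipoly_mult_x d g)
  thus ?case using bipoly.bipoly_mult_x[of d "\<lambda>x y. c * g x y"] by (simp add: mult.left_commute)
next
  case (bipoly_mult_y d g)
  thus ?case using bipoly.bipoly_mult_y[of d "\<lambda>x y. c * g x y"] by (simp add: mult.left_commute)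
next
  case (bipoly_add d g h)
  thus ?case using bipoly.bipoly_add[of d "\<lambda>x y. c * g x y" "\<lambda>x y. c * h x y"] by (simp add: distrib_left)
qed (rule bipoly.bipoly_const)

lemma bipoly_diff: "bipoly d g \<Longrightarrow> bipoly d h \<Longrightarrow> bipoly d (\<lambda>x y. g x y - h x y)"
  using bipoly_add[of d g "\<lambda>x y. -1 * h x y"] bipoly_cmult[of d h "-1"] by simp

lemma bipoly_mult: "bipoly d g \<Longrightarrow> bipoly e h \<Longrightarrow> bipoly (d + e) (\<lambda>x y. g x y * h x y)"
proof (induction rule: bipoly.induct)
  case (bipoly_const d c)
  thus ?case using bipoly_mono[OF bipoly_cmult[of e h c], of "d + e"] by simp
next
  case (bipoly_mult_x d g)
  thus ?case using bipoly.bipoly_mult_x[of "d + e" "\<lambda>x y. g x y * h x y"] by (simp add: mult.assoc)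
next
  case (bipoly_mult_y d g)
  thus ?case using bipoly.bipoly_mult_y[of "d + e" "\<lambda>x y. g x y * h x y"] by (simp add: mult.assoc)
next
  case (bipoly_add d g g')
  thus ?case using bipoly.bipoly_add[of "d + e" "\<lambda>x y. g x y * h x y" "\<lambda>x y. g' x y * h x y"] by (simp add: distrib_right)
qed

lemma bipoly_x: "bipoly (Suc 0) (\<lambda>x y. x)" and bipoly_y: "bipoly (Suc 0) (\<lambda>x y. y)"
  using bipoly_mult_x[OF bipoly_const, of 0 1] bipoly_mult_y[OF bipoly_const, of 0 1] by simp_all

lemma bipoly_power: "bipoly d g \<Longrightarrow> bipoly (n * d) (\<lambda>x y. g x y ^ n)"
  by (induction n) (auto intro: bipoly_const bipoly_mult)

lemma bipoly_poly: "bipoly d g \<Longrightarrow> bipoly (degree p * d) (\<lambda>x y. poly p (g x y))"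
proof (induction p)
  case (pCons a p)
  show ?case
  proof (cases "p = 0")
    case False
    have "bipoly (d + degree p * d) (\<lambda>x y. a + g x y * poly p (g x y))"
      using pCons by (intro bipoly_add bipoly_const bipoly_mult)
    thus ?thesis using False by (simp add: degree_pCons_eq)
  qed (auto intro: bipoly_const)
qed (auto intro: bipoly_const)

lemma bipoly_sum:
  "(\<And>i. i \<in> A \<Longrightarrow> bipoly d (g i)) \<Longrightarrow> bipoly d (\<lambda>x y. \<Sum>i\<in>A. g i x y)"
  by (induction A rule: infinite_finite_induct) (auto intro: bipoly_const bipoly_add)

lemma continuous_on_bipoly: "bipoly d g \<Longrightarrow> continuous_on UNIV (planar g)"
  by (induction rule: bipoly.induct) (auto intro!: continuous_intros)

text \<open>The solid harmonics r^m cos(m \<phi>) and r^m sin(m \<phi>), written without the angle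
  so that they are visibly polynomials.\<close>

definition harm :: "nat \<Rightarrow> nat \<Rightarrow> real \<Rightarrow> real \<Rightarrow> real" where
  "harm m \<epsilon> x y = (if \<epsilon> = 0 then Re (Complex x y ^ m) else Im (Complex x y ^ m))"

lemma harm_0: "harm 0 \<epsilon> x y = (if \<epsilon> = 0 then 1 else 0)"
  by (simp add: harm_def)

lemma harm_Suc:
  "harm (Suc m) 0 x y = x * harm m 0 x y - y * harm m (Suc 0) x y"
  "harm (Suc m) (Suc 0) x y = x * harm m (Suc 0) x y + y * harm m 0 x y"
  by (simp_all add: harm_def)

text \<open>With z = x + i y these are the real and imaginary parts of (z + conj z) z^(m+1) =
  z^(m+2) + |z|^2 z^m and of the same identity with z - conj z.\<close>

lemma harm_mult_xy:
  "2 * (x * harm (Suc m) 0 x y) = harm (Suc (Suc m)) 0 x y + (x\<^sup>2 + y\<^sup>2) * harm m 0 x y"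
  "2 * (x * harm (Suc m) (Suc 0) x y) = harm (Suc (Suc m)) (Suc 0) x y + (x\<^sup>2 + y\<^sup>2) * harm m (Suc 0) x y"
  "2 * (y * harm (Suc m) 0 x y) = harm (Suc (Suc m)) (Suc 0) x y - (x\<^sup>2 + y\<^sup>2) * harm m (Suc 0) x y"
  "2 * (y * harm (Suc m) (Suc 0) x y) = (x\<^sup>2 + y\<^sup>2) * harm m 0 x y - harm (Suc (Suc m)) 0 x y"
  by (simp_all add: harm_Suc power2_eq_square algebra_simps)

lemma bipoly_harm: "bipoly m (harm m 0)" "bipoly m (harm m (Suc 0))"
proof (induction m)
  case 0
  { case 1 show ?case by (simp add: harm_0[abs_def] bipoly_const) }
  { case 2 show ?case by (simp add: harm_0[abs_def] bipoly_const) }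
next
  case (Suc m)
  { case 1 show ?case unfolding harm_Suc[abs_def] using Suc by (intro bipoly_diff bipoly_mult_x bipoly_mult_y) }
  { case 2 show ?case unfolding harm_Suc[abs_def] using Suc by (intro bipoly_add bipoly_mult_x bipoly_mult_y) }
qed

lemma harm_polar: "harm m \<epsilon> (r * cos \<phi>) (r * sin \<phi>) = r ^ m * trig_factor m \<epsilon> \<phi>"
proof -
  have "Complex (r * cos \<phi>) (r * sin \<phi>) ^ m = of_real (r ^ m) * cis (real m * \<phi>)"
  proof -
    have "Complex (r * cos \<phi>) (r * sin \<phi>) = of_real r * cis \<phi>" by (simp add: complex_eq_iff)
    thus ?thesis by (simp add: power_mult_distrib Complex.DeMoivre)
  qed
  thus ?thesis by (simp add: harm_def trig_factor_def)
qed

inductive harm_span :: "nat \<Rightarrow> (real \<Rightarrow> real \<Rightarrow> real) \<Rightarrow> bool" for d where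
  harm_span_base: "2 * s + m \<le> d \<Longrightarrow> \<epsilon> \<le> Suc 0 \<Longrightarrow> harm_span d (\<lambda>x y. (x\<^sup>2 + y\<^sup>2) ^ s * harm m \<epsilon> x y)"
| harm_span_add: "harm_span d g \<Longrightarrow> harm_span d h \<Longrightarrow> harm_span d (\<lambda>x y. g x y + h x y)"
| harm_span_cmult: "harm_span d g \<Longrightarrow> harm_span d (\<lambda>x y. c * g x y)"

lemma harm_span_combine:
  assumes "harm_span d g" "harm_span d h" "\<And>x y. f x y = a * g x y + b * h x y"
  shows "harm_span d f"
proof -
  have "harm_span d (\<lambda>x y. a * g x y + b * h x y)"
    using assms(1,2) by (intro harm_span_add harm_span_cmult)
  moreover have "f = (\<lambda>x y. a * g x y + b * h x y)" using assms(3) by (intro ext)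
  ultimately show ?thesis by simp
qed

lemma harm_span_const: "harm_span d (\<lambda>x y. c)"
  using harm_span_cmult[OF harm_span_base[of 0 0 d 0], of c] by (simp add: harm_0)

text \<open>Multiplication by x or y sends frequency m to m + 1 and m - 1, the latter with an
  additional factor x^2 + y^2; either way 2 s + m grows by one.\<close>

lemma harm_span_mult_xy:
  assumes "harm_span d g"
  shows "harm_span (Suc d) (\<lambda>x y. x * g x y)" "harm_span (Suc d) (\<lambda>x y. y * g x y)"
  using assms
proof (induction rule: harm_span.induct)
  case (harm_span_base s m \<epsilon>)
  have \<epsilon>: "\<epsilon> = 0 \<or> \<epsilon> = Suc 0" using harm_span_base by auto
  have zero: "harm_span (Suc d) (\<lambda>x y. 0)" by (rule harm_span_const)
  have up: "harm_span (Suc d) (\<lambda>x y. (x\<^sup>2 + y\<^sup>2) ^ s * harm (Suc m) \<epsilon>' x y)" if "\<epsilon>' \<le> Suc 0" for \<epsilon>'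
    using harm_span_base that by (intro harm_span.harm_span_base) auto
  have down: "harm_span (Suc d) (\<lambda>x y. (x\<^sup>2 + y\<^sup>2) ^ Suc s * harm m' \<epsilon>' x y)" if "\<epsilon>' \<le> Suc 0" "m = Suc m'" for \<epsilon>' m'
    using harm_span_base that by (intro harm_span.harm_span_base) auto
  {
    case 1
    show ?case
    proof (cases m)
      case 0
      \<comment> \<open>For m = 0 there is no lower frequency. The coefficient
        \<open>1 - \<epsilon>\<close> is 1 for the constant and 0 for the vanishing sine.\<close>
      show ?thesis using \<epsilon>
        by (elim disjE; intro harm_span_combine[OF up[of 0] zero, where a = "1 - \<epsilon>" and b = 0])
           (auto simp: 0 harm_0 harm_Suc)
    next
      case (Suc m')
      have "x * ((x\<^sup>2 + y\<^sup>2) ^ s * harm m \<epsilon> x y) = 1/2 * ((x\<^sup>2 + y\<^sup>2) ^ s * harm (Suc m) \<epsilon> x y) +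
          1/2 * ((x\<^sup>2 + y\<^sup>2) ^ Suc s * harm m' \<epsilon> x y)" for x y
      proof -
        have "2 * (x * harm m \<epsilon> x y) = harm (Suc m) \<epsilon> x y + (x\<^sup>2 + y\<^sup>2) * harm m' \<epsilon> x y"
          using \<epsilon> harm_mult_xy[of x m' y] Suc by auto
        from arg_cong[OF this, of "\<lambda>t. (x\<^sup>2 + y\<^sup>2) ^ s * t / 2"] show ?thesis
          by (simp add: algebra_simps)
      qed
      with up[of \<epsilon>] down[of \<epsilon> m'] Suc harm_span_base show ?thesis by (blast intro: harm_span_combine)
    qed
  next
    case 2
    show ?case
    proof (cases m)
      case 0
      show ?thesis using \<epsilon>
        by (elim disjE; intro harm_span_combine[OF up[of "Suc 0"] zero, where a = "1 - \<epsilon>" and b = 0])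
           (auto simp: 0 harm_0 harm_Suc)
    next
      case (Suc m')
      \<comment> \<open>Multiplication by y exchanges real and imaginary parts, so \<epsilon>
        becomes \<open>1 - \<epsilon>\<close>, with a sign that depends on the direction of the
        exchange.\<close>
      define c where "c = (if \<epsilon> = 0 then 1/2 else -1/2 :: real)"
      have "y * ((x\<^sup>2 + y\<^sup>2) ^ s * harm m \<epsilon> x y) = c * ((x\<^sup>2 + y\<^sup>2) ^ s * harm (Suc m) (1 - \<epsilon>) x y) +
          (- c) * ((x\<^sup>2 + y\<^sup>2) ^ Suc s * harm m' (1 - \<epsilon>) x y)" for x y
      proof -
        have "y * harm m \<epsilon> x y = c * harm (Suc m) (1 - \<epsilon>) x y - c * ((x\<^sup>2 + y\<^sup>2) * harm m' (1 - \<epsilon>) x y)"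
          using \<epsilon> harm_mult_xy[of x m' y] harm_mult_xy[where x = y and y = x] Suc
          by (auto simp: c_def; use harm_mult_xy(3,4)[of y m' x] in linarith)
        from arg_cong[OF this, of "\<lambda>t. (x\<^sup>2 + y\<^sup>2) ^ s * t"] show ?thesis
          by (simp add: algebra_simps)
      qed
      moreover have "1 - \<epsilon> \<le> Suc 0" by simp
      ultimately show ?thesis using up[of "1 - \<epsilon>"] down[of "1 - \<epsilon>" m'] Suc by (blast intro: harm_span_combine)
    qed
  }
next
  case (harm_span_add g h)
  { case 1 show ?case using harm_span.harm_span_add[OF harm_span_add.IH(1,3)] by (simp add: distrib_left) }
  { case 2 show ?case using harm_span.harm_span_add[OF harm_span_add.IH(2,4)] by (simp add: distrib_left) }
next
  case (harm_span_cmult g c)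
  { case 1 show ?case using harm_span.harm_span_cmult[OF harm_span_cmult.IH(1), of c] by (simp only: mult.left_commute[of _ c]) }
  { case 2 show ?case using harm_span.harm_span_cmult[OF harm_span_cmult.IH(2), of c] by (simp only: mult.left_commute[of _ c]) }
qed

lemma bipoly_imp_harm_span: "bipoly d g \<Longrightarrow> harm_span d g"
  by (induction rule: bipoly.induct) (auto intro: harm_span_const harm_span_mult_xy harm_span_add)

section \<open>Trigonometric orthogonality, over the period and over the nodes\<close>

lemma set_integral_cos_sin_period:
  fixes j :: int
  shows "(LINT \<phi>:{0..2 * pi}|lborel. cos (real_of_int j * \<phi>)) = (if j = 0 then 2 * pi else 0)"
    and "(LINT \<phi>:{0..2 * pi}|lborel. sin (real_of_int j * \<phi>)) = 0"
    and "set_integrable lborel {0..2 * pi} (\<lambda>\<phi>. cos (real_of_int j * \<phi>))"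
    and "set_integrable lborel {0..2 * pi} (\<lambda>\<phi>. sin (real_of_int j * \<phi>))"
proof -
  have per: "cos (real_of_int j * (2 * pi)) = 1" "sin (real_of_int j * (2 * pi)) = 0"
    using cos_int_2pin[of j] sin_int_2pin[of j] by (simp_all add: mult_ac)
  show "(LINT \<phi>:{0..2 * pi}|lborel. cos (real_of_int j * \<phi>)) = (if j = 0 then 2 * pi else 0)"
  proof (cases "j = 0")
    case False
    have "(LINT \<phi>|lborel. cos (real_of_int j * \<phi>) * indicator {0..2 * pi} \<phi>) =
       sin (real_of_int j * (2 * pi)) / j - sin (real_of_int j * 0) / j"
      using False by (intro integral_FTC_Icc_real) (auto intro!: derivative_eq_intros)
    thus ?thesis using False per by (simp add: set_lebesgue_integral_def mult.commute)
  qed (simp add: set_lebesgue_integral_def)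
  show "(LINT \<phi>:{0..2 * pi}|lborel. sin (real_of_int j * \<phi>)) = 0"
  proof (cases "j = 0")
    case False
    have "(LINT \<phi>|lborel. sin (real_of_int j * \<phi>) * indicator {0..2 * pi} \<phi>) =
       - cos (real_of_int j * (2 * pi)) / j - (- cos (real_of_int j * 0) / j)"
      using False by (intro integral_FTC_Icc_real) (auto intro!: derivative_eq_intros)
    thus ?thesis using False per by (simp add: set_lebesgue_integral_def mult.commute)
  qed simp
qed (auto intro!: borel_integrable_atLeastAtMost' continuous_intros)

text \<open>Product-to-sum formulas, in a form shared by the integral and the quadrature: only the
  frequencies m - m' and m + m' occur. For \<epsilon> different from \<epsilon>' only sines remain,
  whose coefficients need not be known.\<close>

lemma trig_factor_mult:
  assumes "\<epsilon> \<le> Suc 0" "\<epsilon>' \<le> Suc 0"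
  obtains a b :: real where "\<And>\<phi>. trig_factor m \<epsilon> \<phi> * trig_factor m' \<epsilon>' \<phi> =
    (if \<epsilon> = \<epsilon>' then 1/2 * cos (real_of_int (int m - int m') * \<phi>) + a * cos (real_of_int (int m + int m') * \<phi>)
     else a * sin (real_of_int (int m - int m') * \<phi>) + b * sin (real_of_int (int m + int m') * \<phi>))"
    "\<epsilon> = \<epsilon>' \<Longrightarrow> a = (if \<epsilon> = 0 then 1/2 else -1/2)"
proof -
  consider "\<epsilon> = 0" "\<epsilon>' = 0" | "\<epsilon> = 1" "\<epsilon>' = 1" | "\<epsilon> = 0" "\<epsilon>' = 1" | "\<epsilon> = 1" "\<epsilon>' = 0"
    using assms by linarith
  thus thesis
  proof cases
    case 1 thus ?thesis
      by (intro that[of "1/2" 0]) (auto simp: trig_factor_def cos_times_cos left_diff_distrib distrib_right)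
  next
    case 2 thus ?thesis
      by (intro that[of "-1/2" 0]) (auto simp: trig_factor_def sin_times_sin left_diff_distrib distrib_right field_simps)
  next
    case 3 thus ?thesis
      by (intro that[of "-1/2" "1/2"]) (auto simp: trig_factor_def cos_times_sin left_diff_distrib distrib_right field_simps)
  next
    case 4 thus ?thesis
      by (intro that[of "1/2" "1/2"]) (auto simp: trig_factor_def sin_times_cos left_diff_distrib distrib_right add_divide_distrib)
  qed
qed

text \<open>Excludes the sine of frequency 0, which is not a basis function.\<close>

definition trig_valid :: "nat \<Rightarrow> nat \<Rightarrow> bool" where
  "trig_valid m \<epsilon> \<longleftrightarrow> \<epsilon> = 0 \<or> (\<epsilon> = 1 \<and> m > 0)"

text \<open>The mean square over a period. For m = 0 both m - m and m + m are the zero frequency,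
  hence 1 and not 1/2.\<close>

definition trig_norm :: "nat \<Rightarrow> real" where
  "trig_norm m = (if m = 0 then 1 else 1/2)"

lemma trig_orthogonal:
  assumes v: "trig_valid m \<epsilon>" "trig_valid m' \<epsilon>'"
  shows "(LINT \<phi>:{0..2 * pi}|lborel. trig_factor m \<epsilon> \<phi> * trig_factor m' \<epsilon>' \<phi>) =
    (if m = m' \<and> \<epsilon> = \<epsilon>' then 2 * pi * trig_norm m else 0)"
proof -
  have \<epsilon>: "\<epsilon> \<le> Suc 0" "\<epsilon>' \<le> Suc 0" using v by (auto simp: trig_valid_def)
  from trig_factor_mult[OF this, of m m'] obtain a b where ab:
    "\<And>\<phi>. trig_factor m \<epsilon> \<phi> * trig_factor m' \<epsilon>' \<phi> =
    (if \<epsilon> = \<epsilon>' then 1/2 * cos (real_of_int (int m - int m') * \<phi>) + a * cos (real_of_int (int m + int m') * \<phi>)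
     else a * sin (real_of_int (int m - int m') * \<phi>) + b * sin (real_of_int (int m + int m') * \<phi>))"
    "\<epsilon> = \<epsilon>' \<Longrightarrow> a = (if \<epsilon> = 0 then 1/2 else -1/2)" by metis
  note int = set_integral_cos_sin_period[of "int m - int m'"] set_integral_cos_sin_period[of "int m + int m'"]
  show ?thesis
  proof (cases "\<epsilon> = \<epsilon>'")
    case True
    hence "(LINT \<phi>:{0..2 * pi}|lborel. trig_factor m \<epsilon> \<phi> * trig_factor m' \<epsilon>' \<phi>) =
      1/2 * (if m = m' then 2 * pi else 0) + a * (if m = 0 \<and> m' = 0 then 2 * pi else 0)"
      using int unfolding ab by (simp add: set_integral_add del: of_int_diff of_int_add)
    thus ?thesis using True v ab(2) by (auto simp: trig_norm_def trig_valid_def)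
  next
    case False
    thus ?thesis
      using int unfolding ab by (simp add: set_integral_add del: of_int_diff of_int_add)
  qed
qed

text \<open>A geometric sum in an \<open>N\<close>-th root of unity, which differs from 1 because p
  is not a multiple of \<open>N\<close>.\<close>

lemma sum_cis_roots:
  fixes p :: int
  assumes "0 < \<bar>p\<bar>" "\<bar>p\<bar> < int N"
  shows "(\<Sum>\<nu><N. cis (2 * pi * p * real \<nu> / N)) = 0"
proof -
  define w where "w = cis (2 * pi * p / N)"
  have N: "N > 0" using assms by auto
  have "w ^ N = cis (real N * (2 * pi * p / N))" by (simp only: w_def Complex.DeMoivre)
  also have "real N * (2 * pi * p / N) = 2 * pi * p" using N by simp
  also have "cis (2 * pi * p) = 1" by (rule cis_multiple_2pi) simp
  finally have wN: "w ^ N = 1" .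
  have "w \<noteq> 1"
  proof
    assume "w = 1"
    hence "cos (2 * pi * p / N) = 1" unfolding w_def by (metis cis.sel(1) one_complex.sel(1))
    then obtain k :: int where "2 * pi * p / N = k * 2 * pi" using cos_one_2pi_int by auto
    hence "real_of_int p = real_of_int (k * int N)" using N by (simp add: field_simps)
    hence "p = k * int N" by linarith
    moreover from this have "k \<noteq> 0" using assms by auto
    hence "1 * int N \<le> \<bar>k\<bar> * int N" by (intro mult_right_mono) auto
    moreover have "\<bar>p\<bar> = \<bar>k\<bar> * int N" using \<open>p = k * int N\<close> by (simp add: abs_mult)
    ultimately show False using assms by linarith
  qed
  have "(\<Sum>\<nu><N. cis (2 * pi * p * real \<nu> / N)) = (\<Sum>\<nu><N. w ^ \<nu>)"
    by (intro sum.cong) (auto simp: w_def Complex.DeMoivre mult_ac)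
  also have "\<dots> = 0" using \<open>w \<noteq> 1\<close> wN by (simp add: geometric_sum)
  finally show ?thesis .
qed

text \<open>The assumption \<open>exact\<close> rules out aliasing: on the nodes a frequency j
  behaves as the p-th power of an \<open>N\<close>-th root of unity with |p| < N, and p = 0 only for
  j = 0. Separating p from j allows nodes on half of the circle.\<close>

lemma trig_quadrature:
  assumes v: "trig_valid m \<epsilon>" "trig_valid m' \<epsilon>'" and N: "N > 0"
    and exact: "\<And>j. j \<in> {int m - int m', int m + int m'} \<Longrightarrow>
      \<exists>p. \<bar>p\<bar> < int N \<and> (p = 0 \<longleftrightarrow> j = 0) \<and> (\<forall>\<nu>. real_of_int j * \<xi> \<nu> = 2 * pi * real_of_int p * real \<nu> / N)"
  shows "(\<Sum>\<nu><N. trig_factor m \<epsilon> (\<xi> \<nu>) * trig_factor m' \<epsilon>' (\<xi> \<nu>)) =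
    (if m = m' \<and> \<epsilon> = \<epsilon>' then real N * trig_norm m else 0)"
proof -
  have S: "(\<Sum>\<nu><N. cos (real_of_int j * \<xi> \<nu>)) = (if j = 0 then real N else 0)"
    "(\<Sum>\<nu><N. sin (real_of_int j * \<xi> \<nu>)) = 0" if "j \<in> {int m - int m', int m + int m'}" for j
  proof -
    from exact[OF that] obtain p where p: "\<bar>p\<bar> < int N" "p = 0 \<longleftrightarrow> j = 0"
      "\<And>\<nu>. real_of_int j * \<xi> \<nu> = 2 * pi * real_of_int p * real \<nu> / N" by metis
    have *: "(\<Sum>\<nu><N. cos (real_of_int j * \<xi> \<nu>)) = Re (\<Sum>\<nu><N. cis (2 * pi * p * real \<nu> / N))"
      "(\<Sum>\<nu><N. sin (real_of_int j * \<xi> \<nu>)) = Im (\<Sum>\<nu><N. cis (2 * pi * p * real \<nu> / N))"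
      by (simp_all add: p(3))
    show "(\<Sum>\<nu><N. cos (real_of_int j * \<xi> \<nu>)) = (if j = 0 then real N else 0)"
      "(\<Sum>\<nu><N. sin (real_of_int j * \<xi> \<nu>)) = 0"
      using sum_cis_roots[of p N] p(1,2) unfolding * by (cases "p = 0"; simp)+
  qed
  have \<epsilon>: "\<epsilon> \<le> Suc 0" "\<epsilon>' \<le> Suc 0" using v by (auto simp: trig_valid_def)
  from trig_factor_mult[OF this, of m m'] obtain a b where ab:
    "\<And>\<phi>. trig_factor m \<epsilon> \<phi> * trig_factor m' \<epsilon>' \<phi> =
    (if \<epsilon> = \<epsilon>' then 1/2 * cos (real_of_int (int m - int m') * \<phi>) + a * cos (real_of_int (int m + int m') * \<phi>)
     else a * sin (real_of_int (int m - int m') * \<phi>) + b * sin (real_of_int (int m + int m') * \<phi>))"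
    "\<epsilon> = \<epsilon>' \<Longrightarrow> a = (if \<epsilon> = 0 then 1/2 else -1/2)" by metis
  note S' = S[of "int m - int m'"] S[of "int m + int m'"]
  show ?thesis
  proof (cases "\<epsilon> = \<epsilon>'")
    case True
    hence "(\<Sum>\<nu><N. trig_factor m \<epsilon> (\<xi> \<nu>) * trig_factor m' \<epsilon>' (\<xi> \<nu>)) =
      1/2 * (if m = m' then real N else 0) + a * (if m = 0 \<and> m' = 0 then real N else 0)"
      using S' unfolding ab
      by (simp add: sum.distrib del: of_int_diff of_int_add flip: sum_distrib_left sum_divide_distrib)
    thus ?thesis using True v ab(2) by (auto simp: trig_norm_def trig_valid_def)
  next
    case False
    thus ?thesis
      using S' unfolding ab
      by (simp add: sum.distrib del: of_int_diff of_int_add flip: sum_distrib_left sum_divide_distrib)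
  qed
qed

section \<open>The orthonormal basis on the disk\<close>

text \<open>By projection of the sphere this is the normalized integral over the disk with weight
  W_\<mu>, so the disk needs no measure of its own.\<close>

definition mean :: "real \<Rightarrow> (real \<Rightarrow> real \<Rightarrow> real) \<Rightarrow> real" where
  "mean \<mu> g = (LINT u|sphere_prob \<mu>. planar g u)"

definition radial :: "real poly \<Rightarrow> nat \<Rightarrow> nat \<Rightarrow> real \<Rightarrow> real \<Rightarrow> real" where
  "radial q m \<epsilon> x y = poly q (2 * (x\<^sup>2 + y\<^sup>2) - 1) * harm m \<epsilon> x y"

lemma bipoly_radial: "\<epsilon> \<le> Suc 0 \<Longrightarrow> bipoly (2 * degree q + m) (radial q m \<epsilon>)"
proof -
  assume "\<epsilon> \<le> Suc 0"
  hence "bipoly m (harm m \<epsilon>)" using bipoly_harm[of m] by (auto simp: le_Suc_eq)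
  moreover have "bipoly 2 (\<lambda>x y :: real. 2 * (x\<^sup>2 + y\<^sup>2) - 1)"
    using bipoly_power[OF bipoly_x, of 2] bipoly_power[OF bipoly_y, of 2]
    by (intro bipoly_diff bipoly_cmult bipoly_add bipoly_const) auto
  ultimately have "bipoly (degree q * 2 + m) (\<lambda>x y. poly q (2 * (x\<^sup>2 + y\<^sup>2) - 1) * harm m \<epsilon> x y)"
    by (intro bipoly_mult bipoly_poly)
  thus ?thesis unfolding radial_def[abs_def] mult.commute[of "degree q"] .
qed

lemma radial_add: "radial (p + q) m \<epsilon> x y = radial p m \<epsilon> x y + radial q m \<epsilon> x y"
  by (simp add: radial_def distrib_right)

lemma radial_smult: "radial (smult c p) m \<epsilon> x y = c * radial p m \<epsilon> x y"
  by (simp add: radial_def)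

lemma radial_invalid: "\<epsilon> \<le> Suc 0 \<Longrightarrow> \<not> trig_valid m \<epsilon> \<Longrightarrow> radial q m \<epsilon> x y = 0"
  by (cases "\<epsilon> = 0") (auto simp: radial_def trig_valid_def harm_0)

text \<open>For t = 2 (x^2 + y^2) - 1 one has (1 + t)/2 = x^2 + y^2; thus the generators of
  \<open>harm_span\<close> are instances of \<open>radial\<close>.\<close>

lemma power_eq_radial:
  "(x\<^sup>2 + y\<^sup>2) ^ s * harm m \<epsilon> x y = radial ([:1/2, 1/2:] ^ s) m \<epsilon> x y"
proof -
  have "poly [:1/2, 1/2:] (2 * (x\<^sup>2 + y\<^sup>2) - 1) = x\<^sup>2 + y\<^sup>2" by (simp add: field_simps)
  thus ?thesis by (simp add: radial_def)
qed

lemma basis_indicesD: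
  assumes "(l, \<epsilon>) \<in> basis_indices k"
  shows "2 * l \<le> k" "trig_valid (k - 2 * l) \<epsilon>" "\<epsilon> \<le> Suc 0"
  using assms by (auto simp: basis_indices_def trig_valid_def)

lemma basis_indicesI: "trig_valid m \<epsilon> \<Longrightarrow> (l, \<epsilon>) \<in> basis_indices (m + 2 * l)"
  by (auto simp: basis_indices_def trig_valid_def)

lemma finite_basis_indices [simp]: "finite (basis_indices k)"
  by (rule finite_subset[of _ "{..k} \<times> {..1}"]) (auto simp: basis_indices_def)

lemma disk_basis_eq:
  "disk_basis \<mu> k l \<epsilon> x y =
     basis_norm_const \<mu> l k * radial (jacobi_orthonormal (\<mu> - 1/2) (real (k - 2 * l)) l) (k - 2 * l) \<epsilon> x y"
proof -
  let ?z = "Complex x y"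
  have xy: "x = cmod ?z * cos (Arg ?z)" "y = cmod ?z * sin (Arg ?z)"
    using rcis_cmod_Arg[of ?z] by (simp_all add: complex_eq_iff)
  have "harm m \<epsilon> x y = cmod ?z ^ m * trig_factor m \<epsilon> (Arg ?z)" for m
    using harm_polar[of m \<epsilon> "cmod ?z" "Arg ?z"] by (simp flip: xy)
  moreover have "(cmod ?z)\<^sup>2 = x\<^sup>2 + y\<^sup>2" by (simp add: cmod_power2)
  ultimately show ?thesis
    unfolding disk_basis_def disk_basis_polar_def radial_def by (simp add: mult_ac)
qed

lemma disk_basis_unit:
  "disk_basis \<mu> k l \<epsilon> (cos \<xi>) (sin \<xi>) =
     basis_norm_const \<mu> l k * poly (jacobi_orthonormal (\<mu> - 1/2) (real (k - 2 * l)) l) 1 * trig_factor (k - 2 * l) \<epsilon> \<xi>"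
  using harm_polar[of "k - 2 * l" \<epsilon> 1 \<xi>] by (simp add: disk_basis_eq radial_def)

context
  fixes \<mu> :: real
  assumes \<mu>: "\<mu> \<ge> 0"
begin

lemma integrable_bipoly: "bipoly d g \<Longrightarrow> integrable (sphere_prob \<mu>) (planar g)"
  by (rule integrable_sphere_prob_continuous[OF \<mu> continuous_on_bipoly])

lemma mean_add: "bipoly d g \<Longrightarrow> bipoly e h \<Longrightarrow> mean \<mu> (\<lambda>x y. g x y + h x y) = mean \<mu> g + mean \<mu> h"
  unfolding mean_def by (rule Bochner_Integration.integral_add[OF integrable_bipoly integrable_bipoly])

lemma mean_cmult: "mean \<mu> (\<lambda>x y. c * g x y) = c * mean \<mu> g"
  by (simp add: mean_def)

text \<open>The product of \<open>disk_const \<mu> / 2\<close>, the Beta value of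
  \<open>radial_integral\<close> and the angular integral 2 pi \<open>trig_norm m\<close>.\<close>

definition radial_norm :: "nat \<Rightarrow> real" where
  "radial_norm m = (\<mu> + 1/2) * Beta (\<mu> + 1/2) (real m + 1) * trig_norm m"

text \<open>Height and longitude separate. For equal frequencies the two powers of sqrt(1 - z^2)
  combine to (1 - z^2)^m; otherwise the angular integral is 0 and the height factor does not
  matter.\<close>

lemma mean_radial:
  assumes v: "trig_valid m \<epsilon>" "trig_valid m' \<epsilon>'"
  shows "mean \<mu> (\<lambda>x y. radial q m \<epsilon> x y * radial q' m' \<epsilon>' x y) =
    (if m = m' \<and> \<epsilon> = \<epsilon>' then radial_norm m * jacobi_functional (\<mu> - 1/2) m (q * q') else 0)"
proof -
  have \<epsilon>: "\<epsilon> \<le> Suc 0" "\<epsilon>' \<le> Suc 0" using v by (auto simp: trig_valid_def)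
  define F where "F = (\<lambda>u :: real ^ 3. radial q m \<epsilon> (u $ 1) (u $ 2) * radial q' m' \<epsilon>' (u $ 1) (u $ 2))"
  define A where "A = (\<lambda>z. poly (q * q') (1 - 2 * z\<^sup>2) * (sqrt (1 - z\<^sup>2) ^ m * sqrt (1 - z\<^sup>2) ^ m'))"
  have cont: "continuous_on UNIV F"
    unfolding F_def by (intro continuous_on_mult continuous_on_bipoly[OF bipoly_radial] \<epsilon>)
  have eq: "F (latitude_point z \<phi>) = A z * (trig_factor m \<epsilon> \<phi> * trig_factor m' \<epsilon>' \<phi>)" if z: "z \<in> {-1..1}" for z \<phi>
  proof -
    define s where "s = sqrt (1 - z\<^sup>2)"
    have "z\<^sup>2 \<le> 1" using z by (simp add: abs_square_le_1 abs_le_iff)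
    hence "s\<^sup>2 = 1 - z\<^sup>2" by (simp add: s_def)
    hence "2 * ((s * cos \<phi>)\<^sup>2 + (s * sin \<phi>)\<^sup>2) - 1 = 1 - 2 * z\<^sup>2"
      by (simp add: power_mult_distrib flip: distrib_left)
    thus ?thesis
      unfolding F_def A_def radial_def latitude_point_def vector_3 harm_polar s_def[symmetric]
      by (simp add: mult_ac)
  qed
  have "mean \<mu> (\<lambda>x y. radial q m \<epsilon> x y * radial q' m' \<epsilon>' x y) = (LINT u|sphere_prob \<mu>. F u)"
    by (simp add: mean_def F_def)
  also have "\<dots> = disk_const \<mu> / 2 * ((LINT z:{-1..1}|lborel. A z * abs_weight \<mu> z) *
      (LINT \<phi>:{0..2 * pi}|lborel. trig_factor m \<epsilon> \<phi> * trig_factor m' \<epsilon>' \<phi>))"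
    by (rule mean_product[OF \<mu> borel_measurable_continuous_onI[OF cont] integrable_sphere_prob_continuous[OF \<mu> cont] eq])
  also have "\<dots> = (if m = m' \<and> \<epsilon> = \<epsilon>' then radial_norm m * jacobi_functional (\<mu> - 1/2) m (q * q') else 0)"
  proof (cases "m = m' \<and> \<epsilon> = \<epsilon>'")
    case True
    have "(LINT z:{-1..1}|lborel. A z * abs_weight \<mu> z) =
        (LINT z:{-1..1}|lborel. poly (q * q') (1 - 2 * z\<^sup>2) * (1 - z\<^sup>2) ^ m * abs_weight \<mu> z)"
    proof (rule set_lebesgue_integral_cong)
      show "\<forall>z. z \<in> {-1..1} \<longrightarrow> A z * abs_weight \<mu> z = poly (q * q') (1 - 2 * z\<^sup>2) * (1 - z\<^sup>2) ^ m * abs_weight \<mu> z"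
        using True by (auto simp: A_def abs_square_le_1 abs_le_iff simp flip: power_mult_distrib)
    qed simp
    also have "\<dots> = Beta (\<mu> + 1/2) (real m + 1) * jacobi_functional (\<mu> - 1/2) m (q * q')"
      by (rule radial_integral(2)[OF \<mu>])
    finally show ?thesis
      using True v by (simp add: trig_orthogonal radial_norm_def disk_const_def)
  qed (use trig_orthogonal[OF v] in auto)
  finally show ?thesis .
qed

text \<open>The recurrence of Gamma shows that the constant h^2 is exactly the reciprocal of
  \<open>radial_norm\<close>.\<close>

lemma basis_norm_const_square:
  assumes "2 * l \<le> k"
  shows "(basis_norm_const \<mu> l k)\<^sup>2 * radial_norm (k - 2 * l) = 1"
proof -
  define m where "m = k - 2 * l"
  have G: "Gamma (\<mu> + 1/2) > 0" "Gamma (real m + 1) > 0" "Gamma (\<mu> + real m + 3/2) > 0" "Gamma (\<mu> + 3/2) > 0"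
    using \<mu> by (auto intro!: Gamma_real_pos)
  have "Gamma (\<mu> + 1/2 + 1) = (\<mu> + 1/2) * Gamma (\<mu> + 1/2)"
    using \<mu> by (intro Gamma_plus1) (auto simp: nonpos_Ints_def)
  hence G3: "Gamma (\<mu> + 3/2) = (\<mu> + 1/2) * Gamma (\<mu> + 1/2)" by (simp add: add.assoc)
  have Gm: "Gamma (\<mu> + 1/2 + (real m + 1)) = Gamma (\<mu> + real m + 3/2)" "Gamma (real m + \<mu> + 3/2) = Gamma (\<mu> + real m + 3/2)"
    by (rule arg_cong[of _ _ Gamma], simp)+
  have t: "(if 2 * l < k then 1/2 else 1 :: real) = trig_norm m" "trig_norm m > 0"
    using assms by (auto simp: trig_norm_def m_def)
  have "(basis_norm_const \<mu> l k)\<^sup>2 = 1 / trig_norm m * (Gamma (\<mu> + real m + 3/2) / (Gamma (\<mu> + 3/2) * Gamma (real m + 1)))"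
    unfolding basis_norm_const_def m_def[symmetric] t(1) Gm(2) using t(2) G
    by (subst real_sqrt_pow2) (auto intro!: mult_nonneg_nonneg divide_nonneg_nonneg less_imp_le)
  moreover have "radial_norm m = Gamma (\<mu> + 3/2) * Gamma (real m + 1) / Gamma (\<mu> + real m + 3/2) * trig_norm m"
    unfolding radial_norm_def Beta_def Gm(1) G3 by simp
  moreover define g where "g = Gamma (real m + 1)"
  ultimately show ?thesis using t(2) G unfolding m_def[symmetric] g_def[symmetric] by simp
qed

lemma basis_norm_const_nz: "2 * l \<le> k \<Longrightarrow> basis_norm_const \<mu> l k \<noteq> 0"
  using basis_norm_const_square by fastforce

lemma bipoly_disk_basis:
  assumes "(l, \<epsilon>) \<in> basis_indices k"
  shows "bipoly k (disk_basis \<mu> k l \<epsilon>)"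
proof -
  note D = basis_indicesD[OF assms]
  have "bipoly (2 * degree (jacobi_orthonormal (\<mu> - 1/2) (real (k - 2 * l)) l) + (k - 2 * l))
      (disk_basis \<mu> k l \<epsilon>)"
    unfolding disk_basis_eq[abs_def] by (intro bipoly_cmult bipoly_radial D)
  thus ?thesis using \<mu> D(1) by (simp add: degree_jacobi_orthonormal)
qed

text \<open>Different frequencies or parities are separated by the angle. For equal frequency both
  Jacobi polynomials belong to the same weight, and they differ only in the degree.\<close>

lemma disk_basis_orthonormal:
  assumes "(l, \<epsilon>) \<in> basis_indices k" "(l', \<epsilon>') \<in> basis_indices k'"
  shows "mean \<mu> (\<lambda>x y. disk_basis \<mu> k l \<epsilon> x y * disk_basis \<mu> k' l' \<epsilon>' x y) =
    (if k = k' \<and> l = l' \<and> \<epsilon> = \<epsilon>' then 1 else 0)"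
proof -
  note D = basis_indicesD[OF assms(1)] basis_indicesD[OF assms(2)]
  let ?m = "k - 2 * l" and ?m' = "k' - 2 * l'"
  let ?p = "jacobi_orthonormal (\<mu> - 1/2) (real ?m) l" and ?p' = "jacobi_orthonormal (\<mu> - 1/2) (real ?m') l'"
  have \<alpha>: "\<mu> - 1/2 > -1" and \<beta>: "real ?m > -1" using \<mu> by auto
  have "mean \<mu> (\<lambda>x y. disk_basis \<mu> k l \<epsilon> x y * disk_basis \<mu> k' l' \<epsilon>' x y) =
      mean \<mu> (\<lambda>x y. (basis_norm_const \<mu> l k * basis_norm_const \<mu> l' k') * (radial ?p ?m \<epsilon> x y * radial ?p' ?m' \<epsilon>' x y))"
    unfolding disk_basis_eq by (rule arg_cong[of _ _ "mean \<mu>"]) (simp add: mult_ac)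
  also have "\<dots> = (basis_norm_const \<mu> l k * basis_norm_const \<mu> l' k') *
      (if ?m = ?m' \<and> \<epsilon> = \<epsilon>' then radial_norm ?m * jacobi_functional (\<mu> - 1/2) ?m (?p * ?p') else 0)"
    unfolding mean_cmult mean_radial[OF D(2) D(5)] ..
  also have "\<dots> = (if k = k' \<and> l = l' \<and> \<epsilon> = \<epsilon>' then 1 else 0)"
  proof (cases "?m = ?m' \<and> \<epsilon> = \<epsilon>'")
    case True
    show ?thesis
    proof (cases l l' rule: linorder_cases)
      case equal
      hence "k = k'" using True D by linarith
      thus ?thesis
        using True equal basis_norm_const_square[OF D(1)] jacobi_orthonormal_norm[OF \<alpha> \<beta>, of l]
        by (simp add: power2_eq_square)
    next
      case less
      hence "jacobi_functional (\<mu> - 1/2) ?m' (?p' * ?p) = 0"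
        by (intro jacobi_orthonormal_orthogonal[OF \<alpha>]) (auto simp: degree_jacobi_orthonormal[OF \<alpha> \<beta>])
      thus ?thesis using less True by (simp add: mult.commute)
    next
      case greater
      hence "jacobi_functional (\<mu> - 1/2) ?m (?p * ?p') = 0"
        using degree_jacobi_orthonormal[OF \<alpha>, of "real ?m'" l'] by (intro jacobi_orthonormal_orthogonal[OF \<alpha> \<beta>]) simp
      thus ?thesis using greater True by simp
    qed
  qed auto
  finally show ?thesis .
qed

lemma disk_basis_orthogonal:
  assumes g: "bipoly d g" and "d < k" and I: "(l, \<epsilon>) \<in> basis_indices k"
  shows "mean \<mu> (\<lambda>x y. g x y * disk_basis \<mu> k l \<epsilon> x y) = 0"
proof -
  note D = basis_indicesD[OF I]
  let ?m = "k - 2 * l"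
  let ?p = "jacobi_orthonormal (\<mu> - 1/2) (real ?m) l"
  have \<alpha>: "\<mu> - 1/2 > -1" and \<beta>: "real ?m > -1" using \<mu> by auto
  \<comment> \<open>The induction carries the degree bound because additivity of \<open>mean\<close>
    needs integrability.\<close>
  have "bipoly d g \<and> mean \<mu> (\<lambda>x y. g x y * disk_basis \<mu> k l \<epsilon> x y) = 0"
    using bipoly_imp_harm_span[OF g]
  proof (induction rule: harm_span.induct)
    case (harm_span_base s m \<epsilon>')
    have deg: "degree ([:1/2, 1/2::real:] ^ s) = s" by (simp add: degree_power_eq)
    have "bipoly (2 * s + m) (radial ([:1/2, 1/2:] ^ s) m \<epsilon>')"
      using bipoly_radial[of \<epsilon>' "[:1/2, 1/2:] ^ s" m] harm_span_base deg by simp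
    hence b: "bipoly d (radial ([:1/2, 1/2:] ^ s) m \<epsilon>')"
      using bipoly_mono harm_span_base by blast
    have "mean \<mu> (\<lambda>x y. radial ([:1/2, 1/2:] ^ s) m \<epsilon>' x y * disk_basis \<mu> k l \<epsilon> x y) = 0"
    proof (cases "trig_valid m \<epsilon>'")
      case True
      have "mean \<mu> (\<lambda>x y. radial ([:1/2, 1/2:] ^ s) m \<epsilon>' x y * disk_basis \<mu> k l \<epsilon> x y) =
        mean \<mu> (\<lambda>x y. basis_norm_const \<mu> l k * (radial ?p ?m \<epsilon> x y * radial ([:1/2, 1/2:] ^ s) m \<epsilon>' x y))"
        unfolding disk_basis_eq by (rule arg_cong[of _ _ "mean \<mu>"]) (simp add: mult_ac)
      also have "\<dots> = basis_norm_const \<mu> l k * (if ?m = m \<and> \<epsilon> = \<epsilon>' then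
          radial_norm ?m * jacobi_functional (\<mu> - 1/2) ?m (?p * [:1/2, 1/2:] ^ s) else 0)"
        unfolding mean_cmult mean_radial[OF D(2) True] ..
      also have "\<dots> = 0"
      proof (cases "?m = m")
        case True
        \<comment> \<open>For equal frequency m, 2 s + m is at most d, hence less than k = 2 l +
          m.\<close>
        hence "s < l" using harm_span_base \<open>d < k\<close> D by linarith
        hence "jacobi_functional (\<mu> - 1/2) ?m (?p * [:1/2, 1/2:] ^ s) = 0"
          using deg by (intro jacobi_orthonormal_orthogonal[OF \<alpha> \<beta>]) simp
        thus ?thesis by (simp only: mult_zero_right if_cancel)
      qed auto
      finally show ?thesis .
    next
      case False
      thus ?thesis using radial_invalid[of \<epsilon>' m] harm_span_base by (simp add: mean_def)
    qed
    thus ?case using b by (simp add: power_eq_radial[abs_def])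
  next
    case (harm_span_add g h)
    have b: "bipoly k (disk_basis \<mu> k l \<epsilon>)" by (rule bipoly_disk_basis[OF I])
    show ?case
      using harm_span_add mean_add[OF bipoly_mult[OF _ b] bipoly_mult[OF _ b], of d g d h]
      by (auto simp: distrib_right intro: bipoly_add)
  next
    case (harm_span_cmult g c)
    thus ?case using mean_cmult[of c "\<lambda>x y. g x y * disk_basis \<mu> k l \<epsilon> x y"]
      by (auto simp: mult.assoc intro: bipoly_cmult)
  qed
  thus ?thesis by simp
qed

definition fourier_sum :: "nat \<Rightarrow> (real \<Rightarrow> real \<Rightarrow> real) \<Rightarrow> real \<Rightarrow> real \<Rightarrow> real" where
  "fourier_sum n g x y = (\<Sum>k\<le>n. \<Sum>(l, \<epsilon>)\<in>basis_indices k.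
     mean \<mu> (\<lambda>x y. g x y * disk_basis \<mu> k l \<epsilon> x y) * disk_basis \<mu> k l \<epsilon> x y)"

lemma fourier_sum_add:
  assumes "bipoly d g" "bipoly e h"
  shows "fourier_sum n (\<lambda>x y. g x y + h x y) x y = fourier_sum n g x y + fourier_sum n h x y"
proof -
  have "mean \<mu> (\<lambda>x y. (g x y + h x y) * disk_basis \<mu> k l \<epsilon> x y) =
      mean \<mu> (\<lambda>x y. g x y * disk_basis \<mu> k l \<epsilon> x y) + mean \<mu> (\<lambda>x y. h x y * disk_basis \<mu> k l \<epsilon> x y)"
    if "(l, \<epsilon>) \<in> basis_indices k" for k l \<epsilon>
    using mean_add[OF bipoly_mult[OF assms(1) bipoly_disk_basis[OF that]] bipoly_mult[OF assms(2) bipoly_disk_basis[OF that]]]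
    by (simp add: distrib_right)
  thus ?thesis
    unfolding fourier_sum_def sum.distrib[symmetric]
    by (intro sum.cong refl) (auto simp: distrib_right)
qed

lemma fourier_sum_cmult: "fourier_sum n (\<lambda>x y. c * g x y) x y = c * fourier_sum n g x y"
  unfolding fourier_sum_def sum_distrib_left
  by (intro sum.cong refl) (auto simp: mean_cmult mult.assoc)

lemma fourier_sum_disk_basis:
  assumes I: "(l, \<epsilon>) \<in> basis_indices k" and "k \<le> n"
  shows "fourier_sum n (disk_basis \<mu> k l \<epsilon>) x y = disk_basis \<mu> k l \<epsilon> x y"
proof -
  have "fourier_sum n (disk_basis \<mu> k l \<epsilon>) x y =
      (\<Sum>k'\<le>n. \<Sum>q\<in>basis_indices k'. if k' = k then (if q = (l, \<epsilon>) then disk_basis \<mu> k l \<epsilon> x y else 0) else 0)"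
    unfolding fourier_sum_def
    by (intro sum.cong refl) (auto simp: disk_basis_orthonormal[OF I] split: if_splits)
  also have "\<dots> = (\<Sum>k'\<le>n. if k' = k then disk_basis \<mu> k l \<epsilon> x y else 0)"
    by (intro sum.cong refl) (auto simp: sum.delta I)
  finally show ?thesis using \<open>k \<le> n\<close> by simp
qed

text \<open>Induction on the degree of the radial factor: a multiple of the orthonormal Jacobi
  polynomial of that degree, which gives a multiple of a basis function, removes the leading
  term.\<close>

lemma fourier_sum_radial:
  assumes v: "trig_valid m \<epsilon>"
  shows "2 * degree q + m \<le> n \<Longrightarrow> fourier_sum n (radial q m \<epsilon>) x y = radial q m \<epsilon> x y"
proof (induction "degree q" arbitrary: q rule: less_induct)
  case less
  define s where "s = degree q"
  have \<alpha>: "\<mu> - 1/2 > -1" and \<beta>: "real m > -1" using \<mu> by auto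
  have \<epsilon>: "\<epsilon> \<le> Suc 0" using v by (auto simp: trig_valid_def)
  define p where "p = jacobi_orthonormal (\<mu> - 1/2) (real m) s"
  have p: "degree p = s" unfolding p_def by (rule degree_jacobi_orthonormal[OF \<alpha> \<beta>])
  have "p \<noteq> 0" using jacobi_orthonormal_norm[OF \<alpha> \<beta>, of s]
    by (auto simp: p_def jacobi_functional_0[OF \<alpha> \<beta>])
  define c where "c = lead_coeff q / lead_coeff p"
  define r where "r = q - smult c p"
  have "coeff p s \<noteq> 0" using p \<open>p \<noteq> 0\<close> by (metis leading_coeff_0_iff)
  hence "coeff r s = 0" using p by (simp add: r_def c_def s_def)
  moreover have "degree r \<le> s" unfolding r_def by (intro degree_diff_le) (auto simp: p s_def)
  ultimately have r: "r = 0 \<or> degree r < s" by (metis le_neq_implies_less leading_coeff_0_iff)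
  have fr: "fourier_sum n (radial r m \<epsilon>) x y = radial r m \<epsilon> x y"
  proof (cases "r = 0")
    case True
    hence "radial r m \<epsilon> = (\<lambda>x y. 0 * 0)" by (intro ext) (simp add: radial_def)
    thus ?thesis using fourier_sum_cmult[of n 0 "\<lambda>x y. 0" x y] by simp
  next
    case False
    hence "degree r < degree q" using r unfolding s_def by blast
    moreover have "2 * degree r + m \<le> n" using \<open>degree r < degree q\<close> less.prems by linarith
    ultimately show ?thesis by (rule less.hyps)
  qed
  have I: "(s, \<epsilon>) \<in> basis_indices (m + 2 * s)" by (rule basis_indicesI[OF v])
  define h where "h = basis_norm_const \<mu> s (m + 2 * s)"
  have h: "h \<noteq> 0" unfolding h_def by (rule basis_norm_const_nz) simp
  have "radial p m \<epsilon> x y = 1 / h * disk_basis \<mu> (m + 2 * s) s \<epsilon> x y" for x y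
    using h by (simp add: disk_basis_eq p_def h_def)
  hence pe: "radial p m \<epsilon> = (\<lambda>x y. 1 / h * disk_basis \<mu> (m + 2 * s) s \<epsilon> x y)" by (intro ext)
  have fp: "fourier_sum n (radial p m \<epsilon>) x y = radial p m \<epsilon> x y"
    unfolding pe fourier_sum_cmult
    using fourier_sum_disk_basis[OF I, of n x y] less.prems by (simp add: s_def)
  have "q = r + smult c p" by (simp add: r_def)
  hence eq: "radial q m \<epsilon> = (\<lambda>x y. radial r m \<epsilon> x y + c * radial p m \<epsilon> x y)"
    by (intro ext) (metis radial_add radial_smult)
  have "fourier_sum n (radial q m \<epsilon>) x y = radial r m \<epsilon> x y + c * radial p m \<epsilon> x y"
    unfolding eq fourier_sum_add[OF bipoly_radial[OF \<epsilon>] bipoly_cmult[OF bipoly_radial[OF \<epsilon>]]]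
      fourier_sum_cmult fr fp ..
  thus ?case unfolding eq .
qed

text \<open>Completeness of the basis. By linearity the generators suffice, and each of them is
  either \<open>radial\<close> with a valid angular factor or zero.\<close>

lemma fourier_sum_bipoly:
  assumes "bipoly n g"
  shows "fourier_sum n g x y = g x y"
proof -
  have "bipoly n g \<and> (\<forall>x y. fourier_sum n g x y = g x y)"
    using bipoly_imp_harm_span[OF assms]
  proof (induction rule: harm_span.induct)
    case (harm_span_base s m \<epsilon>')
    have deg: "degree ([:1/2, 1/2::real:] ^ s) = s" by (simp add: degree_power_eq)
    have "bipoly (2 * s + m) (radial ([:1/2, 1/2:] ^ s) m \<epsilon>')"
      using bipoly_radial[of \<epsilon>' "[:1/2, 1/2:] ^ s" m] harm_span_base deg by simp
    hence b: "bipoly n (radial ([:1/2, 1/2:] ^ s) m \<epsilon>')"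
      using bipoly_mono harm_span_base by blast
    have "fourier_sum n (radial ([:1/2, 1/2:] ^ s) m \<epsilon>') x y = radial ([:1/2, 1/2:] ^ s) m \<epsilon>' x y" for x y
    proof (cases "trig_valid m \<epsilon>'")
      case True
      thus ?thesis using harm_span_base deg by (intro fourier_sum_radial) auto
    next
      case False
      hence "radial ([:1/2, 1/2:] ^ s) m \<epsilon>' = (\<lambda>x y. 0 * 0)"
        using radial_invalid[of \<epsilon>' m] harm_span_base by (intro ext) simp
      thus ?thesis using fourier_sum_cmult[of n 0 "\<lambda>x y. 0" x y] by simp
    qed
    thus ?case using b by (simp add: power_eq_radial[abs_def])
  next
    case (harm_span_add g h)
    thus ?case by (auto simp: fourier_sum_add[of n g n h] intro: bipoly_add)
  next
    case (harm_span_cmult g c)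
    thus ?case by (auto simp: fourier_sum_cmult intro: bipoly_cmult)
  qed
  thus ?thesis by simp
qed

end

section \<open>Ridge polynomials and the addition formula\<close>

text \<open>A second generating set, suited to slices: with x fixed at t and y = sqrt(1 - t^2) cos
  \<alpha>, a monomial separates into powers in t and a moment of cos \<alpha>.\<close>

inductive mono_span :: "nat \<Rightarrow> (real \<Rightarrow> real \<Rightarrow> real) \<Rightarrow> bool" for d where
  mono_span_base: "i + j \<le> d \<Longrightarrow> mono_span d (\<lambda>x y. x ^ i * y ^ j)"
| mono_span_add: "mono_span d g \<Longrightarrow> mono_span d h \<Longrightarrow> mono_span d (\<lambda>x y. g x y + h x y)"
| mono_span_cmult: "mono_span d g \<Longrightarrow> mono_span d (\<lambda>x y. c * g x y)"

lemma mono_span_mult_xy: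
  assumes "mono_span d g"
  shows "mono_span (Suc d) (\<lambda>x y. x * g x y)" "mono_span (Suc d) (\<lambda>x y. y * g x y)"
  using assms
proof (induction rule: mono_span.induct)
  case (mono_span_base i j)
  { case 1 show ?case using mono_span.mono_span_base[of "Suc i" j "Suc d"] mono_span_base by (simp add: mult.assoc) }
  { case 2 show ?case using mono_span.mono_span_base[of i "Suc j" "Suc d"] mono_span_base by (simp add: mult.left_commute) }
next
  case (mono_span_add g h)
  { case 1 show ?case using mono_span.mono_span_add[OF mono_span_add.IH(1,3)] by (simp add: distrib_left) }
  { case 2 show ?case using mono_span.mono_span_add[OF mono_span_add.IH(2,4)] by (simp add: distrib_left) }
next
  case (mono_span_cmult g c)
  { case 1 show ?case using mono_span.mono_span_cmult[OF mono_span_cmult.IH(1), of c] by (simp only: mult.left_commute[of _ c]) }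
  { case 2 show ?case using mono_span.mono_span_cmult[OF mono_span_cmult.IH(2), of c] by (simp only: mult.left_commute[of _ c]) }
qed

lemma bipoly_imp_mono_span: "bipoly d g \<Longrightarrow> mono_span d g"
proof (induction rule: bipoly.induct)
  case (bipoly_const d c)
  show ?case using mono_span_cmult[OF mono_span_base[of 0 0 d], of c] by simp
qed (auto intro: mono_span_mult_xy mono_span_add)

text \<open>For a = cos \<theta> and b = sin \<theta> the new first axis is the direction of the
  slices; the degree bound is unaffected.\<close>

lemma bipoly_rotate:
  "bipoly d g \<Longrightarrow> bipoly d (\<lambda>t v. g (t * a - v * b) (t * b + v * a))"
proof (induction rule: bipoly.induct)
  case (bipoly_mult_x d g)
  have "bipoly (Suc d) (\<lambda>t v. (a * t - b * v) * g (t * a - v * b) (t * b + v * a))"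
    using bipoly_mult[OF bipoly_diff[OF bipoly_cmult[OF bipoly_x] bipoly_cmult[OF bipoly_y]] bipoly_mult_x.IH, of a b] by simp
  thus ?case by (simp add: mult.commute)
next
  case (bipoly_mult_y d g)
  have "bipoly (Suc d) (\<lambda>t v. (b * t + a * v) * g (t * a - v * b) (t * b + v * a))"
    using bipoly_mult[OF bipoly_add[OF bipoly_cmult[OF bipoly_x] bipoly_cmult[OF bipoly_y]] bipoly_mult_y.IH, of b a] by simp
  thus ?case by (simp add: mult.commute)
qed (auto intro: bipoly_const bipoly_add)

context
  fixes \<mu> :: real
  assumes \<mu>: "\<mu> \<ge> 0"
begin

lemma set_integrable_circle_weight:
  assumes "continuous_on UNIV f"
  shows "set_integrable lborel {0..2 * pi} (\<lambda>\<alpha>. f \<alpha> * abs_weight \<mu> (sin \<alpha>))"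
proof -
  have [measurable]: "f \<in> borel_measurable borel" using assms by (rule borel_measurable_continuous_onI)
  have "set_integrable lborel {0..2 * pi} f"
    using assms by (intro borel_integrable_atLeastAtMost') (rule continuous_on_subset, auto)
  thus ?thesis unfolding set_integrable_def
  proof (rule Bochner_Integration.integrable_bound)
    show "AE \<alpha> in lborel. norm (indicator {0..2 * pi} \<alpha> *\<^sub>R (f \<alpha> * abs_weight \<mu> (sin \<alpha>))) \<le> norm (indicator {0..2 * pi} \<alpha> *\<^sub>R f \<alpha>)"
    proof (intro AE_I2)
      fix \<alpha> :: real
      have "\<bar>abs_weight \<mu> (sin \<alpha>)\<bar> \<le> 1" using abs_weight_le_1[OF \<mu>, of "sin \<alpha>"] by simp
      hence "\<bar>f \<alpha>\<bar> * \<bar>abs_weight \<mu> (sin \<alpha>)\<bar> \<le> \<bar>f \<alpha>\<bar> * 1" by (intro mult_left_mono) auto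
      thus "norm (indicator {0..2 * pi} \<alpha> *\<^sub>R (f \<alpha> * abs_weight \<mu> (sin \<alpha>))) \<le> norm (indicator {0..2 * pi} \<alpha> *\<^sub>R f \<alpha>)"
        by (auto simp: indicator_def abs_mult)
    qed
  qed measurable
qed

definition circle_moment :: "nat \<Rightarrow> real" where
  "circle_moment j = (LINT \<alpha>:{0..2 * pi}|lborel. cos \<alpha> ^ j * abs_weight \<mu> (sin \<alpha>))"

text \<open>The shift by pi changes the sign of the integrand. The available shift rule is for
  \<open>ennreal\<close>, so it is applied to 1 + f and 1 - f, which are nonnegative because |f| is
  at most 1.\<close>

lemma circle_moment_odd:
  assumes "odd j"
  shows "circle_moment j = 0"
proof -
  define f where "f = (\<lambda>\<alpha>. cos \<alpha> ^ j * abs_weight \<mu> (sin \<alpha>))"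
  have [measurable]: "f \<in> borel_measurable borel" unfolding f_def by measurable
  have f_int: "set_integrable lborel {0..2 * pi} f"
    unfolding f_def by (intro set_integrable_circle_weight continuous_intros)
  have c_int: "set_integrable lborel {0..2 * pi} (\<lambda>\<alpha>. 1 :: real)"
    by (intro borel_integrable_atLeastAtMost' continuous_intros)
  have bound: "\<bar>f \<alpha>\<bar> \<le> 1" for \<alpha>
    using abs_weight_le_1[OF \<mu>, of "sin \<alpha>"] unfolding f_def abs_mult power_abs
    by (intro mult_le_one power_le_one) auto
  have nonneg: "1 + f \<alpha> \<ge> 0" "1 - f \<alpha> \<ge> 0" for \<alpha>
    using bound[of \<alpha>] by (auto simp: abs_le_iff)
  have conv: "(\<integral>\<^sup>+\<alpha>\<in>{0..2 * pi}. ennreal (1 + e * f \<alpha>) \<partial>lborel) = ennreal (2 * pi + e * circle_moment j)"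
    "2 * pi + e * circle_moment j \<ge> 0"
    if e: "e \<in> {-1, 1}" for e
  proof -
    have int: "set_integrable lborel {0..2 * pi} (\<lambda>\<alpha>. 1 + e * f \<alpha>)"
      using f_int c_int by (intro set_integral_add) auto
    have val: "(LINT \<alpha>:{0..2 * pi}|lborel. 1 + e * f \<alpha>) = 2 * pi + e * circle_moment j"
      using f_int c_int by (subst set_integral_add) (auto simp: circle_moment_def f_def set_lebesgue_integral_def)
    have nn: "indicator {0..2 * pi} \<alpha> *\<^sub>R (1 + e * f \<alpha>) \<ge> 0" for \<alpha>
      using nonneg[of \<alpha>] e by (auto simp: indicator_def)
    have "(\<integral>\<^sup>+\<alpha>\<in>{0..2 * pi}. ennreal (1 + e * f \<alpha>) \<partial>lborel) =
        (\<integral>\<^sup>+\<alpha>. ennreal (indicator {0..2 * pi} \<alpha> *\<^sub>R (1 + e * f \<alpha>)) \<partial>lborel)"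
      by (intro nn_integral_cong) (auto simp: indicator_def)
    also have "\<dots> = ennreal (LINT \<alpha>:{0..2 * pi}|lborel. 1 + e * f \<alpha>)"
      using int nn unfolding set_integrable_def set_lebesgue_integral_def by (intro nn_integral_eq_integral) auto
    finally show "(\<integral>\<^sup>+\<alpha>\<in>{0..2 * pi}. ennreal (1 + e * f \<alpha>) \<partial>lborel) = ennreal (2 * pi + e * circle_moment j)"
      unfolding val .
    show "2 * pi + e * circle_moment j \<ge> 0"
      unfolding val[symmetric] set_lebesgue_integral_def using nn by (intro Bochner_Integration.integral_nonneg) auto
  qed
  have "f (\<alpha> + pi) = - f \<alpha>" for \<alpha> using assms by (simp add: f_def)
  hence "(\<integral>\<^sup>+\<alpha>\<in>{0..2 * pi}. ennreal (1 + -1 * f \<alpha>) \<partial>lborel) =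
      (\<integral>\<^sup>+\<alpha>\<in>{0..2 * pi}. ennreal (1 + f (\<alpha> + pi)) \<partial>lborel)" by simp
  also have "\<dots> = (\<integral>\<^sup>+\<alpha>\<in>{0..2 * pi}. ennreal (1 + 1 * f \<alpha>) \<partial>lborel)"
    by (subst nn_integral_periodic_shift[where g = "\<lambda>\<alpha>. ennreal (1 + f \<alpha>)"]) (auto simp: f_def)
  finally have "ennreal (2 * pi + -1 * circle_moment j) = ennreal (2 * pi + 1 * circle_moment j)"
    using conv(1)[of 1] conv(1)[of "-1"] by simp
  thus ?thesis using conv(2)[of 1] conv(2)[of "-1"] by simp
qed

text \<open>On the circle at height t the weight is |sqrt(1 - t^2)|^(2 \<mu>) |sin \<alpha>|^(2
  \<mu>). The first factor becomes the Jacobi weight in t, and the second goes into the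
  slice.\<close>

lemma ridge_mean_slices:
  assumes g: "bipoly d g" and \<theta>: "0 \<le> \<theta>" "\<theta> \<le> 2 * pi"
    and slice: "\<And>t. t \<in> {-1..1} \<Longrightarrow> (LINT \<alpha>:{0..2 * pi}|lborel.
      g (t * cos \<theta> - (sqrt (1 - t\<^sup>2) * cos \<alpha>) * sin \<theta>) (t * sin \<theta> + (sqrt (1 - t\<^sup>2) * cos \<alpha>) * cos \<theta>) * abs_weight \<mu> (sin \<alpha>)) =
      A * poly R t"
  shows "mean \<mu> (\<lambda>x y. poly C (x * cos \<theta> + y * sin \<theta>) * g x y) =
    disk_const \<mu> / 2 * A * (LINT t:{-1..1}|lborel. poly (C * R) t * jacobi_weight \<mu> \<mu> t)"
proof -
  define F where "F = (\<lambda>u :: real ^ 3. poly C (u $ 1 * cos \<theta> + u $ 2 * sin \<theta>) * planar g u)"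
  have cont: "continuous_on UNIV F"
    unfolding F_def by (intro continuous_intros continuous_on_bipoly[OF g])
  have [measurable]: "poly p \<in> borel_measurable borel" for p :: "real poly"
    by (intro borel_measurable_continuous_onI continuous_intros)
  let ?c = "circle_point (equator_point \<theta>)"
  have inner: "(LINT \<alpha>:{0..2 * pi}|lborel. F (?c t \<alpha>) * sphere_weight \<mu> (?c t \<alpha>)) =
      poly (C * R) t * A * abs_weight \<mu> (sqrt (1 - t\<^sup>2))" if t: "t \<in> {-1..1}" for t
  proof -
    have "F (?c t \<alpha>) * sphere_weight \<mu> (?c t \<alpha>) = poly C t * abs_weight \<mu> (sqrt (1 - t\<^sup>2)) *
      (g (t * cos \<theta> - (sqrt (1 - t\<^sup>2) * cos \<alpha>) * sin \<theta>) (t * sin \<theta> + (sqrt (1 - t\<^sup>2) * cos \<alpha>) * cos \<theta>) * abs_weight \<mu> (sin \<alpha>))" for \<alpha>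
      unfolding F_def circle_point_height by (simp add: sphere_weight_eq circle_point_def equator_point_def abs_weight_mult)
    hence "(LINT \<alpha>:{0..2 * pi}|lborel. F (?c t \<alpha>) * sphere_weight \<mu> (?c t \<alpha>)) =
        poly C t * abs_weight \<mu> (sqrt (1 - t\<^sup>2)) * (A * poly R t)"
      unfolding slice[OF t, symmetric] by simp
    thus ?thesis by simp
  qed
  have "mean \<mu> (\<lambda>x y. poly C (x * cos \<theta> + y * sin \<theta>) * g x y) = (LINT u|sphere_prob \<mu>. F u)"
    by (simp add: mean_def F_def)
  also have "\<dots> = disk_const \<mu> / 2 * (LINT t:{-1..1}|lborel. LINT \<alpha>:{0..2 * pi}|lborel.
     F (?c t \<alpha>) * sphere_weight \<mu> (?c t \<alpha>))"
    by (rule mean_circle[OF \<mu> borel_measurable_continuous_onI[OF cont] integrable_sphere_prob_continuous[OF \<mu> cont] \<theta>])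
  also have "(LINT t:{-1..1}|lborel. LINT \<alpha>:{0..2 * pi}|lborel. F (?c t \<alpha>) * sphere_weight \<mu> (?c t \<alpha>)) =
      (LINT t:{-1..1}|lborel. poly (C * R) t * A * abs_weight \<mu> (sqrt (1 - t\<^sup>2)))"
    by (rule set_lebesgue_integral_cong) (use inner in auto)
  also have "\<dots> = (LINT t:{-1..1}|lborel. A * (poly (C * R) t * jacobi_weight \<mu> \<mu> t))"
    unfolding set_lebesgue_integral_def
  proof (rule integral_cong_AE)
    have "AE t in lborel. t \<notin> {-1, 1::real}"
      by (intro AE_not_in finite_imp_null_set_lborel) auto
    thus "AE t in lborel. indicator {-1..1} t *\<^sub>R (poly (C * R) t * A * abs_weight \<mu> (sqrt (1 - t\<^sup>2))) =
       indicator {-1..1} t *\<^sub>R (A * (poly (C * R) t * jacobi_weight \<mu> \<mu> t))"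
    proof eventually_elim
      case (elim t)
      show ?case
      proof (cases "t \<in> {-1..1}")
        case True
        hence "t\<^sup>2 < 1" using elim by (simp add: abs_square_less_1 abs_less_iff)
        hence "abs_weight \<mu> (sqrt (1 - t\<^sup>2)) = (1 - t\<^sup>2) powr \<mu>" by (rule abs_weight_sqrt)
        also have "(1 - t\<^sup>2) powr \<mu> = ((1 - t) * (1 + t)) powr \<mu>" by (simp add: power2_eq_square algebra_simps)
        also have "((1 - t) * (1 + t)) powr \<mu> = jacobi_weight \<mu> \<mu> t"
          using True by (simp add: jacobi_weight_def powr_mult)
        finally have "abs_weight \<mu> (sqrt (1 - t\<^sup>2)) = jacobi_weight \<mu> \<mu> t" .
        thus ?thesis by simp
      qed simp
    qed
    show "(\<lambda>t. indicator {-1..1} t *\<^sub>R (A * (poly (C * R) t * jacobi_weight \<mu> \<mu> t))) \<in> borel_measurable lborel"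
      unfolding jacobi_weight_def by measurable
  qed measurable
  also have "\<dots> = A * (LINT t:{-1..1}|lborel. poly (C * R) t * jacobi_weight \<mu> \<mu> t)"
    by (rule set_integral_mult_right)
  finally show ?thesis by simp
qed

text \<open>Obtained by slicing the constant 1, whose mean is 1; no explicit value of the circle
  integral is needed.\<close>

lemma circle_moment_0: "disk_const \<mu> / 2 * circle_moment 0 * (LINT t:{-1..1}|lborel. jacobi_weight \<mu> \<mu> t) = 1"
proof -
  have "mean \<mu> (\<lambda>x y. poly 1 (x * cos 0 + y * sin 0) * 1) =
      disk_const \<mu> / 2 * circle_moment 0 * (LINT t:{-1..1}|lborel. poly (1 * 1) t * jacobi_weight \<mu> \<mu> t)"
    by (rule ridge_mean_slices[OF bipoly_const]) (auto simp: circle_moment_def)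
  moreover have "mean \<mu> (\<lambda>x y. 1) = 1"
    using measure_sphere_prob_UNIV[OF \<mu>] by (simp add: mean_def)
  ultimately show ?thesis by simp
qed

text \<open>An odd power of sqrt(1 - t^2) is not a polynomial, but it comes with an odd moment,
  which is 0; even powers are powers of 1 - t^2. At t = 1 the circle is a single point, which gives
  the value of \<open>R\<close> there.\<close>

lemma slice_polynomial:
  assumes "bipoly d g"
  shows "\<exists>R. degree R \<le> d \<and> poly R 1 = g 1 0 \<and> (\<forall>t\<in>{-1..1}. (LINT \<alpha>:{0..2 * pi}|lborel.
      g t (sqrt (1 - t\<^sup>2) * cos \<alpha>) * abs_weight \<mu> (sin \<alpha>)) = circle_moment 0 * poly R t)"
proof -
  have A: "circle_moment 0 \<noteq> 0" using circle_moment_0 by auto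
  \<comment> \<open>Continuity is carried through the induction since adding slice integrals
    requires integrability.\<close>
  have "(\<forall>t. continuous_on UNIV (\<lambda>v. g t v)) \<and> ?thesis"
    using bipoly_imp_mono_span[OF assms]
  proof (induction rule: mono_span.induct)
    case (mono_span_base i j)
    define R :: "real poly" where "R = smult (circle_moment j / circle_moment 0) ([:0, 1:] ^ i * [:1, 0, -1:] ^ (j div 2))"
    have int: "(LINT \<alpha>:{0..2 * pi}|lborel. t ^ i * (sqrt (1 - t\<^sup>2) * cos \<alpha>) ^ j * abs_weight \<mu> (sin \<alpha>)) =
        t ^ i * sqrt (1 - t\<^sup>2) ^ j * circle_moment j" for t
      unfolding circle_moment_def by (simp add: power_mult_distrib mult.assoc)
    have "degree R \<le> d"
    proof -
      have "degree ([:0, 1:] ^ i * [:1, 0, -1::real:] ^ (j div 2)) \<le> i + 2 * (j div 2)"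
        by (intro order.trans[OF degree_mult_le] add_mono order.trans[OF degree_power_le]) auto
      moreover have "2 * (j div 2) \<le> j" by simp
      ultimately show ?thesis
        unfolding R_def using mono_span_base by (intro order.trans[OF degree_smult_le]) linarith
    qed
    moreover have "poly R 1 = 1 ^ i * 0 ^ j"
    proof (cases "odd j")
      case True
      thus ?thesis by (cases j) (auto simp: R_def circle_moment_odd)
    next
      case False
      thus ?thesis using A by (cases "j = 0") (auto simp: R_def power_0_left elim!: evenE)
    qed
    moreover have "t ^ i * sqrt (1 - t\<^sup>2) ^ j * circle_moment j = circle_moment 0 * poly R t" if t: "t \<in> {-1..1}" for t
    proof (cases "odd j")
      case False
      then obtain b where b: "j = 2 * b" by (auto elim: evenE)
      have "t\<^sup>2 \<le> 1" using t by (simp add: abs_square_le_1 abs_le_iff)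
      hence "sqrt (1 - t\<^sup>2) ^ j = (1 - t\<^sup>2) ^ b" by (simp add: b power_mult)
      moreover have "poly [:1, 0, -1:] t = 1 - t\<^sup>2" by (simp add: power2_eq_square)
      ultimately show ?thesis using A by (simp add: R_def b)
    qed (simp add: R_def circle_moment_odd)
    ultimately show ?case unfolding int by (auto intro!: continuous_intros)
  next
    case (mono_span_add g h)
    then obtain R1 R2 where R: "degree R1 \<le> d" "poly R1 1 = g 1 0" "degree R2 \<le> d" "poly R2 1 = h 1 0"
      "\<And>t. t \<in> {-1..1} \<Longrightarrow> (LINT \<alpha>:{0..2 * pi}|lborel. g t (sqrt (1 - t\<^sup>2) * cos \<alpha>) * abs_weight \<mu> (sin \<alpha>)) = circle_moment 0 * poly R1 t"
      "\<And>t. t \<in> {-1..1} \<Longrightarrow> (LINT \<alpha>:{0..2 * pi}|lborel. h t (sqrt (1 - t\<^sup>2) * cos \<alpha>) * abs_weight \<mu> (sin \<alpha>)) = circle_moment 0 * poly R2 t"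
      by blast
    have c: "continuous_on UNIV (\<lambda>v. g t v)" "continuous_on UNIV (\<lambda>v. h t v)" for t
      using mono_span_add.IH by auto
    have int: "set_integrable lborel {0..2 * pi} (\<lambda>\<alpha>. g t (s * cos \<alpha>) * abs_weight \<mu> (sin \<alpha>))"
      "set_integrable lborel {0..2 * pi} (\<lambda>\<alpha>. h t (s * cos \<alpha>) * abs_weight \<mu> (sin \<alpha>))" for t s
      by (intro set_integrable_circle_weight continuous_on_compose2[OF c(1)] continuous_on_compose2[OF c(2)] continuous_intros subset_UNIV)+
    have "degree (R1 + R2) \<le> d" using R by (intro degree_add_le)
    moreover have "poly (R1 + R2) 1 = g 1 0 + h 1 0" using R by simp
    moreover have "(LINT \<alpha>:{0..2 * pi}|lborel. (g t (sqrt (1 - t\<^sup>2) * cos \<alpha>) + h t (sqrt (1 - t\<^sup>2) * cos \<alpha>)) * abs_weight \<mu> (sin \<alpha>)) =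
        circle_moment 0 * poly (R1 + R2) t" if "t \<in> {-1..1}" for t
      using R(5,6)[OF that] int by (simp add: distrib_right distrib_left set_integral_add)
    ultimately show ?case using c by (auto intro!: continuous_on_add)
  next
    case (mono_span_cmult g c)
    then obtain R where R: "degree R \<le> d" "poly R 1 = g 1 0"
      "\<And>t. t \<in> {-1..1} \<Longrightarrow> (LINT \<alpha>:{0..2 * pi}|lborel. g t (sqrt (1 - t\<^sup>2) * cos \<alpha>) * abs_weight \<mu> (sin \<alpha>)) = circle_moment 0 * poly R t"
      by blast
    have "degree (smult c R) \<le> d" using R by (intro order.trans[OF degree_smult_le])
    moreover have "poly (smult c R) 1 = c * g 1 0" using R by simp
    moreover have "(LINT \<alpha>:{0..2 * pi}|lborel. c * g t (sqrt (1 - t\<^sup>2) * cos \<alpha>) * abs_weight \<mu> (sin \<alpha>)) =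
        circle_moment 0 * poly (smult c R) t" if "t \<in> {-1..1}" for t
      using R(3)[OF that] by (simp add: mult.assoc)
    moreover have "continuous_on UNIV (\<lambda>v. c * g t v)" for t
      using mono_span_cmult.IH by (intro continuous_intros) auto
    ultimately show ?case by blast
  qed
  thus ?thesis by blast
qed

text \<open>A Funk-Hecke formula. \<open>R\<close> depends on \<open>g\<close> and the direction but
  not on \<open>C\<close>; varying \<open>C\<close> therefore transfers orthogonality from
  \<open>g\<close> to \<open>R\<close>.\<close>

lemma ridge_mean:
  assumes g: "bipoly d g" and \<theta>: "0 \<le> \<theta>" "\<theta> \<le> 2 * pi"
  shows "\<exists>R. degree R \<le> d \<and> poly R 1 = g (cos \<theta>) (sin \<theta>) \<and>
    (\<forall>C. mean \<mu> (\<lambda>x y. poly C (x * cos \<theta> + y * sin \<theta>) * g x y) = jacobi_functional \<mu> \<mu> (C * R))"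
proof -
  have \<mu>': "\<mu> > -1" using \<mu> by simp
  from slice_polynomial[OF bipoly_rotate[OF g, of "cos \<theta>" "sin \<theta>"]] obtain R where R:
    "degree R \<le> d" "poly R 1 = g (cos \<theta>) (sin \<theta>)"
    "\<And>t. t \<in> {-1..1} \<Longrightarrow> (LINT \<alpha>:{0..2 * pi}|lborel.
      g (t * cos \<theta> - (sqrt (1 - t\<^sup>2) * cos \<alpha>) * sin \<theta>) (t * sin \<theta> + (sqrt (1 - t\<^sup>2) * cos \<alpha>) * cos \<theta>) * abs_weight \<mu> (sin \<alpha>)) =
      circle_moment 0 * poly R t" by auto
  have "mean \<mu> (\<lambda>x y. poly C (x * cos \<theta> + y * sin \<theta>) * g x y) = jacobi_functional \<mu> \<mu> (C * R)" for C
  proof -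
    have "disk_const \<mu> / 2 * circle_moment 0 = 1 / (LINT t:{-1..1}|lborel. jacobi_weight \<mu> \<mu> t)"
      using circle_moment_0 integral_jacobi_weight_pos[OF \<mu>' \<mu>'] by (simp add: eq_divide_eq)
    moreover have "mean \<mu> (\<lambda>x y. poly C (x * cos \<theta> + y * sin \<theta>) * g x y) =
        disk_const \<mu> / 2 * circle_moment 0 * (LINT t:{-1..1}|lborel. poly (C * R) t * jacobi_weight \<mu> \<mu> t)"
      by (rule ridge_mean_slices[OF g \<theta> R(3)])
    ultimately show ?thesis by (simp add: jacobi_functional_def)
  qed
  with R show ?thesis by blast
qed

text \<open>By \<open>ridge_mean\<close> the Fourier coefficients of the ridge polynomial are multiples of the values of
  the basis at the direction; only those of degree \<open>k\<close> survive.\<close>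

lemma gegenbauer_addition:
  assumes \<theta>: "0 \<le> \<theta>" "\<theta> \<le> 2 * pi"
  shows "(real k + \<mu> + 1/2) / (\<mu> + 1/2) * poly (gegenbauer (\<mu> + 1/2) k) (x * cos \<theta> + y * sin \<theta>) =
    (\<Sum>(l, \<epsilon>)\<in>basis_indices k. disk_basis \<mu> k l \<epsilon> x y * disk_basis \<mu> k l \<epsilon> (cos \<theta>) (sin \<theta>))"
proof -
  have \<mu>': "\<mu> > -1" "\<mu> > -1/2" using \<mu> by auto
  define G where "G = gegenbauer (\<mu> + 1/2) k"
  define \<gamma> where "\<gamma> = (\<mu> + 1/2) / (real k + \<mu> + 1/2)"
  have degG: "degree G = k" unfolding G_def by (rule degree_gegenbauer[OF \<mu>'(2)])
  have ridge: "bipoly (degree q) (\<lambda>x y. poly q (x * cos \<theta> + y * sin \<theta>))" for q :: "real poly"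
  proof -
    have "bipoly 1 (\<lambda>x y. cos \<theta> * x + sin \<theta> * y)"
      using bipoly_x bipoly_y by (intro bipoly_add bipoly_cmult) simp_all
    from bipoly_poly[OF this, of q] show ?thesis by (simp add: mult.commute)
  qed
  have lower: "mean \<mu> (\<lambda>x y. poly G (x * cos \<theta> + y * sin \<theta>) * disk_basis \<mu> k' l \<epsilon> x y) = 0"
    if I: "(l, \<epsilon>) \<in> basis_indices k'" and "k' < k" for k' l \<epsilon>
  proof -
    obtain R where R: "degree R \<le> k'" "poly R 1 = disk_basis \<mu> k' l \<epsilon> (cos \<theta>) (sin \<theta>)"
      "\<And>C. mean \<mu> (\<lambda>x y. poly C (x * cos \<theta> + y * sin \<theta>) * disk_basis \<mu> k' l \<epsilon> x y) = jacobi_functional \<mu> \<mu> (C * R)"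
      using ridge_mean[OF bipoly_disk_basis[OF \<mu> I] \<theta>] by blast
    show ?thesis unfolding R(3) G_def using R(1) \<open>k' < k\<close> by (intro gegenbauer_orthogonal \<mu>'(2)) simp
  qed
  have top: "mean \<mu> (\<lambda>x y. poly G (x * cos \<theta> + y * sin \<theta>) * disk_basis \<mu> k l \<epsilon> x y) =
      \<gamma> * disk_basis \<mu> k l \<epsilon> (cos \<theta>) (sin \<theta>)" if I: "(l, \<epsilon>) \<in> basis_indices k" for l \<epsilon>
  proof -
    obtain R where R: "degree R \<le> k" "poly R 1 = disk_basis \<mu> k l \<epsilon> (cos \<theta>) (sin \<theta>)"
      "\<And>C. mean \<mu> (\<lambda>x y. poly C (x * cos \<theta> + y * sin \<theta>) * disk_basis \<mu> k l \<epsilon> x y) = jacobi_functional \<mu> \<mu> (C * R)"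
      using ridge_mean[OF bipoly_disk_basis[OF \<mu> I] \<theta>] by blast
    \<comment> \<open>Ridge polynomials of degree less than k are orthogonal to the basis function,
      which says that \<open>R\<close> is orthogonal to every such \<open>q\<close>.\<close>
    have orth: "jacobi_functional \<mu> \<mu> (R * q) = 0" if "degree q < k" for q
      using disk_basis_orthogonal[OF \<mu> ridge that I] R(3)[of q] by (simp add: mult.commute)
    \<comment> \<open>\<open>ridge_mean\<close> only bounds the degree of \<open>R\<close>. If it is
      less than k, then \<open>R\<close> is orthogonal to itself and is zero.\<close>
    have "R = smult (poly R 1) (jacobi_poly \<mu> \<mu> k)"
    proof (cases "degree R = k")
      case True
      thus ?thesis by (rule orthogonal_poly_unique[OF \<mu>'(1) \<mu>'(1) _ orth])
    next
      case False
      hence "jacobi_functional \<mu> \<mu> (R * R) = 0" using R(1) by (intro orth) simp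
      hence "R = 0" by (rule jacobi_functional_square_eq_0[OF \<mu>'(1) \<mu>'(1)])
      thus ?thesis by simp
    qed
    moreover have "G = smult (poly G 1) (jacobi_poly \<mu> \<mu> k)"
      by (rule orthogonal_poly_unique[OF \<mu>'(1) \<mu>'(1) degG]) (simp add: G_def gegenbauer_orthogonal[OF \<mu>'(2)])
    moreover have G1: "poly G 1 > 0" unfolding G_def by (rule gegenbauer_1_pos[OF \<mu>'(2)])
    ultimately have RG: "R = smult (poly R 1 / poly G 1) G"
      by (metis divide_cancel_right nonzero_eq_divide_eq order_less_irrefl smult_smult)
    have "jacobi_functional \<mu> \<mu> (G * R) = poly R 1 / poly G 1 * jacobi_functional \<mu> \<mu> (G * G)"
      by (subst RG) (simp add: jacobi_functional_smult[OF \<mu>'(1) \<mu>'(1)])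
    also have "\<dots> = \<gamma> * poly R 1"
      using G1 gegenbauer_square[OF \<mu>'(2), of k] by (simp add: G_def[symmetric] \<gamma>_def)
    finally show ?thesis unfolding R(3) R(2) .
  qed
  have "poly G (x * cos \<theta> + y * sin \<theta>) = fourier_sum \<mu> k (\<lambda>x y. poly G (x * cos \<theta> + y * sin \<theta>)) x y"
    using ridge[of G] unfolding degG by (intro fourier_sum_bipoly[OF \<mu>, symmetric])
  also have "\<dots> = (\<Sum>k'\<le>k. if k' = k then (\<Sum>(l, \<epsilon>)\<in>basis_indices k. \<gamma> * disk_basis \<mu> k l \<epsilon> (cos \<theta>) (sin \<theta>) * disk_basis \<mu> k l \<epsilon> x y) else 0)"
    unfolding fourier_sum_def[OF \<mu>]
  proof (intro sum.cong refl)
    fix k' assume k': "k' \<in> {..k}"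
    show "(\<Sum>(l, \<epsilon>)\<in>basis_indices k'. mean \<mu> (\<lambda>x y. poly G (x * cos \<theta> + y * sin \<theta>) * disk_basis \<mu> k' l \<epsilon> x y) * disk_basis \<mu> k' l \<epsilon> x y) =
      (if k' = k then (\<Sum>(l, \<epsilon>)\<in>basis_indices k. \<gamma> * disk_basis \<mu> k l \<epsilon> (cos \<theta>) (sin \<theta>) * disk_basis \<mu> k l \<epsilon> x y) else 0)"
    proof (cases "k' = k")
      case True
      thus ?thesis by (auto intro!: sum.cong simp: top)
    next
      case False
      thus ?thesis using k' by (auto intro!: sum.neutral simp: lower)
    qed
  qed
  also have "\<dots> = \<gamma> * (\<Sum>(l, \<epsilon>)\<in>basis_indices k. disk_basis \<mu> k l \<epsilon> x y * disk_basis \<mu> k l \<epsilon> (cos \<theta>) (sin \<theta>))"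
    by (simp add: sum_distrib_left case_prod_unfold mult_ac)
  finally show ?thesis using \<mu> by (simp add: G_def \<gamma>_def)
qed

end

section \<open>Quadrature and homogeneous polynomials\<close>

context
  fixes \<mu> :: real
  assumes \<mu>: "\<mu> \<ge> 0"
begin

text \<open>This explains \<lambda>: it compensates the mean square of a basis function on the unit
  circle. The value of the Jacobi polynomial cancels all of \<lambda> except m!/(\<mu> + 3/2)_m, and
  the norming constant cancels the rest.\<close>

lemma disk_multiplier_eq:
  assumes "2 * l \<le> k"
  shows "disk_multiplier \<mu> l k * (basis_norm_const \<mu> l k * poly (jacobi_orthonormal (\<mu> - 1/2) (real (k - 2 * l)) l) 1)\<^sup>2 *
    trig_norm (k - 2 * l) = 1"
proof -
  define m where "m = k - 2 * l"
  have k: "k = m + 2 * l" "k - l = m + l" using assms by (auto simp: m_def)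
  have \<alpha>: "\<mu> - 1/2 > -1" and \<beta>: "real m > -1" using \<mu> by auto
  have p1: "(poly (jacobi_orthonormal (\<mu> - 1/2) (real m) l) 1)\<^sup>2 =
     pochhammer (\<mu> + 1/2) l * pochhammer (\<mu> + 3/2 + m) l * (real k + \<mu> + 1/2) /
     (fact l * pochhammer (real m + 1) l * (real (m + l) + \<mu> + 1/2))"
  proof -
    have "\<mu> - 1/2 + real m + 1 > 0" using \<mu> by simp
    from jacobi_orthonormal_1_square[OF \<alpha> \<beta> this, of l] show ?thesis
      by (simp add: k(1) algebra_simps)
  qed
  have pos: "pochhammer (\<mu> + 1/2) l > 0" "pochhammer (\<mu> + 3/2 + m) l > 0" "pochhammer (real m + 1) l > 0"
    "pochhammer (\<mu> + 3/2) m > 0" "real k + \<mu> + 1/2 > 0" "real (m + l) + \<mu> + 1/2 > 0"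
    using \<mu> by (auto intro!: pochhammer_pos)
  have split: "pochhammer (\<mu> + 3/2) (m + l) = pochhammer (\<mu> + 3/2) m * pochhammer (\<mu> + 3/2 + m) l"
    by (rule pochhammer_product')
  have "pochhammer (1 :: real) (m + l) = pochhammer 1 m * pochhammer (1 + real m) l"
    by (rule pochhammer_product')
  hence fact_split: "(fact (m + l) :: real) = fact m * pochhammer (real m + 1) l"
    by (simp add: pochhammer_fact add.commute)
  have "disk_multiplier \<mu> l k * (poly (jacobi_orthonormal (\<mu> - 1/2) (real m) l) 1)\<^sup>2 = fact m / pochhammer (\<mu> + 3/2) m"
    unfolding disk_multiplier_def k(2) split fact_split p1 using pos by (simp add: divide_simps)
  also have "\<dots> = (\<mu> + 1/2) * Beta (\<mu> + 1/2) (real m + 1)"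
  proof -
    have "Gamma (\<mu> + 1/2 + 1) = (\<mu> + 1/2) * Gamma (\<mu> + 1/2)"
      using \<mu> by (intro Gamma_plus1) (auto simp: nonpos_Ints_def)
    hence "(\<mu> + 1/2) * Gamma (\<mu> + 1/2) = Gamma (\<mu> + 3/2)" by (simp add: add.assoc)
    moreover have "pochhammer (\<mu> + 3/2) m = Gamma (\<mu> + 1/2 + (real m + 1)) / Gamma (\<mu> + 3/2)"
      using \<mu> by (subst pochhammer_Gamma) (auto simp: nonpos_Ints_def add_ac)
    moreover have "Gamma (real m + 1) = fact m" by (simp add: Gamma_fact add.commute)
    ultimately show ?thesis by (simp add: Beta_def)
  qed
  finally have "disk_multiplier \<mu> l k * (basis_norm_const \<mu> l k * poly (jacobi_orthonormal (\<mu> - 1/2) (real m) l) 1)\<^sup>2 *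
      trig_norm m = (basis_norm_const \<mu> l k)\<^sup>2 * radial_norm \<mu> m"
    unfolding radial_norm_def[OF \<mu>] power_mult_distrib by (simp add: mult_ac)
  also have "\<dots> = 1" unfolding m_def by (rule basis_norm_const_square[OF \<mu> assms])
  finally show ?thesis unfolding m_def .
qed

text \<open>Both functions have the same \<open>k\<close>. Their frequencies then have equal parity,
  which makes n + 1 nodes on a half circle exact.\<close>

lemma disk_basis_quadrature:
  assumes I: "(l, \<epsilon>) \<in> basis_indices k" "(l', \<epsilon>') \<in> basis_indices k" and "k \<le> n" and N: "N \<in> {n + 1, 2 * n + 2}"
  shows "disk_multiplier \<mu> l k * (\<Sum>\<nu><N. disk_basis \<mu> k l \<epsilon> (cos (view_angle n \<nu>)) (sin (view_angle n \<nu>)) *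
      disk_basis \<mu> k l' \<epsilon>' (cos (view_angle n \<nu>)) (sin (view_angle n \<nu>))) =
    (if l = l' \<and> \<epsilon> = \<epsilon>' then real N else 0)"
proof -
  note D = basis_indicesD[OF I(1)] basis_indicesD[OF I(2)]
  let ?m = "k - 2 * l" and ?m' = "k - 2 * l'"
  define c where "c = (\<lambda>l. basis_norm_const \<mu> l k * poly (jacobi_orthonormal (\<mu> - 1/2) (real (k - 2 * l)) l) 1)"
  have "(\<Sum>\<nu><N. trig_factor ?m \<epsilon> (view_angle n \<nu>) * trig_factor ?m' \<epsilon>' (view_angle n \<nu>)) =
    (if ?m = ?m' \<and> \<epsilon> = \<epsilon>' then real N * trig_norm ?m else 0)"
  proof (rule trig_quadrature[OF D(2) D(5)])
    show "N > 0" using N by auto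
    fix j assume "j \<in> {int ?m - int ?m', int ?m + int ?m'}"
    \<comment> \<open>The frequencies k - 2 l and k - 2 l' differ and add up to even numbers of
      modulus at most 2 n. With n + 1 nodes p = j/2 is at most n in modulus; with 2 n + 2 nodes p =
      j is at most 2 n.\<close>
    hence j: "even j" "\<bar>j\<bar> \<le> 2 * int n" using D \<open>k \<le> n\<close> by (auto simp: even_diff_iff of_nat_diff)
    show "\<exists>p. \<bar>p\<bar> < int N \<and> (p = 0 \<longleftrightarrow> j = 0) \<and> (\<forall>\<nu>. real_of_int j * view_angle n \<nu> = 2 * pi * real_of_int p * real \<nu> / N)"
    proof (cases "N = n + 1")
      case True
      from j obtain p where p: "j = 2 * p" by (auto elim: evenE)
      thus ?thesis using j True by (intro exI[of _ p]) (auto simp: view_angle_def mult_ac add.commute)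
    next
      case False
      hence "N = 2 * n + 2" using N by auto
      hence "2 * (real n + 1) = real N" by simp
      thus ?thesis using j \<open>N = 2 * n + 2\<close>
        by (intro exI[of _ j]) (auto simp: view_angle_def divide_simps mult_ac simp flip: distrib_left)
    qed
  qed
  moreover have "(\<Sum>\<nu><N. disk_basis \<mu> k l \<epsilon> (cos (view_angle n \<nu>)) (sin (view_angle n \<nu>)) *
      disk_basis \<mu> k l' \<epsilon>' (cos (view_angle n \<nu>)) (sin (view_angle n \<nu>))) =
    c l * c l' * (\<Sum>\<nu><N. trig_factor ?m \<epsilon> (view_angle n \<nu>) * trig_factor ?m' \<epsilon>' (view_angle n \<nu>))"
    unfolding sum_distrib_left by (intro sum.cong refl) (simp add: disk_basis_unit c_def)
  ultimately have "(\<Sum>\<nu><N. disk_basis \<mu> k l \<epsilon> (cos (view_angle n \<nu>)) (sin (view_angle n \<nu>)) *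
      disk_basis \<mu> k l' \<epsilon>' (cos (view_angle n \<nu>)) (sin (view_angle n \<nu>))) =
    c l * c l' * (if ?m = ?m' \<and> \<epsilon> = \<epsilon>' then real N * trig_norm ?m else 0)"
    by simp
  moreover have "?m = ?m' \<longleftrightarrow> l = l'" using D by auto
  moreover have "disk_multiplier \<mu> l k * (c l)\<^sup>2 * trig_norm ?m = 1"
    unfolding c_def by (rule disk_multiplier_eq[OF D(1)])
  ultimately show ?thesis by (auto simp: power2_eq_square mult_ac)
qed

text \<open>Averaging over the directions turns the addition formula into the reproducing kernel.\<close>

lemma kernel_Phi_average:
  assumes N: "N \<in> {n + 1, 2 * n + 2}"
  shows "(\<Sum>\<nu><N. kernel_Phi \<mu> n (view_angle n \<nu>) (a * cos (view_angle n \<nu>) + b * sin (view_angle n \<nu>)) x y) =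
    real N * (\<Sum>k\<le>n. \<Sum>(l, \<epsilon>)\<in>basis_indices k. disk_basis \<mu> k l \<epsilon> a b * disk_basis \<mu> k l \<epsilon> x y)"
proof -
  define B where "B = (\<lambda>k p. disk_basis \<mu> k (fst p) (snd p))"
  define Z where "Z = (\<lambda>k p \<nu>. B k p (cos (view_angle n \<nu>)) (sin (view_angle n \<nu>)))"
  define M where "M = (\<lambda>k p :: nat \<times> nat. disk_multiplier \<mu> (fst p) k)"
  have angle: "0 \<le> view_angle n \<nu>" "view_angle n \<nu> \<le> 2 * pi" if "\<nu> < N" for \<nu>
  proof -
    have "real \<nu> \<le> 2 * (real n + 1)" using that N by auto
    hence "real \<nu> * pi \<le> 2 * (real n + 1) * pi" by (intro mult_right_mono) auto
    thus "0 \<le> view_angle n \<nu>" "view_angle n \<nu> \<le> 2 * pi"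
      by (auto simp: view_angle_def divide_simps mult_ac)
  qed
  \<comment> \<open>The addition formula contributes one factor at the direction and
    \<open>kernel_D\<close> the other, both of the same degree; summing over the nodes pairs
    them.\<close>
  have "(\<Sum>\<nu><N. kernel_Phi \<mu> n (view_angle n \<nu>) (a * cos (view_angle n \<nu>) + b * sin (view_angle n \<nu>)) x y) =
     (\<Sum>\<nu><N. \<Sum>k\<le>n. \<Sum>p'\<in>basis_indices k. \<Sum>p\<in>basis_indices k. (B k p' a b * Z k p' \<nu>) * (M k p * Z k p \<nu> * B k p x y))"
  proof (intro sum.cong refl)
    fix \<nu> assume "\<nu> \<in> {..<N}"
    hence \<nu>: "\<nu> < N" by simp
    show "kernel_Phi \<mu> n (view_angle n \<nu>) (a * cos (view_angle n \<nu>) + b * sin (view_angle n \<nu>)) x y =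
      (\<Sum>k\<le>n. \<Sum>p'\<in>basis_indices k. \<Sum>p\<in>basis_indices k. (B k p' a b * Z k p' \<nu>) * (M k p * Z k p \<nu> * B k p x y))"
      unfolding kernel_Phi_def kernel_D_def gegenbauer_addition[OF \<mu> angle[OF \<nu>]] sum_product[symmetric] atLeast0AtMost
      by (simp add: B_def Z_def M_def case_prod_unfold)
  qed
  also have "\<dots> = (\<Sum>k\<le>n. \<Sum>p'\<in>basis_indices k. \<Sum>p\<in>basis_indices k. \<Sum>\<nu><N. (B k p' a b * Z k p' \<nu>) * (M k p * Z k p \<nu> * B k p x y))"
    by (subst sum.swap, intro sum.cong refl, subst sum.swap, intro sum.cong refl, rule sum.swap)
  also have "\<dots> = (\<Sum>k\<le>n. \<Sum>p'\<in>basis_indices k. \<Sum>p\<in>basis_indices k. if p = p' then B k p' a b * B k p x y * real N else 0)"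
  proof (intro sum.cong refl)
    fix k p' p assume k: "k \<in> {..n}" and p: "p' \<in> basis_indices k" "p \<in> basis_indices k"
    have "(\<Sum>\<nu><N. (B k p' a b * Z k p' \<nu>) * (M k p * Z k p \<nu> * B k p x y)) =
        B k p' a b * B k p x y * (M k p * (\<Sum>\<nu><N. Z k p \<nu> * Z k p' \<nu>))"
      by (simp add: sum_distrib_left mult_ac)
    also have "M k p * (\<Sum>\<nu><N. Z k p \<nu> * Z k p' \<nu>) = (if p = p' then real N else 0)"
      unfolding M_def Z_def B_def
      using disk_basis_quadrature[of "fst p" "snd p" k "fst p'" "snd p'" n N] k p N by (auto simp: prod_eq_iff)
    finally show "(\<Sum>\<nu><N. (B k p' a b * Z k p' \<nu>) * (M k p * Z k p \<nu> * B k p x y)) =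
        (if p = p' then B k p' a b * B k p x y * real N else 0)" by simp
  qed
  also have "\<dots> = (\<Sum>k\<le>n. \<Sum>p'\<in>basis_indices k. B k p' a b * B k p' x y * real N)"
    by (intro sum.cong refl) (simp add: sum.delta)
  finally show ?thesis
    by (simp add: B_def case_prod_unfold sum_distrib_left mult_ac)
qed

end

section \<open>Homogeneous polynomials in three variables and their restriction to the
  sphere\<close>

lemma finite_poly3_indices: "finite {(i, j, m). i + j + m = (k :: nat)}" "finite {(i, j, m). i + j + m < (k :: nat)}"
  by (rule finite_subset[of _ "{..k} \<times> {..k} \<times> {..k}"], auto)+

lemma sphere_coords: "u \<in> sphere 0 1 \<Longrightarrow> (u $ 1)\<^sup>2 + (u $ 2)\<^sup>2 + (u $ 3)\<^sup>2 = 1" for u :: "real ^ 3"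
  by (simp add: norm_vec_def L2_set_def sum_3)

lemma continuous_on_poly3: "p \<in> poly3 A \<Longrightarrow> continuous_on UNIV p"
  by (auto simp: poly3_def case_prod_unfold intro!: continuous_intros)

lemma poly3_mono:
  assumes "p \<in> poly3 A" "A \<subseteq> B" "finite B"
  shows "p \<in> poly3 B"
proof -
  from assms(1) obtain c where p: "p = (\<lambda>x. \<Sum>(i, j, m)\<in>A. c i j m * x $ 1 ^ i * x $ 2 ^ j * x $ 3 ^ m)"
    by (auto simp: poly3_def)
  have "p = (\<lambda>x. \<Sum>(i, j, m)\<in>B. (if (i, j, m) \<in> A then c i j m else 0) * x $ 1 ^ i * x $ 2 ^ j * x $ 3 ^ m)"
    unfolding p using assms(2,3) by (intro ext sum.mono_neutral_cong_left) auto
  thus ?thesis unfolding poly3_def by (intro CollectI exI[of _ "\<lambda>i j m. if (i, j, m) \<in> A then c i j m else 0"])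
qed

text \<open>On the sphere \<open>x\<^sub>3\<^sup>2\<close> is a polynomial in the other two variables.\<close>

lemma poly3_split:
  assumes "p \<in> poly3 A" "\<And>i j m. (i, j, m) \<in> A \<Longrightarrow> i + j + m \<le> d"
  shows "\<exists>g h. bipoly d g \<and> bipoly d h \<and> (\<forall>u\<in>sphere 0 1. p u = planar g u + planar h u * u $ 3)"
proof -
  from assms(1) obtain c where p: "p = (\<lambda>x. \<Sum>(i, j, m)\<in>A. c i j m * x $ 1 ^ i * x $ 2 ^ j * x $ 3 ^ m)"
    by (auto simp: poly3_def)
  define b where "b = (\<lambda>i j m x y :: real. x ^ i * y ^ j * (1 - (x\<^sup>2 + y\<^sup>2)) ^ (m div 2))"
  have b: "bipoly d (b i j m)" if "(i, j, m) \<in> A" for i j m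
  proof -
    have sq: "bipoly 2 (\<lambda>x y :: real. 1 - (x\<^sup>2 + y\<^sup>2))"
      using bipoly_power[OF bipoly_x, of 2] bipoly_power[OF bipoly_y, of 2]
      by (intro bipoly_diff bipoly_add bipoly_const) auto
    have "bipoly (i * Suc 0 + j * Suc 0 + m div 2 * 2) (b i j m)"
      unfolding b_def by (intro bipoly_mult bipoly_power bipoly_x bipoly_y sq)
    moreover have "i * Suc 0 + j * Suc 0 + m div 2 * 2 \<le> d" using assms(2)[OF that] by simp
    ultimately show ?thesis by (rule bipoly_mono)
  qed
  define g where "g = (\<lambda>x y. \<Sum>a\<in>A. case a of (i, j, m) \<Rightarrow> (if even m then c i j m else 0) * b i j m x y)"
  define h where "h = (\<lambda>x y. \<Sum>a\<in>A. case a of (i, j, m) \<Rightarrow> (if odd m then c i j m else 0) * b i j m x y)"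
  have "bipoly d g" "bipoly d h"
    unfolding g_def h_def by (rule bipoly_sum; clarsimp; intro conjI impI bipoly_cmult b bipoly_const; simp)+
  moreover have "p u = planar g u + planar h u * u $ 3" if u: "u \<in> sphere 0 1" for u
  proof -
    have z: "1 - ((u $ 1)\<^sup>2 + (u $ 2)\<^sup>2) = (u $ 3)\<^sup>2" using sphere_coords[OF u] by simp
    have "p u = (\<Sum>a\<in>A. (case a of (i, j, m) \<Rightarrow> (if even m then c i j m else 0) * b i j m (u $ 1) (u $ 2)) +
        (case a of (i, j, m) \<Rightarrow> (if odd m then c i j m else 0) * b i j m (u $ 1) (u $ 2)) * u $ 3)"
      unfolding p
    proof (intro sum.cong refl)
      fix a assume "a \<in> A"
      obtain i j m where a: "a = (i, j, m)" by (metis prod_cases3)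
      have "u $ 3 ^ m = ((u $ 3)\<^sup>2) ^ (m div 2) * (if even m then 1 else u $ 3)"
        by (auto elim!: evenE oddE simp: power_mult)
      thus "(case a of (i, j, m) \<Rightarrow> c i j m * u $ 1 ^ i * u $ 2 ^ j * u $ 3 ^ m) =
        (case a of (i, j, m) \<Rightarrow> (if even m then c i j m else 0) * b i j m (u $ 1) (u $ 2)) +
        (case a of (i, j, m) \<Rightarrow> (if odd m then c i j m else 0) * b i j m (u $ 1) (u $ 2)) * u $ 3"
        by (simp add: a b_def z mult_ac)
    qed
    thus ?thesis by (simp add: g_def h_def sum.distrib sum_distrib_right)
  qed
  ultimately show ?thesis by blast
qed

lemma poly3_add:
  assumes "p \<in> poly3 A" "q \<in> poly3 A"
  shows "(\<lambda>u. p u + q u) \<in> poly3 A"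
proof -
  from assms obtain c c' where p: "p = (\<lambda>x. \<Sum>(i, j, m)\<in>A. c i j m * x $ 1 ^ i * x $ 2 ^ j * x $ 3 ^ m)"
    and q: "q = (\<lambda>x. \<Sum>(i, j, m)\<in>A. c' i j m * x $ 1 ^ i * x $ 2 ^ j * x $ 3 ^ m)"
    unfolding poly3_def by blast
  have "(\<lambda>u. p u + q u) = (\<lambda>x. \<Sum>(i, j, m)\<in>A. (c i j m + c' i j m) * x $ 1 ^ i * x $ 2 ^ j * x $ 3 ^ m)"
    by (intro ext) (simp add: p q sum.distrib[symmetric] case_prod_unfold distrib_right)
  thus ?thesis unfolding poly3_def by (intro CollectI exI[of _ "\<lambda>i j m. c i j m + c' i j m"])
qed

lemma poly3_cmult:
  assumes "p \<in> poly3 A"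
  shows "(\<lambda>u. k * p u) \<in> poly3 A"
proof -
  from assms obtain c where p: "p = (\<lambda>x. \<Sum>(i, j, m)\<in>A. c i j m * x $ 1 ^ i * x $ 2 ^ j * x $ 3 ^ m)"
    unfolding poly3_def by blast
  have "(\<lambda>u. k * p u) = (\<lambda>x. \<Sum>(i, j, m)\<in>A. (k * c i j m) * x $ 1 ^ i * x $ 2 ^ j * x $ 3 ^ m)"
    by (intro ext) (simp add: p sum_distrib_left case_prod_unfold mult_ac)
  thus ?thesis unfolding poly3_def by (intro CollectI exI[of _ "\<lambda>i j m. k * c i j m"])
qed

lemma poly3_sum: "(\<And>a. a \<in> S \<Longrightarrow> F a \<in> poly3 A) \<Longrightarrow> (\<lambda>u. \<Sum>a\<in>S. F a u) \<in> poly3 A"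
proof (induction S rule: infinite_finite_induct)
  case empty
  show ?case unfolding poly3_def by (simp, intro exI[of _ "\<lambda>_ _ _. 0"]) simp
next
  case (infinite S)
  thus ?case unfolding poly3_def by (simp, intro exI[of _ "\<lambda>_ _ _. 0"]) simp
qed (auto intro!: poly3_add)

lemma hom_monomial:
  assumes "i + j + m = k"
  shows "(\<lambda>u. u $ 1 ^ i * u $ 2 ^ j * u $ 3 ^ m) \<in> homogeneous_poly3 k"
proof -
  have "(\<lambda>u :: real ^ 3. u $ 1 ^ i * u $ 2 ^ j * u $ 3 ^ m) \<in> poly3 {(i, j, m)}"
    unfolding poly3_def by (intro CollectI exI[of _ "\<lambda>_ _ _. 1"]) simp
  thus ?thesis unfolding homogeneous_poly3_def
    by (rule poly3_mono) (use assms finite_poly3_indices in auto)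
qed

lemma hom_mult:
  assumes "p \<in> homogeneous_poly3 k" "q \<in> homogeneous_poly3 k'"
  shows "(\<lambda>u. p u * q u) \<in> homogeneous_poly3 (k + k')"
proof -
  let ?A = "{(i, j, m). i + j + m = k}" and ?A' = "{(i, j, m). i + j + m = k'}"
  from assms obtain c c' where p: "p = (\<lambda>x. \<Sum>(i, j, m)\<in>?A. c i j m * x $ 1 ^ i * x $ 2 ^ j * x $ 3 ^ m)"
    and q: "q = (\<lambda>x. \<Sum>(i, j, m)\<in>?A'. c' i j m * x $ 1 ^ i * x $ 2 ^ j * x $ 3 ^ m)"
    unfolding homogeneous_poly3_def poly3_def by blast
  have "(\<lambda>u. \<Sum>a\<in>?A. \<Sum>b\<in>?A'. case (a, b) of ((i, j, m), (i', j', m')) \<Rightarrow>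
      (c i j m * c' i' j' m') * (u $ 1 ^ (i + i') * u $ 2 ^ (j + j') * u $ 3 ^ (m + m'))) \<in> homogeneous_poly3 (k + k')"
    unfolding homogeneous_poly3_def
  proof (intro poly3_sum)
    fix a b assume ab: "a \<in> ?A" "b \<in> ?A'"
    obtain i j m i' j' m' where [simp]: "a = (i, j, m)" "b = (i', j', m')" by (metis prod_cases3)
    have "(i + i') + (j + j') + (m + m') = k + k'" using ab by simp
    from poly3_cmult[OF hom_monomial[OF this, unfolded homogeneous_poly3_def], of "c i j m * c' i' j' m'"]
    show "(\<lambda>u. case (a, b) of ((i, j, m), (i', j', m')) \<Rightarrow>
      (c i j m * c' i' j' m') * (u $ 1 ^ (i + i') * u $ 2 ^ (j + j') * u $ 3 ^ (m + m'))) \<in> poly3 {(i, j, m). i + j + m = k + k'}"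
      by simp
  qed
  moreover have "(\<lambda>u. p u * q u) = (\<lambda>u. \<Sum>a\<in>?A. \<Sum>b\<in>?A'. case (a, b) of ((i, j, m), (i', j', m')) \<Rightarrow>
      (c i j m * c' i' j' m') * (u $ 1 ^ (i + i') * u $ 2 ^ (j + j') * u $ 3 ^ (m + m')))"
    unfolding p q sum_product by (intro ext sum.cong refl) (auto simp: power_add mult_ac)
  ultimately show ?thesis by simp
qed

lemma hom_power: "p \<in> homogeneous_poly3 k \<Longrightarrow> (\<lambda>u. p u ^ n) \<in> homogeneous_poly3 (n * k)"
proof (induction n)
  case 0
  show ?case using hom_monomial[of 0 0 0 0] by simp
qed (auto intro: hom_mult)

lemma hom_coords: "(\<lambda>u. u $ 1) \<in> homogeneous_poly3 1" "(\<lambda>u. u $ 2) \<in> homogeneous_poly3 1" "(\<lambda>u. u $ 3) \<in> homogeneous_poly3 1"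
  using hom_monomial[of 1 0 0] hom_monomial[of 0 1 0] hom_monomial[of 0 0 1] by simp_all

lemma hom_harm:
  "planar (harm m 0) \<in> homogeneous_poly3 m" "(planar (harm m (Suc 0))) \<in> homogeneous_poly3 m"
proof (induction m)
  case 0
  { case 1 show ?case using hom_monomial[of 0 0 0 0] by (simp add: harm_0) }
  { case 2 show ?case using poly3_cmult[OF hom_monomial[of 0 0 0 0, unfolded homogeneous_poly3_def], of 0] by (simp add: harm_0 homogeneous_poly3_def) }
next
  case (Suc m)
  have x: "(\<lambda>u. u $ 1 * p u) \<in> poly3 {(i, j, m'). i + j + m' = Suc m}"
    and y: "(\<lambda>u. e * (u $ 2 * p u)) \<in> poly3 {(i, j, m'). i + j + m' = Suc m}"
    if "p \<in> homogeneous_poly3 m" for p e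
    using hom_mult[OF hom_coords(1) that] poly3_cmult[OF hom_mult[OF hom_coords(2) that, unfolded homogeneous_poly3_def]]
    by (simp_all add: homogeneous_poly3_def)
  { case 1 show ?case using poly3_add[OF x[OF Suc.IH(1)] y[OF Suc.IH(2), of "-1"]]
      by (simp add: harm_Suc homogeneous_poly3_def) }
  { case 2 show ?case using poly3_add[OF x[OF Suc.IH(2)] y[OF Suc.IH(1), of 1]]
      by (simp add: harm_Suc homogeneous_poly3_def) }
qed

text \<open>On the sphere 2 (x1^2 + x2^2) - 1 equals x1^2 + x2^2 - x3^2, which is homogeneous of
  degree 2. Missing degrees are filled by powers of x1^2 + x2^2 + x3^2 = 1.\<close>

lemma disk_basis_homogeneous:
  assumes \<mu>: "\<mu> \<ge> 0" and I: "(l, \<epsilon>) \<in> basis_indices k"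
  shows "\<exists>H\<in>homogeneous_poly3 k. \<forall>u\<in>sphere 0 1. H u = planar (disk_basis \<mu> k l \<epsilon>) u"
proof -
  note D = basis_indicesD[OF I]
  define m where "m = k - 2 * l"
  define p where "p = jacobi_orthonormal (\<mu> - 1/2) (real m) l"
  have p: "degree p = l" unfolding p_def using \<mu> by (intro degree_jacobi_orthonormal) auto
  define H where "H = (\<lambda>u :: real ^ 3. basis_norm_const \<mu> l k * ((\<Sum>i\<le>l. coeff p i *
    (((u $ 1)\<^sup>2 + (u $ 2)\<^sup>2 + (-1) * (u $ 3)\<^sup>2) ^ i * ((u $ 1)\<^sup>2 + (u $ 2)\<^sup>2 + (u $ 3)\<^sup>2) ^ (l - i))) * planar (harm m \<epsilon>) u))"
  have sq: "(\<lambda>u. (u $ i)\<^sup>2) \<in> poly3 {(i, j, m). i + j + m = 2}" if "i \<in> {1, 2, 3}" for i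
    using that hom_power[OF hom_coords(1), of 2] hom_power[OF hom_coords(2), of 2] hom_power[OF hom_coords(3), of 2]
    by (auto simp: homogeneous_poly3_def)
  have q1: "(\<lambda>u. (u $ 1)\<^sup>2 + (u $ 2)\<^sup>2 + (-1) * (u $ 3)\<^sup>2) \<in> homogeneous_poly3 2"
    and q2: "(\<lambda>u. (u $ 1)\<^sup>2 + (u $ 2)\<^sup>2 + (u $ 3)\<^sup>2) \<in> homogeneous_poly3 2"
    unfolding homogeneous_poly3_def by (intro poly3_add poly3_cmult sq; simp)+
  have inner: "(\<lambda>u. ((u $ 1)\<^sup>2 + (u $ 2)\<^sup>2 + (-1) * (u $ 3)\<^sup>2) ^ i * ((u $ 1)\<^sup>2 + (u $ 2)\<^sup>2 + (u $ 3)\<^sup>2) ^ (l - i)) \<in> homogeneous_poly3 (2 * l)"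
    if "i \<le> l" for i
  proof -
    have "i * 2 + (l - i) * 2 = 2 * l" using that by simp
    thus ?thesis using hom_mult[OF hom_power[OF q1, of i] hom_power[OF q2, of "l - i"]] by simp
  qed
  have "(\<lambda>u. \<Sum>i\<le>l. coeff p i *
    (((u $ 1)\<^sup>2 + (u $ 2)\<^sup>2 + (-1) * (u $ 3)\<^sup>2) ^ i * ((u $ 1)\<^sup>2 + (u $ 2)\<^sup>2 + (u $ 3)\<^sup>2) ^ (l - i))) \<in> homogeneous_poly3 (2 * l)"
    unfolding homogeneous_poly3_def
    by (intro poly3_sum poly3_cmult) (use inner in \<open>simp add: homogeneous_poly3_def\<close>)
  moreover have "planar (harm m \<epsilon>) \<in> homogeneous_poly3 m"
    using D(3) hom_harm[of m] by (auto simp: le_Suc_eq)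
  ultimately have "(\<lambda>u. (\<Sum>i\<le>l. coeff p i *
    (((u $ 1)\<^sup>2 + (u $ 2)\<^sup>2 + (-1) * (u $ 3)\<^sup>2) ^ i * ((u $ 1)\<^sup>2 + (u $ 2)\<^sup>2 + (u $ 3)\<^sup>2) ^ (l - i))) * planar (harm m \<epsilon>) u)
      \<in> homogeneous_poly3 (2 * l + m)"
    by (rule hom_mult)
  hence "H \<in> homogeneous_poly3 (2 * l + m)"
    unfolding H_def homogeneous_poly3_def by (rule poly3_cmult)
  moreover have "2 * l + m = k" using D(1) by (simp add: m_def)
  moreover have "H u = planar (disk_basis \<mu> k l \<epsilon>) u" if u: "u \<in> sphere 0 1" for u
  proof -
    note s = sphere_coords[OF u]
    have t: "(u $ 1)\<^sup>2 + (u $ 2)\<^sup>2 + (-1) * (u $ 3)\<^sup>2 = 2 * ((u $ 1)\<^sup>2 + (u $ 2)\<^sup>2) - 1" using s by simp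
    have "H u = basis_norm_const \<mu> l k * ((\<Sum>i\<le>l. coeff p i * (2 * ((u $ 1)\<^sup>2 + (u $ 2)\<^sup>2) - 1) ^ i) * planar (harm m \<epsilon>) u)"
      unfolding H_def by (simp only: s t power_one mult_1_right)
    also have "(\<Sum>i\<le>l. coeff p i * (2 * ((u $ 1)\<^sup>2 + (u $ 2)\<^sup>2) - 1) ^ i) = poly p (2 * ((u $ 1)\<^sup>2 + (u $ 2)\<^sup>2) - 1)"
      by (simp add: poly_altdef p)
    finally show ?thesis by (simp add: disk_basis_eq radial_def p_def m_def)
  qed
  ultimately show ?thesis by metis
qed

section \<open>The projections\<close>

lemma AE_bipoly_even: "AE u in sphere_measure. planar g (reflect3 u) = planar g u"
  by (simp add: reflect3_def)

lemma borel_measurable_surface_measure: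
  "F \<in> borel_measurable borel \<Longrightarrow> F \<in> borel_measurable surface_measure" for F :: "real ^ 3 \<Rightarrow> real"
  unfolding surface_measure_def by (intro measurable_completion) (simp add: measurable_restrict_space1)

lemma borel_measurable_poly3: "p \<in> poly3 A \<Longrightarrow> p \<in> borel_measurable borel"
  by (intro borel_measurable_continuous_onI continuous_on_poly3)

context
  fixes \<mu> :: real
  assumes \<mu>: "\<mu> \<ge> 0"
begin

section \<open>Even and odd functions in the third coordinate\<close>

lemma integral_sphere_prob_cong:
  fixes F G :: "real ^ 3 \<Rightarrow> real"
  assumes "F \<in> borel_measurable borel" "G \<in> borel_measurable borel" "\<And>u. u \<in> sphere 0 1 \<Longrightarrow> F u = G u"
  shows "(LINT u|sphere_prob \<mu>. F u) = (LINT u|sphere_prob \<mu>. G u)"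
proof (rule integral_cong_AE)
  show "AE u in sphere_prob \<mu>. F u = G u"
    using AE_sphere_probI[OF \<mu> AE_in_sphere] by eventually_elim (rule assms(3))
qed (use assms in simp_all)

lemma integral_sphere_prob_odd:
  fixes F :: "real ^ 3 \<Rightarrow> real"
  assumes F [measurable]: "F \<in> borel_measurable borel" and odd: "AE u in sphere_measure. F (reflect3 u) = - F u"
  shows "(LINT u|sphere_prob \<mu>. F u) = 0"
proof -
  define G where "G = (\<lambda>u. F u * sphere_weight \<mu> u)"
  have [measurable]: "G \<in> borel_measurable borel" unfolding G_def by measurable
  have "(LINT u|sphere_measure. G u) = (LINT u|distr sphere_measure borel reflect3. G u)"
    by (simp add: sphere_measure_reflect)
  also have "\<dots> = (LINT u|sphere_measure. G (reflect3 u))" by (rule integral_distr) measurable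
  also have "\<dots> = (LINT u|sphere_measure. - G u)"
  proof (rule integral_cong_AE)
    show "AE u in sphere_measure. G (reflect3 u) = - G u"
      using odd by eventually_elim (simp add: G_def sphere_weight_eq reflect3_def)
  qed measurable
  finally have "(LINT u|sphere_measure. G u) = 0" by simp
  thus ?thesis unfolding integral_sphere_prob[OF \<mu> F] G_def by simp
qed

lemma integral_even_times_odd:
  fixes f :: "real ^ 3 \<Rightarrow> real"
  assumes f [measurable]: "f \<in> borel_measurable borel" and even: "AE u in sphere_measure. f (reflect3 u) = f u"
    and h: "bipoly d h"
  shows "(LINT u|sphere_prob \<mu>. f u * (planar h u * u $ 3)) = 0"
proof (rule integral_sphere_prob_odd)
  have [measurable]: "planar h \<in> borel_measurable borel"
    by (intro borel_measurable_continuous_onI continuous_on_bipoly[OF h])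
  show "(\<lambda>u. f u * (planar h u * u $ 3)) \<in> borel_measurable borel" by measurable
  show "AE u in sphere_measure. f (reflect3 u) * (planar h (reflect3 u) * reflect3 u $ 3) =
      - (f u * (planar h u * u $ 3))"
    using even by eventually_elim (simp add: reflect3_def)
qed

text \<open>The part with the factor x3 is odd and integrates to 0 against an even function; this
  reduces pairings on the sphere to the disk.\<close>

lemma integral_even_times_split:
  fixes f p :: "real ^ 3 \<Rightarrow> real"
  assumes f: "integrable (sphere_prob \<mu>) f" and even: "AE u in sphere_measure. f (reflect3 u) = f u"
    and g: "bipoly d g" and h: "bipoly e h" and p: "p \<in> borel_measurable borel"
    and split: "\<And>u. u \<in> sphere 0 1 \<Longrightarrow> p u = planar g u + planar h u * u $ 3"
  shows "(LINT u|sphere_prob \<mu>. f u * p u) = (LINT u|sphere_prob \<mu>. f u * planar g u)"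
proof -
  have fm [measurable]: "f \<in> borel_measurable borel"
    using borel_measurable_integrable[OF f] by simp
  note [measurable] = p
  have gm [measurable]: "planar g \<in> borel_measurable borel"
    and hm [measurable]: "planar h \<in> borel_measurable borel"
    by (intro borel_measurable_continuous_onI continuous_on_bipoly[OF g] continuous_on_bipoly[OF h])+
  have int: "integrable (sphere_prob \<mu>) (\<lambda>u. f u * planar g u)"
    "integrable (sphere_prob \<mu>) (\<lambda>u. f u * (planar h u * u $ 3))"
    by (intro integrable_sphere_prob_mult_continuous[OF \<mu> f] continuous_on_bipoly[OF g] continuous_on_bipoly[OF h] continuous_intros)+
  have "(LINT u|sphere_prob \<mu>. f u * p u) =
      (LINT u|sphere_prob \<mu>. f u * planar g u + f u * (planar h u * u $ 3))"
    by (rule integral_sphere_prob_cong) (measurable, auto simp: split distrib_left simp del: mem_sphere)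
  also have "\<dots> = (LINT u|sphere_prob \<mu>. f u * planar g u)"
    using int integral_even_times_odd[OF fm even h] by simp
  finally show ?thesis .
qed

lemma mean_sum:
  "(\<And>i. i \<in> S \<Longrightarrow> bipoly d (g i)) \<Longrightarrow> mean \<mu> (\<lambda>x y. \<Sum>i\<in>S. g i x y) = (\<Sum>i\<in>S. mean \<mu> (g i))"
  unfolding mean_def by (rule Bochner_Integration.integral_sum) (rule integrable_bipoly[OF \<mu>])

text \<open>Definiteness follows algebraically from completeness: the mean square is the sum of the
  squared Fourier coefficients, and these determine \<open>g\<close>.\<close>

lemma mean_square_eq_0:
  assumes g: "bipoly d g" and zero: "mean \<mu> (\<lambda>x y. g x y * g x y) = 0"
  shows "g x y = 0"
proof -
  define c where "c = (\<lambda>k p. mean \<mu> (\<lambda>x y. g x y * disk_basis \<mu> k (fst p) (snd p) x y))"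
  have B: "bipoly (d + d) (\<lambda>x y. c k p * (g x y * disk_basis \<mu> k (fst p) (snd p) x y))"
    if "k \<le> d" "p \<in> basis_indices k" for k p
    using bipoly_mono[OF bipoly_disk_basis[OF \<mu>, of "fst p" "snd p" k] that(1)] that(2)
    by (intro bipoly_cmult bipoly_mult[OF g]) simp
  have expand: "g x y = (\<Sum>k\<le>d. \<Sum>p\<in>basis_indices k. c k p * disk_basis \<mu> k (fst p) (snd p) x y)" for x y
    using fourier_sum_bipoly[OF \<mu> g, of x y] unfolding fourier_sum_def[OF \<mu>] c_def case_prod_unfold by simp
  have "mean \<mu> (\<lambda>x y. g x y * g x y) =
      mean \<mu> (\<lambda>x y. \<Sum>k\<le>d. \<Sum>p\<in>basis_indices k. c k p * (g x y * disk_basis \<mu> k (fst p) (snd p) x y))"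
    by (subst (2) expand) (simp add: sum_distrib_left mult_ac)
  also have "\<dots> = (\<Sum>k\<le>d. mean \<mu> (\<lambda>x y. \<Sum>p\<in>basis_indices k. c k p * (g x y * disk_basis \<mu> k (fst p) (snd p) x y)))"
    by (rule mean_sum) (auto intro!: bipoly_sum B)
  also have "\<dots> = (\<Sum>k\<le>d. \<Sum>p\<in>basis_indices k. mean \<mu> (\<lambda>x y. c k p * (g x y * disk_basis \<mu> k (fst p) (snd p) x y)))"
    by (intro sum.cong refl mean_sum) (auto intro!: B)
  also have "\<dots> = (\<Sum>k\<le>d. \<Sum>p\<in>basis_indices k. (c k p)\<^sup>2)"
    by (simp add: mean_cmult[OF \<mu>] c_def power2_eq_square)
  finally have "(\<Sum>k\<le>d. \<Sum>p\<in>basis_indices k. (c k p)\<^sup>2) = 0" using zero by simp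
  hence "\<forall>k\<in>{..d}. (\<Sum>p\<in>basis_indices k. (c k p)\<^sup>2) = 0"
    by (subst (asm) sum_nonneg_eq_0_iff) (auto intro!: sum_nonneg)
  hence "c k p = 0" if "k \<le> d" "p \<in> basis_indices k" for k p
    using that by (subst (asm) sum_nonneg_eq_0_iff) auto
  thus ?thesis unfolding expand by (intro sum.neutral ballI) auto
qed

end

text \<open>The factor \<open>u\<^sub>3\<^sup>2\<close> raises the parameter of the weight by one.\<close>

lemma integral_sphere_prob_square3:
  fixes h :: "real \<Rightarrow> real \<Rightarrow> real"
  assumes \<mu>: "\<mu> \<ge> 0" and h: "bipoly d h"
    and zero: "(LINT u|sphere_prob \<mu>. (planar h u * u $ 3)\<^sup>2) = 0"
  shows "h x y = 0"
proof -
  have hm [measurable]: "planar h \<in> borel_measurable borel"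
    by (intro borel_measurable_continuous_onI continuous_on_bipoly[OF h])
  have \<mu>1: "\<mu> + 1 \<ge> 0" using \<mu> by simp
  have w: "(u $ 3)\<^sup>2 * sphere_weight \<mu> u = sphere_weight (\<mu> + 1) u" for u
  proof (cases "u $ 3 = 0")
    case True
    thus ?thesis using \<mu> by (simp add: sphere_weight_def)
  next
    case False
    hence "\<bar>u $ 3\<bar> powr (2 * \<mu> + 2) = \<bar>u $ 3\<bar> powr (2 * \<mu>) * (u $ 3)\<^sup>2"
      by (subst powr_add) simp
    thus ?thesis using \<mu> False by (simp add: sphere_weight_def algebra_simps)
  qed
  have "0 = disk_const \<mu> / 2 * (LINT u|sphere_measure. (planar h u * u $ 3)\<^sup>2 * sphere_weight \<mu> u)"
    unfolding zero[symmetric] by (rule integral_sphere_prob[OF \<mu>]) measurable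
  hence "(LINT u|sphere_measure. (planar h u * u $ 3)\<^sup>2 * sphere_weight \<mu> u) = 0"
    using disk_const_pos[OF \<mu>] by simp
  also have "(\<lambda>u. (planar h u * u $ 3)\<^sup>2 * sphere_weight \<mu> u) =
      (\<lambda>u. (planar h u * planar h u) * sphere_weight (\<mu> + 1) u)"
    unfolding w[symmetric] by (intro ext) (simp add: power2_eq_square mult_ac)
  finally have z: "(LINT u|sphere_measure. (planar h u * planar h u) * sphere_weight (\<mu> + 1) u) = 0" .
  have "mean (\<mu> + 1) (\<lambda>x y. h x y * h x y) = 0"
    unfolding mean_def using z by (subst integral_sphere_prob[OF \<mu>1]) auto
  thus ?thesis by (rule mean_square_eq_0[OF \<mu>1 h])
qed

context
  fixes \<mu> :: real
  assumes \<mu>: "\<mu> \<ge> 0"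
begin

lemma sphere_inner_poly3:
  assumes "p \<in> poly3 A" "q \<in> poly3 B"
  shows "sphere_inner \<mu> p q = 2 / disk_const \<mu> * (LINT u|sphere_prob \<mu>. p u * q u)"
  using assms by (intro sphere_inner_eq[OF \<mu>] borel_measurable_poly3 borel_measurable_surface_measure) auto

lemma integrable_poly3: "p \<in> poly3 A \<Longrightarrow> integrable (sphere_prob \<mu>) p"
  by (rule integrable_sphere_prob_continuous[OF \<mu> continuous_on_poly3])

text \<open>Every basis function of lower degree is the restriction of a polynomial of that degree,
  so orthogonality of \<open>p\<close> applies to it. The odd part of \<open>p\<close> drops out of
  these pairings, and the Fourier expansion of \<open>g\<close> retains only degree
  \<open>k\<close>.\<close>

lemma sphere_harmonic_split:
  assumes p: "p \<in> homogeneous_poly3 k" and orth: "\<And>q. q \<in> poly3_degree_less k \<Longrightarrow> sphere_inner \<mu> p q = 0"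
  shows "\<exists>g h. bipoly k g \<and> bipoly k h \<and> (\<forall>u\<in>sphere 0 1. p u = planar g u + planar h u * u $ 3) \<and>
    (\<forall>x y. g x y = (\<Sum>(l, \<epsilon>)\<in>basis_indices k.
      (LINT u|sphere_prob \<mu>. planar g u * planar (disk_basis \<mu> k l \<epsilon>) u) * disk_basis \<mu> k l \<epsilon> x y))"
proof -
  from poly3_split[OF p[unfolded homogeneous_poly3_def], of k] obtain g h where
    gh: "bipoly k g" "bipoly k h" "\<And>u. u \<in> sphere 0 1 \<Longrightarrow> p u = planar g u + planar h u * u $ 3"
    by auto
  have pm: "p \<in> borel_measurable borel" using p unfolding homogeneous_poly3_def by (rule borel_measurable_poly3)
  have lower: "mean \<mu> (\<lambda>x y. g x y * disk_basis \<mu> k' l \<epsilon> x y) = 0"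
    if I: "(l, \<epsilon>) \<in> basis_indices k'" and "k' < k" for k' l \<epsilon>
  proof -
    obtain H where H: "H \<in> homogeneous_poly3 k'" "\<And>u. u \<in> sphere 0 1 \<Longrightarrow> H u = planar (disk_basis \<mu> k' l \<epsilon>) u"
      using disk_basis_homogeneous[OF \<mu> I] by blast
    note B = bipoly_disk_basis[OF \<mu> I]
    have Hm: "H \<in> borel_measurable borel" using H(1) unfolding homogeneous_poly3_def by (rule borel_measurable_poly3)
    have Bm [measurable]: "planar (disk_basis \<mu> k' l \<epsilon>) \<in> borel_measurable borel"
      by (intro borel_measurable_continuous_onI continuous_on_bipoly[OF B])
    note [measurable] = pm Hm
    have "H \<in> poly3_degree_less k"
      using H(1) \<open>k' < k\<close> unfolding homogeneous_poly3_def poly3_degree_less_def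
      by (rule_tac poly3_mono) (auto simp: finite_poly3_indices)
    hence "sphere_inner \<mu> p H = 0" by (rule orth)
    hence "0 = (LINT u|sphere_prob \<mu>. p u * H u)"
      using sphere_inner_poly3[OF p[unfolded homogeneous_poly3_def] H(1)[unfolded homogeneous_poly3_def]] disk_const_pos[OF \<mu>]
      by simp
    also have "\<dots> = (LINT u|sphere_prob \<mu>. planar (disk_basis \<mu> k' l \<epsilon>) u * p u)"
      by (rule integral_sphere_prob_cong[OF \<mu>]) (measurable, auto simp: H(2) simp del: mem_sphere)
    also have "\<dots> = (LINT u|sphere_prob \<mu>. planar (disk_basis \<mu> k' l \<epsilon>) u * planar g u)"
      by (rule integral_even_times_split[OF \<mu> integrable_bipoly[OF \<mu> B] AE_bipoly_even gh(1,2) pm gh(3)])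
    finally show ?thesis by (simp add: mean_def mult.commute)
  qed
  have "g x y = (\<Sum>(l, \<epsilon>)\<in>basis_indices k.
      (LINT u|sphere_prob \<mu>. planar g u * planar (disk_basis \<mu> k l \<epsilon>) u) * disk_basis \<mu> k l \<epsilon> x y)" for x y
  proof -
    have "g x y = fourier_sum \<mu> k g x y" by (rule fourier_sum_bipoly[OF \<mu> gh(1), symmetric])
    also have "\<dots> = (\<Sum>k'\<le>k. if k' = k then (\<Sum>(l, \<epsilon>)\<in>basis_indices k. mean \<mu> (\<lambda>x y. g x y * disk_basis \<mu> k l \<epsilon> x y) * disk_basis \<mu> k l \<epsilon> x y) else 0)"
      unfolding fourier_sum_def[OF \<mu>]
      by (intro sum.cong refl) (auto intro!: sum.neutral simp: lower)
    finally show ?thesis by (simp add: mean_def)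
  qed
  with gh show ?thesis by blast
qed

text \<open>Existence: the degree-k Fourier part of \<open>f'\<close> has a homogeneous version, and
  odd parts of harmonics are invisible to the even residual. Uniqueness: the coefficients fix the
  planar part of a competitor, and its odd part must have square integral 0.\<close>

lemma proj_harmonics_eq:
  fixes f f' :: "real ^ 3 \<Rightarrow> real"
  assumes f: "f \<in> borel_measurable surface_measure" and ff': "AE u in surface_measure. f u = f' u"
    and f': "integrable (sphere_prob \<mu>) f'" and even: "AE u in sphere_measure. f' (reflect3 u) = f' u"
  shows "proj_harmonics \<mu> k f = restrict (\<lambda>u. \<Sum>(l, \<epsilon>)\<in>basis_indices k.
     (LINT v|sphere_prob \<mu>. f' v * planar (disk_basis \<mu> k l \<epsilon>) v) * planar (disk_basis \<mu> k l \<epsilon>) u) (sphere 0 1)"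
proof -
  define c where "c = (\<lambda>p. LINT v|sphere_prob \<mu>. f' v * planar (disk_basis \<mu> k (fst p) (snd p)) v)"
  define B where "B = (\<lambda>p. disk_basis \<mu> k (fst p) (snd p))"
  define G where "G = (\<lambda>x y. \<Sum>p\<in>basis_indices k. c p * B p x y)"
  have fm: "f' \<in> borel_measurable borel" using borel_measurable_integrable[OF f'] by simp
  have B: "bipoly k (B p)" if "p \<in> basis_indices k" for p
    unfolding B_def using bipoly_disk_basis[OF \<mu>, of "fst p" "snd p" k] that by simp
  have G: "bipoly k G" unfolding G_def by (intro bipoly_sum bipoly_cmult B)
  have Gint: "integrable (sphere_prob \<mu>) (planar G)" by (rule integrable_bipoly[OF \<mu> G])
  have Gm: "planar G \<in> borel_measurable borel"
    by (intro borel_measurable_continuous_onI continuous_on_bipoly[OF G])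
  have "\<exists>H. \<forall>p\<in>basis_indices k. H p \<in> homogeneous_poly3 k \<and> (\<forall>u\<in>sphere 0 1. H p u = planar (B p) u)"
    unfolding B_def using disk_basis_homogeneous[OF \<mu>] by (intro bchoice) force
  then obtain H where H: "\<And>p. p \<in> basis_indices k \<Longrightarrow> H p \<in> homogeneous_poly3 k"
    "\<And>p u. p \<in> basis_indices k \<Longrightarrow> u \<in> sphere 0 1 \<Longrightarrow> H p u = planar (B p) u" by blast
  define P where "P = (\<lambda>u. \<Sum>p\<in>basis_indices k. c p * H p u)"
  have P: "P \<in> homogeneous_poly3 k"
    using H(1) unfolding P_def homogeneous_poly3_def by (intro poly3_sum poly3_cmult)
  hence P3: "P \<in> poly3 {(i, j, m). i + j + m = k}" by (simp add: homogeneous_poly3_def)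
  have PG: "P u = planar G u" if "u \<in> sphere 0 1" for u
    unfolding P_def G_def using H(2)[OF _ that] by (intro sum.cong) auto
  have Pm: "P \<in> borel_measurable borel" by (rule borel_measurable_poly3[OF P3])
  have Hm: "H a \<in> borel_measurable borel" and Bm: "planar (B a) \<in> borel_measurable borel"
    if "a \<in> basis_indices k" for a
    using H(1)[OF that] borel_measurable_continuous_onI[OF continuous_on_bipoly[OF B[OF that]]]
    by (auto simp: homogeneous_poly3_def intro: borel_measurable_poly3)
  note [measurable] = fm Pm Gm

  have H_orth: "(LINT u|sphere_prob \<mu>. H a u * q u) = 0"
    if a: "a \<in> basis_indices k" and q: "q \<in> poly3_degree_less k" for a q
  proof (cases "k = 0")
    \<comment> \<open>No exponents have degree less than 0, so \<open>q\<close> is an empty sum. The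
      bound \<open>k - 1\<close> of the other case would be truncated here.\<close>
    case True
    have "{(i, j, m). i + j + m < (0 :: nat)} = {}" by auto
    hence "q \<in> poly3 {}" using q unfolding poly3_degree_less_def True by (simp only:)
    thus ?thesis by (auto simp: poly3_def)
  next
    case False
    have q3: "q \<in> poly3 {(i, j, m). i + j + m < k}" using q by (simp add: poly3_degree_less_def)
    have "\<And>i j m. (i, j, m) \<in> {(i, j, m). i + j + m < k} \<Longrightarrow> i + j + m \<le> k - 1" by auto
    from poly3_split[OF q3 this] obtain g h where
      gh: "bipoly (k - 1) g" "bipoly (k - 1) h" "\<And>u. u \<in> sphere 0 1 \<Longrightarrow> q u = planar g u + planar h u * u $ 3"
      by blast
    note qm [measurable] = borel_measurable_poly3[OF q3]
    note [measurable] = Hm[OF a] Bm[OF a]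
    have "(LINT u|sphere_prob \<mu>. H a u * q u) = (LINT u|sphere_prob \<mu>. planar (B a) u * q u)"
      by (rule integral_sphere_prob_cong[OF \<mu>]) (measurable, use a H(2) in simp)
    also have "\<dots> = (LINT u|sphere_prob \<mu>. planar (B a) u * planar g u)"
      by (rule integral_even_times_split[OF \<mu> integrable_bipoly[OF \<mu> B[OF a]] AE_bipoly_even gh(1,2) qm gh(3)])
    also have "\<dots> = 0"
      using disk_basis_orthogonal[OF \<mu> gh(1), of k "fst a" "snd a"] a False by (simp add: mean_def B_def mult.commute)
    finally show ?thesis .
  qed
  have Hint: "integrable (sphere_prob \<mu>) (\<lambda>u. H a u * q u)" if "a \<in> basis_indices k" "continuous_on UNIV q" for a q
    using that H(1)[of a] unfolding homogeneous_poly3_def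
    by (intro integrable_sphere_prob_mult_continuous[OF \<mu>] integrable_poly3) auto
  have harmonic: "restrict r (sphere 0 1) \<in> sphere_harmonics \<mu> k"
    if "r \<in> homogeneous_poly3 k" "\<And>q. q \<in> poly3_degree_less k \<Longrightarrow> (LINT u|sphere_prob \<mu>. r u * q u) = 0" for r
    using that unfolding sphere_harmonics_def homogeneous_poly3_def poly3_degree_less_def
    by (intro CollectI exI[of _ r]) (auto simp: sphere_inner_poly3)
  have P_harmonic: "restrict P (sphere 0 1) \<in> sphere_harmonics \<mu> k"
  proof (rule harmonic[OF P])
    fix q assume q: "q \<in> poly3_degree_less k"
    hence "continuous_on UNIV q" unfolding poly3_degree_less_def by (rule continuous_on_poly3)
    hence "(LINT u|sphere_prob \<mu>. P u * q u) = (\<Sum>a\<in>basis_indices k. c a * (LINT u|sphere_prob \<mu>. H a u * q u))"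
      unfolding P_def sum_distrib_right mult.assoc using Hint by (subst Bochner_Integration.integral_sum) auto
    thus "(LINT u|sphere_prob \<mu>. P u * q u) = 0" by (simp add: H_orth[OF _ q])
  qed

  have pair: "sphere_inner \<mu> (\<lambda>x. f x - restrict r (sphere 0 1) x) (restrict q (sphere 0 1)) =
      2 / disk_const \<mu> * (LINT u|sphere_prob \<mu>. (f' u - r u) * q u)"
    if r: "r \<in> homogeneous_poly3 k" and q: "q \<in> homogeneous_poly3 k" for r q
  proof -
    have rm [measurable]: "r \<in> borel_measurable borel" and qm [measurable]: "q \<in> borel_measurable borel"
      using r q unfolding homogeneous_poly3_def by (auto intro: borel_measurable_poly3)
    have sp: "space surface_measure = sphere 0 1" by (simp add: surface_measure_def space_restrict_space)
    have res: "restrict r (sphere 0 1) \<in> borel_measurable surface_measure"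
      using borel_measurable_surface_measure[OF rm] by (subst measurable_cong[of _ _ r]) (auto simp: sp)
    have "AE u in surface_measure. u \<in> sphere 0 1" using AE_space[of surface_measure] by (simp add: sp)
    with ff' have ae: "AE u in surface_measure. f u - restrict r (sphere 0 1) u = f' u - r u"
      by eventually_elim simp
    show ?thesis
      by (rule sphere_inner_eq[OF \<mu> _ qm borel_measurable_diff[OF f res] ae]) simp_all
  qed

  have fG: "integrable (sphere_prob \<mu>) (\<lambda>u. f' u - planar G u)"
    using f' Gint by (rule Bochner_Integration.integrable_diff)
  have fG_even: "AE u in sphere_measure. f' (reflect3 u) - planar G (reflect3 u) = f' u - planar G u"
    using even by eventually_elim (simp add: reflect3_def)
  have fB: "integrable (sphere_prob \<mu>) (\<lambda>u. F u * planar (B a) u)"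
    if "a \<in> basis_indices k" "integrable (sphere_prob \<mu>) F" for a F
    by (intro integrable_sphere_prob_mult_continuous[OF \<mu> that(2)] continuous_on_bipoly[OF B[OF that(1)]])
  have coeff_G: "(LINT u|sphere_prob \<mu>. (f' u - planar G u) * planar (B a) u) = 0"
    if a: "a \<in> basis_indices k" for a
  proof -
    have "(LINT u|sphere_prob \<mu>. planar G u * planar (B a) u) =
        (\<Sum>b\<in>basis_indices k. c b * mean \<mu> (\<lambda>x y. B b x y * B a x y))"
      unfolding G_def sum_distrib_right mult.assoc mean_def
      using integrable_bipoly[OF \<mu> bipoly_mult[OF B B]] a by (subst Bochner_Integration.integral_sum) auto
    also have "\<dots> = (\<Sum>b\<in>basis_indices k. if b = a then c b else 0)"
      using a disk_basis_orthonormal[OF \<mu>, of _ _ k "fst a" "snd a" k]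
      by (intro sum.cong refl) (auto simp: B_def prod_eq_iff)
    also have "\<dots> = c a" using a by (simp add: sum.delta')
    finally show ?thesis
      using fB[OF a f'] fB[OF a Gint] by (simp add: left_diff_distrib c_def B_def)
  qed
  have P_pair: "(LINT u|sphere_prob \<mu>. (f' u - P u) * q u) = 0"
    if q: "q \<in> homogeneous_poly3 k" and orth: "\<And>q'. q' \<in> poly3_degree_less k \<Longrightarrow> sphere_inner \<mu> q q' = 0" for q
  proof -
    have qm [measurable]: "q \<in> borel_measurable borel"
      using q unfolding homogeneous_poly3_def by (rule borel_measurable_poly3)
    from sphere_harmonic_split[OF q orth] obtain g h where
      gh: "bipoly k g" "bipoly k h" "\<And>u. u \<in> sphere 0 1 \<Longrightarrow> q u = planar g u + planar h u * u $ 3"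
      and g: "\<And>x y. g x y = (\<Sum>(l, \<epsilon>)\<in>basis_indices k.
        (LINT u|sphere_prob \<mu>. planar g u * planar (disk_basis \<mu> k l \<epsilon>) u) * disk_basis \<mu> k l \<epsilon> x y)"
      by blast
    define e where "e = (\<lambda>a. LINT u|sphere_prob \<mu>. planar g u * planar (B a) u)"
    have ge: "g x y = (\<Sum>a\<in>basis_indices k. e a * B a x y)" for x y
      using g[of x y] by (simp add: e_def B_def case_prod_unfold)
    have "(LINT u|sphere_prob \<mu>. (f' u - P u) * q u) = (LINT u|sphere_prob \<mu>. (f' u - planar G u) * q u)"
      by (rule integral_sphere_prob_cong[OF \<mu>]) (measurable, auto simp: PG simp del: mem_sphere)
    also have "\<dots> = (LINT u|sphere_prob \<mu>. (f' u - planar G u) * planar g u)"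
      by (rule integral_even_times_split[OF \<mu> fG fG_even gh(1,2) qm gh(3)])
    also have "\<dots> = (\<Sum>a\<in>basis_indices k. e a * (LINT u|sphere_prob \<mu>. (f' u - planar G u) * planar (B a) u))"
      unfolding ge sum_distrib_left mult.left_commute[of _ "e _"]
      using fB[OF _ fG] by (subst Bochner_Integration.integral_sum) auto
    finally show ?thesis by (simp add: coeff_G)
  qed

  have "proj_harmonics \<mu> k f = restrict P (sphere 0 1)"
    unfolding proj_harmonics_def
  proof (rule the_equality)
    show "restrict P (sphere 0 1) \<in> sphere_harmonics \<mu> k \<and>
        (\<forall>q\<in>sphere_harmonics \<mu> k. sphere_inner \<mu> (\<lambda>x. f x - restrict P (sphere 0 1) x) q = 0)"
      using P_harmonic pair[OF P] P_pair unfolding sphere_harmonics_def by auto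
  next
    fix r assume r: "r \<in> sphere_harmonics \<mu> k \<and> (\<forall>q\<in>sphere_harmonics \<mu> k. sphere_inner \<mu> (\<lambda>x. f x - r x) q = 0)"
    then obtain p where p: "r = restrict p (sphere 0 1)" "p \<in> homogeneous_poly3 k"
      "\<And>q. q \<in> poly3_degree_less k \<Longrightarrow> sphere_inner \<mu> p q = 0"
      unfolding sphere_harmonics_def by blast
    have p3: "p \<in> poly3 {(i, j, m). i + j + m = k}" using p(2) by (simp add: homogeneous_poly3_def)
    note pm [measurable] = borel_measurable_poly3[OF p3]
    from sphere_harmonic_split[OF p(2,3)] obtain g h where
      gh: "bipoly k g" "bipoly k h" "\<And>u. u \<in> sphere 0 1 \<Longrightarrow> p u = planar g u + planar h u * u $ 3"
      and g: "\<And>x y. g x y = (\<Sum>(l, \<epsilon>)\<in>basis_indices k.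
        (LINT u|sphere_prob \<mu>. planar g u * planar (disk_basis \<mu> k l \<epsilon>) u) * disk_basis \<mu> k l \<epsilon> x y)"
      by blast
    have orth: "(LINT u|sphere_prob \<mu>. (f' u - p u) * q u) = 0"
      if "q \<in> homogeneous_poly3 k" "restrict q (sphere 0 1) \<in> sphere_harmonics \<mu> k" for q
      using that r pair[OF p(2) that(1)] disk_const_pos[OF \<mu>] unfolding p(1) by auto
    have pint: "integrable (sphere_prob \<mu>) p" by (rule integrable_poly3[OF p3])
    have coeff: "(LINT u|sphere_prob \<mu>. planar g u * planar (B a) u) = c a" if a: "a \<in> basis_indices k" for a
    proof -
      note [measurable] = Hm[OF a] Bm[OF a]
      have "0 = (LINT u|sphere_prob \<mu>. (f' u - p u) * H a u)"
        using orth[OF H(1)[OF a]] harmonic[OF H(1)[OF a] H_orth[OF a]] by simp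
      also have "\<dots> = (LINT u|sphere_prob \<mu>. (f' u - p u) * planar (B a) u)"
        by (rule integral_sphere_prob_cong[OF \<mu>]) (measurable, use a H(2) in simp)
      also have "\<dots> = c a - (LINT u|sphere_prob \<mu>. planar (B a) u * p u)"
        using fB[OF a f'] fB[OF a pint] by (simp add: left_diff_distrib c_def B_def mult.commute)
      also have "(LINT u|sphere_prob \<mu>. planar (B a) u * p u) = (LINT u|sphere_prob \<mu>. planar (B a) u * planar g u)"
        by (rule integral_even_times_split[OF \<mu> integrable_bipoly[OF \<mu> B[OF a]] AE_bipoly_even gh(1,2) pm gh(3)])
      finally show ?thesis by (simp add: mult.commute)
    qed
    have "g x y = G x y" for x y
      using g[of x y] coeff by (simp add: G_def B_def case_prod_unfold)
    hence pP: "p u = planar G u + planar h u * u $ 3" if "u \<in> sphere 0 1" for u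
      using gh(3)[OF that] by simp
    let ?h = "\<lambda>u :: real ^ 3. planar h u * u $ 3"
    have hc: "continuous_on UNIV ?h" by (intro continuous_intros continuous_on_bipoly[OF gh(2)])
    have hm [measurable]: "?h \<in> borel_measurable borel" by (rule borel_measurable_continuous_onI[OF hc])
    have int: "integrable (sphere_prob \<mu>) (\<lambda>u. (f' u - p u) * q u)" if "q \<in> homogeneous_poly3 k" for q
      using that f' pint unfolding homogeneous_poly3_def
      by (intro integrable_sphere_prob_mult_continuous[OF \<mu> Bochner_Integration.integrable_diff] continuous_on_poly3)
    \<comment> \<open>The residual is tested with \<open>p\<close> and with \<open>P\<close>, which
      are both known to be harmonics. On the sphere p - P is x3 h, odd, whereas f' - G is even; only
      the square of x3 h survives.\<close>
    have "0 = (LINT u|sphere_prob \<mu>. (f' u - p u) * p u) - (LINT u|sphere_prob \<mu>. (f' u - p u) * P u)"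
      using r by (subst (1 2) orth) (auto simp: p P P_harmonic)
    also have "\<dots> = (LINT u|sphere_prob \<mu>. (f' u - p u) * p u - (f' u - p u) * P u)"
      by (rule Bochner_Integration.integral_diff[OF int[OF p(2)] int[OF P], symmetric])
    also have "\<dots> = (LINT u|sphere_prob \<mu>. (f' u - planar G u) * ?h u - (?h u)\<^sup>2)"
      by (rule integral_sphere_prob_cong[OF \<mu>])
         (measurable, auto simp: PG pP power2_eq_square algebra_simps simp del: mem_sphere)
    also have "\<dots> = (LINT u|sphere_prob \<mu>. (f' u - planar G u) * ?h u) - (LINT u|sphere_prob \<mu>. (?h u)\<^sup>2)"
      by (intro Bochner_Integration.integral_diff integrable_sphere_prob_mult_continuous[OF \<mu> fG hc]
          integrable_sphere_prob_continuous[OF \<mu>] continuous_intros hc)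
    also have "(LINT u|sphere_prob \<mu>. (f' u - planar G u) * ?h u) = 0"
      by (rule integral_even_times_odd[OF \<mu> _ fG_even gh(2)]) measurable
    finally have "(LINT u|sphere_prob \<mu>. (?h u)\<^sup>2) = 0" by simp
    hence "h x y = 0" for x y by (rule integral_sphere_prob_square3[OF \<mu> gh(2)])
    hence "p u = P u" if "u \<in> sphere 0 1" for u using pP[OF that] PG[OF that] by simp
    thus "r = restrict P (sphere 0 1)" unfolding p(1) by (intro restrict_ext) auto
  qed
  also have "restrict P (sphere 0 1) = restrict (planar G) (sphere 0 1)"
    by (intro restrict_ext PG)
  finally show ?thesis by (simp add: G_def c_def B_def case_prod_unfold)
qed

text \<open>The weighted measure is finite and |f'| is at most 1 + f'^2.\<close>

lemma sphere_L2_integrable: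
  assumes f: "f \<in> sphere_L2 \<mu>" and [measurable]: "f' \<in> borel_measurable borel" and ff': "AE u in surface_measure. f u = f' u"
  shows "integrable (sphere_prob \<mu>) f'"
proof -
  have fm: "f \<in> borel_measurable surface_measure" and fi: "integrable surface_measure (\<lambda>u. (f u)\<^sup>2 * sphere_weight \<mu> u)"
    using f by (auto simp: sphere_L2_def)
  have "integrable surface_measure (\<lambda>u. (f' u)\<^sup>2 * sphere_weight \<mu> u)"
    using fi
  proof (rule integrable_cong_AE_imp)
    show "(\<lambda>u. (f' u)\<^sup>2 * sphere_weight \<mu> u) \<in> borel_measurable surface_measure"
      by (intro borel_measurable_surface_measure) measurable
    show "AE u in surface_measure. (f u)\<^sup>2 * sphere_weight \<mu> u = (f' u)\<^sup>2 * sphere_weight \<mu> u"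
      using ff' by eventually_elim simp
  qed
  hence "integrable sphere_measure (\<lambda>u. (f' u)\<^sup>2 * sphere_weight \<mu> u)"
    by (subst (asm) integrable_surface_measure) auto
  hence sq: "integrable (sphere_prob \<mu>) (\<lambda>u. (f' u)\<^sup>2)"
    by (subst integrable_sphere_prob[OF \<mu>]) auto
  have "integrable (sphere_prob \<mu>) (\<lambda>u. 1 + (f' u)\<^sup>2)"
    using sq integrable_sphere_prob_continuous[OF \<mu>, of "\<lambda>_. 1"] by (intro Bochner_Integration.integrable_add) auto
  thus ?thesis
  proof (rule Bochner_Integration.integrable_bound)
    show "AE u in sphere_prob \<mu>. norm (f' u) \<le> norm (1 + (f' u)\<^sup>2)"
    proof (intro AE_I2)
      fix u
      have "0 \<le> (\<bar>f' u\<bar> - 1/2)\<^sup>2" by simp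
      hence "\<bar>f' u\<bar> \<le> 1 + (f' u)\<^sup>2" by (simp add: power2_eq_square algebra_simps)
      thus "norm (f' u) \<le> norm (1 + (f' u)\<^sup>2)" by simp
    qed
  qed simp
qed

end

theorem corollary3p3:
  fixes \<mu> :: real and n :: nat and f :: "real ^ 3 \<Rightarrow> real" and x :: "real ^ 3"
  assumes "\<mu> \<ge> 0"
    and "f \<in> sphere_L2 \<mu>"
    and "AE u in surface_measure. f u = f (vector [u $ 1, u $ 2, - u $ 3])"
    and "x \<in> sphere 0 1"
  shows "partial_sum \<mu> n f x =
      1 / (real n + 1) * (\<Sum>\<nu>=0..n. disk_const \<mu> * (LINT t:{-1..1}|lebesgue.
        spherical_transform \<mu> f (equator_point (view_angle n \<nu>)) t *
        kernel_Phi \<mu> n (view_angle n \<nu>) t (x $ 1) (x $ 2)))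
    \<and> partial_sum \<mu> n f x =
      1 / (2 * real n + 2) * (\<Sum>\<nu>=0..2 * n + 1. disk_const \<mu> * (LINT t:{-1..1}|lebesgue.
        spherical_transform \<mu> f (equator_point (view_angle n \<nu>)) t *
        kernel_Phi \<mu> n (view_angle n \<nu>) t (x $ 1) (x $ 2)))"
proof -
  note \<mu> = assms(1)
  have fm: "f \<in> borel_measurable surface_measure" using assms(2) by (simp add: sphere_L2_def)
  obtain f' where f'm [measurable]: "f' \<in> borel_measurable borel" and ff': "AE u in surface_measure. f u = f' u"
    by (rule surface_measurable_representative[OF fm])
  have f': "integrable (sphere_prob \<mu>) f'" by (rule sphere_L2_integrable[OF \<mu> assms(2) f'm ff'])
  \<comment> \<open>\<open>f\<close> and \<open>f'\<close> agree off a null set that the reflected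
    point has to avoid as well; hence the use of the invariance of the measure.\<close>
  have even: "AE u in sphere_measure. f' (reflect3 u) = f' u"
  proof -
    have 1: "AE u in sphere_measure. f u = f' u" by (rule AE_surface_measureD[OF ff'])
    hence "AE u in distr sphere_measure borel reflect3. f u = f' u" by (simp only: sphere_measure_reflect)
    hence 2: "AE u in sphere_measure. f (reflect3 u) = f' (reflect3 u)"
      by (rule AE_distrD[rotated]) simp
    have 3: "AE u in sphere_measure. f u = f (reflect3 u)"
      unfolding reflect3_def by (rule AE_surface_measureD[OF assms(3)])
    show ?thesis using 1 2 3 by eventually_elim simp
  qed
  define S where "S = (\<Sum>k\<le>n. \<Sum>(l, \<epsilon>)\<in>basis_indices k.
     (LINT v|sphere_prob \<mu>. f' v * planar (disk_basis \<mu> k l \<epsilon>) v) * disk_basis \<mu> k l \<epsilon> (x $ 1) (x $ 2))"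
  have "partial_sum \<mu> n f x = S"
    unfolding partial_sum_def S_def atLeast0AtMost proj_harmonics_eq[OF \<mu> fm ff' f' even]
    using assms(4) by (simp del: mem_sphere)
  \<comment> \<open>Both formulas are averages over N directions, with N = n + 1 or N = 2 n + 2.
    Since either node set is exact, both give \<open>S\<close>.\<close>
  moreover have "(\<Sum>\<nu><N. disk_const \<mu> * (LINT t:{-1..1}|lebesgue.
        spherical_transform \<mu> f (equator_point (view_angle n \<nu>)) t *
        kernel_Phi \<mu> n (view_angle n \<nu>) t (x $ 1) (x $ 2))) = real N * S"
    if N: "N \<in> {n + 1, 2 * n + 2}" for N
  proof -
    define \<Phi> where "\<Phi> = (\<lambda>\<nu> t. kernel_Phi \<mu> n (view_angle n \<nu>) t (x $ 1) (x $ 2))"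
    have \<Phi>c: "continuous_on UNIV (\<Phi> \<nu>)" for \<nu>
      unfolding \<Phi>_def kernel_Phi_def by (intro continuous_intros)
    have height: "continuous_on UNIV (\<lambda>u :: real ^ 3. \<Phi> \<nu> (u $ 1 * cos (view_angle n \<nu>) + u $ 2 * sin (view_angle n \<nu>)))" for \<nu>
      by (rule continuous_on_compose2[OF \<Phi>c _ subset_UNIV]) (intro continuous_intros)
    have fB: "integrable (sphere_prob \<mu>) (\<lambda>u. f' u * planar (disk_basis \<mu> k l \<epsilon>) u)"
      if "(l, \<epsilon>) \<in> basis_indices k" for k l \<epsilon>
      by (intro integrable_sphere_prob_mult_continuous[OF \<mu> f'] continuous_on_bipoly[OF bipoly_disk_basis[OF \<mu> that]])
    have "(\<Sum>\<nu><N. disk_const \<mu> * (LINT t:{-1..1}|lebesgue.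
        spherical_transform \<mu> f (equator_point (view_angle n \<nu>)) t * \<Phi> \<nu> t)) =
      (\<Sum>\<nu><N. (LINT u|sphere_prob \<mu>. f' u * \<Phi> \<nu> (u $ 1 * cos (view_angle n \<nu>) + u $ 2 * sin (view_angle n \<nu>))))"
    proof (intro sum.cong refl)
      fix \<nu> assume "\<nu> \<in> {..<N}"
      hence "real \<nu> \<le> 2 * (real n + 1)" using N by auto
      hence "real \<nu> * pi \<le> 2 * (real n + 1) * pi" by (intro mult_right_mono) auto
      hence "0 \<le> view_angle n \<nu>" "view_angle n \<nu> \<le> 2 * pi"
        by (auto simp: view_angle_def divide_simps mult_ac)
      thus "disk_const \<mu> * (LINT t:{-1..1}|lebesgue. spherical_transform \<mu> f (equator_point (view_angle n \<nu>)) t * \<Phi> \<nu> t) =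
          (LINT u|sphere_prob \<mu>. f' u * \<Phi> \<nu> (u $ 1 * cos (view_angle n \<nu>) + u $ 2 * sin (view_angle n \<nu>)))"
        by (rule integral_spherical_transform[OF \<mu> f'm ff' f' \<Phi>c])
    qed
    also have "\<dots> = (LINT u|sphere_prob \<mu>. (\<Sum>\<nu><N. f' u * \<Phi> \<nu> (u $ 1 * cos (view_angle n \<nu>) + u $ 2 * sin (view_angle n \<nu>))))"
      by (rule Bochner_Integration.integral_sum[symmetric]) (rule integrable_sphere_prob_mult_continuous[OF \<mu> f' height])
    \<comment> \<open>The directions now occur only in the average of the kernels, taken at (a, b) =
      (u1, u2), which is N times the reproducing kernel.\<close>
    also have "\<dots> = (LINT u|sphere_prob \<mu>. (\<Sum>k\<le>n. \<Sum>p\<in>basis_indices k.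
        (f' u * planar (disk_basis \<mu> k (fst p) (snd p)) u) * (real N * disk_basis \<mu> k (fst p) (snd p) (x $ 1) (x $ 2))))"
      unfolding sum_distrib_left[symmetric] \<Phi>_def kernel_Phi_average[OF \<mu> N]
      by (simp add: sum_distrib_left case_prod_unfold mult_ac)
    also have "\<dots> = (\<Sum>k\<le>n. \<Sum>p\<in>basis_indices k.
        (LINT u|sphere_prob \<mu>. f' u * planar (disk_basis \<mu> k (fst p) (snd p)) u) * (real N * disk_basis \<mu> k (fst p) (snd p) (x $ 1) (x $ 2)))"
      using fB by (subst Bochner_Integration.integral_sum; (subst Bochner_Integration.integral_sum)?)
        (auto intro!: Bochner_Integration.integrable_sum)
    also have "\<dots> = real N * S"
      by (simp add: S_def sum_distrib_left case_prod_unfold mult_ac)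
    finally show ?thesis by (simp add: \<Phi>_def)
  qed
  note avg = this[of "n + 1"] this[of "2 * n + 2"]
  moreover have "{0..n} = {..<n + 1}" "{0..2 * n + 1} = {..<2 * n + 2}" by auto
  ultimately show ?thesis by (simp add: field_simps del: sum.lessThan_Suc)
qed

end
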